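(* Let $p\in P^{Log}$, $k\in\mathbb{N}$ and $r\in\{0\}\cup\mathbb{N}$. There is a constant $C>0$ depending only on $p,k,r$ such that for every $\sigma>0$ and every $f\in W_r^{p(\cdot)}$, $$A_\sigma(f)_{p(\cdot)}\le C\,\Omega_k\Big(f,\frac1\sigma\Big)_{p(\cdot)}\quad\text{and}\quad A_\sigma(f)_{p(\cdot)}\le \frac{C}{\sigma^r}\,\Omega_k\Big(f^{(r)},\frac1\sigma\Big)_{p(\cdot)}.$$
   Context: $P$ is the class of measurable functions $p:\mathbb{R}\to[1,\infty)$ with $1\le \operatorname{ess\,inf}_{x\in\mathbb{R}}p(x)$ and $\operatorname{ess\,sup}_{x\in\mathbb{R}}p(x)<\infty$. $P^{Log}$ is the class of $p\in P$ for which there exist constants $c_1,c_2>0$ and $c_3\in\mathbb{R}$ with $|p(x)-p(y)|\ln(e+1/|x-y|)\le c_1$ for all $x,y\in\mathbb{R}$ and $|p(x)-c_3|\ln(e+|x|)\le c_2$ for all $x\in\mathbb{R}$. For $p\in P$, $L^{p(\cdot)}=L^{p(\cdot)}(\mathbb{R})$ is the Banach space of measurable $f:\mathbb{R}\to\mathbb{C}$ with $I_{p(\cdot)}(f/\lambda):=\int_{\mathbb{R}}|f(y)/\lambda|^{p(y)}dy<\infty$ for some $\lambda>0$, with norm $\|f\|_{p(\cdot)}=\inf\{\eta>0: I_{p(\cdot)}(f/\eta)<1\}$. For $r\in\mathbb{N}=\{1,2,\dots\}$, $W_r^{p(\cdot)}$ is the class of $f\in L^{p(\cdot)}$ such that $f^{(r-1)}$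 is absolutely continuous and $f^{(r)}\in L^{p(\cdot)}$; for $r=0$, $W_0^{p(\cdot)}=L^{p(\cdot)}$ and $f^{(0)}=f$. For $\sigma>0$, $\mathcal{G}_{\sigma,p(\cdot)}$ is the class of entire functions of exponential type $\le\sigma$ (whose restrictions to $\mathbb{R}$ are) belonging to $L^{p(\cdot)}$, and $A_\sigma(f)_{p(\cdot)}:=\inf\{\|f-g\|_{p(\cdot)}: g\in\mathcal{G}_{\sigma,p(\cdot)}\}$. For $\delta>0$, $T_\delta f(x):=\frac1\delta\int_0^\delta f(x+t)\,dt$, $I$ is the identity operator, and $\Omega_k(f,\delta)_{p(\cdot)}:=\|(I-T_\delta)^kf\|_{p(\cdot)}$. *)

theory Defs
  imports "HOL-Complex_Analysis.Complex_Analysis" "HOL-Probability.Essential_Supremum"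
begin

text \<open>Measurability and integrals on the real line refer to \<^const>\<open>lebesgue\<close>, the completion
  of the Borel--Lebesgue measure. Elements of function spaces are genuine functions, not classes
  modulo null sets.\<close>

definition essinf_real :: "(real \<Rightarrow> real) \<Rightarrow> ereal" where
  "essinf_real p = - esssup lebesgue (\<lambda>x. - ereal (p x))"

definition exponents :: "(real \<Rightarrow> real) set" where
  "exponents = {p. p \<in> borel_measurable lebesgue \<and> (\<forall>x. 1 \<le> p x) \<and>
     1 \<le> essinf_real p \<and> esssup lebesgue (\<lambda>x. ereal (p x)) < \<infinity>}"

text \<open>For \<open>x = y\<close> the first inequality is trivially true, since \<open>1 / 0 = 0\<close> and the first factor
  vanishes.\<close>

definition log_exponents :: "(real \<Rightarrow> real) set" where
  "log_exponents = {p \<in> exponents. \<exists>c1 c2 c3 :: real. c1 > 0 \<and> c2 > 0 \<and>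
     (\<forall>x y. \<bar>p x - p y\<bar> * ln (exp 1 + 1 / \<bar>x - y\<bar>) \<le> c1) \<and>
     (\<forall>x. \<bar>p x - c3\<bar> * ln (exp 1 + \<bar>x\<bar>) \<le> c2)}"

definition modular :: "(real \<Rightarrow> real) \<Rightarrow> (real \<Rightarrow> complex) \<Rightarrow> ennreal" where
  "modular p f = (\<integral>\<^sup>+ y. ennreal (cmod (f y) powr p y) \<partial>lebesgue)"

definition Lp_var :: "(real \<Rightarrow> real) \<Rightarrow> (real \<Rightarrow> complex) set" where
  "Lp_var p = {f \<in> borel_measurable lebesgue.
     \<exists>l::real. l > 0 \<and> modular p (\<lambda>y. f y / of_real l) < \<infinity>}"

definition norm_var :: "(real \<Rightarrow> real) \<Rightarrow> (real \<Rightarrow> complex) \<Rightarrow> real" where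
  "norm_var p f = Inf {\<eta>::real. \<eta> > 0 \<and> modular p (\<lambda>y. f y / of_real \<eta>) < 1}"

text \<open>At a point where the \<open>(n - 1)\<close>-st derivative is not differentiable, the value below is an
  unspecified constant; for members of the Sobolev class this concerns only the
  top-order derivative, on a null set.\<close>

definition nth_deriv :: "nat \<Rightarrow> (real \<Rightarrow> complex) \<Rightarrow> real \<Rightarrow> complex" where
  "nth_deriv n f = ((\<lambda>h x. vector_derivative h (at x)) ^^ n) f"

definition abs_cont_on :: "real \<Rightarrow> real \<Rightarrow> (real \<Rightarrow> complex) \<Rightarrow> bool" where
  "abs_cont_on a b f \<longleftrightarrow> (\<forall>\<epsilon>>0. \<exists>\<delta>>0. \<forall>(n::nat) (u::nat \<Rightarrow> real) v.
     (\<forall>i<n. a \<le> u i \<and> u i \<le> v i \<and> v i \<le> b) \<longrightarrow>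
     disjoint_family_on (\<lambda>i. {u i <..< v i}) {..<n} \<longrightarrow>
     (\<Sum>i<n. v i - u i) < \<delta> \<longrightarrow> (\<Sum>i<n. cmod (f (v i) - f (u i))) < \<epsilon>)"

text \<open>Absolute continuity on the line is meant on every compact interval. Since the derivative is
  moreover required to lie in \<open>L\<^sup>p\<^sup>(\<^sup>\<cdot>\<^sup>)\<close>, hence in \<open>L\<^sup>1 + L\<^sup>q\<close> with \<open>q = ess sup p\<close>, this gives the same
  Sobolev class as absolute continuity with a uniform \<open>\<delta>\<close> on the whole line.\<close>

definition abs_cont :: "(real \<Rightarrow> complex) \<Rightarrow> bool" where
  "abs_cont f \<longleftrightarrow> (\<forall>a b. a \<le> b \<longrightarrow> abs_cont_on a b f)"

definition sobolev_var :: "nat \<Rightarrow> (real \<Rightarrow> real) \<Rightarrow> (real \<Rightarrow> complex) set" where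
  "sobolev_var r p = {f \<in> Lp_var p. r \<ge> 1 \<longrightarrow>
     (\<forall>j<r - 1. \<forall>x. nth_deriv j f differentiable (at x)) \<and>
     abs_cont (nth_deriv (r - 1) f) \<and>
     nth_deriv r f \<in> Lp_var p}"

definition exp_type_le :: "real \<Rightarrow> (complex \<Rightarrow> complex) \<Rightarrow> bool" where
  "exp_type_le \<sigma> g \<longleftrightarrow>
     (\<forall>\<epsilon>>0. \<exists>A. \<forall>z. cmod (g z) \<le> A * exp ((\<sigma> + \<epsilon>) * cmod z))"

definition exp_type_class :: "real \<Rightarrow> (real \<Rightarrow> real) \<Rightarrow> (complex \<Rightarrow> complex) set" where
  "exp_type_class \<sigma> p = {g. g holomorphic_on UNIV \<and> exp_type_le \<sigma> g \<and>
     (\<lambda>x. g (of_real x)) \<in> Lp_var p}"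

definition best_approx :: "real \<Rightarrow> (real \<Rightarrow> real) \<Rightarrow> (real \<Rightarrow> complex) \<Rightarrow> real" where
  "best_approx \<sigma> p f =
     Inf ((\<lambda>g. norm_var p (\<lambda>x. f x - g (of_real x))) ` exp_type_class \<sigma> p)"

definition steklov :: "real \<Rightarrow> (real \<Rightarrow> complex) \<Rightarrow> real \<Rightarrow> complex" where
  "steklov \<delta> f x = of_real (1 / \<delta>) * (LINT t:{0..\<delta>}|lebesgue. f (x + t))"

definition mod_smooth :: "nat \<Rightarrow> (real \<Rightarrow> real) \<Rightarrow> (real \<Rightarrow> complex) \<Rightarrow> real \<Rightarrow> real" where
  "mod_smooth k p f \<delta> = norm_var p (((\<lambda>h x. h x - steklov \<delta> h x) ^^ k) f)"

end

theory Submission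
  imports Defs "HOL-Probability.Sinc_Integral" "HOL-Real_Asymp.Real_Asymp"
begin

text \<open>Put \<open>\<delta> = 1 / \<sigma>\<close> and \<open>T = T\<^sub>\<delta>\<close>. The approximants come from a convolution operator \<open>V\<close> whose
  kernel is a power of \<open>sin z / z\<close>, normalised to have integral 1 and dilated to exponential type
  \<open>\<sigma>\<close>: \<open>V\<close> maps every function of moderate growth to an entire function of type at most \<open>\<sigma>\<close>. As
  \<open>f - (I - V)\<^sup>n f\<close> is \<open>V\<close> applied to some function and \<open>V\<close> is bounded on \<open>L\<^sup>p\<^sup>(\<^sup>\<cdot>\<^sup>)\<close>, this difference
  is an admissible approximant, and the best approximation is at most the norm of \<open>(I - V)\<^sup>n f\<close>. It remains to compare \<open>I - V\<close> with \<open>I - T\<close> and with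
  differentiation, which is done by two factorizations into convolution operators with rapidly
  decaying kernels.

  The first one is \<open>I - V = (I + K) (I - T)\<close>. The measure \<open>\<delta>\<^sub>0\<close> minus the uniform distribution on
  \<open>[0,1]\<close> has the inverse \<open>\<delta>\<^sub>0 + u\<close>, where \<open>u\<close> is the renewal density of the uniform distribution, the
  sum of all its convolution powers. The density \<open>u\<close> is not integrable, but beyond \<open>1\<close> it equals its
  own average over the preceding unit interval, and this forces it to converge exponentially fast
  to a constant. As \<open>V\<close> has integral 1, the correction \<open>u - u * V\<close> decays at both ends of the line,
  so that \<open>K = u - V - u * V\<close> is a decaying kernel (\<open>renewal_kernel\<close>).

  The second one is \<open>(I - V) f = \<delta> W f'\<close>, where the kernel of \<open>W\<close> consists of the two tails of \<open>V\<close>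
  (\<open>density_tail_identity\<close>). All these operators commute, hence
  \<open>(I - V)\<^sup>k\<^sup>+\<^sup>r f = \<delta>\<^sup>r W\<^sup>r (I + K)\<^sup>k (I - T)\<^sup>k f\<^sup>(\<^sup>r\<^sup>)\<close> and \<open>(I - V)\<^sup>k f = (I + K)\<^sup>k (I - T)\<^sup>k f\<close>. The derivatives of
  order strictly between \<open>0\<close> and \<open>r\<close> enter only through this algebra. It takes place in
  polynomially weighted \<open>L\<^sup>1\<close> spaces, where integrating \<open>f\<^sup>(\<^sup>r\<^sup>)\<close> gives all of them for free
  (\<open>density_wL1\<close>).

  Both inequalities now follow once convolution with a dilated decaying kernel is bounded on
  \<open>L\<^sup>p\<^sup>(\<^sup>\<cdot>\<^sup>)\<close> uniformly in the dilation (\<open>dconv_modular_dom\<close>). This is where log-Hoelder continuity enters: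
  the local condition controls the part of \<open>f\<close> with \<open>\<bar>f\<bar> > 1\<close> (\<open>large_values_average\<close>) and the condition at
  infinity controls the rest (\<open>small_values_average\<close>, \<open>powr_compare\<close>), also when the exponent takes the
  value \<open>1\<close>, where the maximal operator is unbounded.

  Finally, \<open>f\<^sup>(\<^sup>r\<^sup>)\<close> is only given as the almost everywhere derivative of an absolutely continuous
  function, so the fundamental theorem of calculus is needed for such functions
  (\<open>abs_cont_FTC\<close>). The positive variation writes them as a difference of monotone ones, whose
  Stieltjes measures have densities by the Radon-Nikodym theorem; Lebesgue's differentiation
  theorem identifies the density with the derivative.\<close>

section \<open>Dilated convolution on weighted \<open>L\<^sup>1\<close> spaces\<close>

definition weight :: "nat \<Rightarrow> real \<Rightarrow> real" where
  "weight N t = 1 / (1 + \<bar>t\<bar>) ^ N"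

lemma weight_measurable [measurable]: "weight N \<in> borel_measurable borel"
  unfolding weight_def by measurable

lemma weight_pos [simp]: "0 < weight N t"
  unfolding weight_def by (auto intro!: zero_less_power)

lemma weight_nonneg [simp]: "0 \<le> weight N t"
  by (rule less_imp_le[OF weight_pos])

lemma weight_antimono: "N \<le> M \<Longrightarrow> weight M t \<le> weight N t"
  unfolding weight_def by (auto intro!: divide_left_mono power_increasing zero_less_power)

lemma weight_mult_power: "weight (N + M) t * (1 + \<bar>t\<bar>) ^ N = weight M t"
proof -
  have "(1 + \<bar>t\<bar>) ^ N \<noteq> 0" by auto
  then show ?thesis unfolding weight_def by (simp add: power_add)
qed

text \<open>A submultiplicativity: \<open>1 + \<bar>v\<bar>\<close> is at most \<open>(1 + \<bar>v - u\<bar>) (1 + \<bar>u\<bar>)\<close>.\<close>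

lemma weight_shift:
  "weight N u \<le> (1 + \<bar>v - u\<bar>) ^ N * weight N v"
proof -
  have "1 + \<bar>v\<bar> \<le> (1 + \<bar>v - u\<bar>) * (1 + \<bar>u\<bar>)"
  proof -
    have "\<bar>v\<bar> \<le> \<bar>v - u\<bar> + \<bar>u\<bar>" by linarith
    moreover have "0 \<le> \<bar>v - u\<bar> * \<bar>u\<bar>" by simp
    moreover have "(1 + \<bar>v - u\<bar>) * (1 + \<bar>u\<bar>) = 1 + \<bar>u\<bar> + \<bar>v - u\<bar> + \<bar>v - u\<bar> * \<bar>u\<bar>"
      by (simp add: distrib_left distrib_right)
    ultimately show ?thesis by linarith
  qed
  then have "(1 + \<bar>v\<bar>) ^ N \<le> (1 + \<bar>v - u\<bar>) ^ N * (1 + \<bar>u\<bar>) ^ N"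
    by (metis abs_ge_zero add_nonneg_nonneg power_mono power_mult_distrib zero_le_one)
  moreover have "0 < (1 + \<bar>u\<bar>) ^ N" "0 < (1 + \<bar>v\<bar>) ^ N" by (auto intro!: zero_less_power)
  ultimately show ?thesis unfolding weight_def by (simp add: field_simps)
qed

lemma weight_scale:
  assumes "0 \<le> d"
  shows "weight N t \<le> (1 + d) ^ N * weight N (d * t)"
proof -
  have "1 + \<bar>d * t\<bar> \<le> (1 + d) * (1 + \<bar>t\<bar>)"
    using assms by (simp add: algebra_simps abs_mult)
  then have "(1 + \<bar>d * t\<bar>) ^ N \<le> (1 + d) ^ N * (1 + \<bar>t\<bar>) ^ N"
    by (metis abs_ge_zero add_nonneg_nonneg power_mono power_mult_distrib zero_le_one)
  moreover have "0 < (1 + \<bar>t\<bar>) ^ N" "0 < (1 + \<bar>d * t\<bar>) ^ N" by (auto intro!: zero_less_power)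
  ultimately show ?thesis unfolding weight_def by (simp add: field_simps)
qed

lemma weight_affine:
  assumes "0 \<le> d"
  shows "weight N t \<le> ((1 + \<bar>x\<bar>) * (1 + d)) ^ N * weight N (x + d * t)"
proof -
  have "weight N t \<le> (1 + d) ^ N * weight N (d * t)" by (rule weight_scale[OF assms])
  also have "\<dots> \<le> (1 + d) ^ N * ((1 + \<bar>x\<bar>) ^ N * weight N (x + d * t))"
    using assms weight_shift[of N "d * t" "x + d * t"] by (intro mult_left_mono) auto
  finally show ?thesis by (simp add: power_mult_distrib mult_ac)
qed

lemma integrable_weight:
  assumes "2 \<le> N"
  shows "integrable lborel (weight N)"
proof (rule Bochner_Integration.integrable_bound)
  have "set_integrable lborel (einterval (-\<infinity>) \<infinity>) (\<lambda>x::real. inverse (1 + x^2))"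
    by (rule Sinc_Integral.integrable_inverse_1_plus_square)
  then show "integrable lborel (\<lambda>x::real. inverse (1 + x^2))"
    by (simp add: set_integrable_def einterval_eq_UNIV)
  show "AE t in lborel. norm (weight N t) \<le> norm (inverse (1 + t\<^sup>2))"
  proof (rule AE_I2)
    fix t :: real
    have "weight N t \<le> weight 2 t" by (rule weight_antimono[OF assms])
    also have "\<dots> \<le> inverse (1 + t\<^sup>2)"
      unfolding weight_def inverse_eq_divide
      by (intro divide_left_mono mult_pos_pos zero_less_power)
         (auto simp: power2_eq_square algebra_simps add_pos_nonneg)
    finally show "norm (weight N t) \<le> norm (inverse (1 + t\<^sup>2))"
      by (simp add: add_nonneg_nonneg)
  qed
qed simp

text \<open>The weight of order 2 is the weakest integrable one among the integral orders, so its mass is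
  the constant in most estimates.\<close>

definition weight_mass :: real where "weight_mass = (LINT t|lborel. weight 2 t)"

lemma weight_mass_nn: "(\<integral>\<^sup>+t. ennreal (weight 2 t) \<partial>lborel) = ennreal weight_mass"
  unfolding weight_mass_def by (rule nn_integral_eq_integral) (auto intro: integrable_weight)

lemma weight_mass_pos: "0 < weight_mass"
proof -
  have "0 \<le> weight_mass" unfolding weight_mass_def by (rule integral_nonneg_AE) simp
  moreover have "weight_mass \<noteq> 0"
  proof
    assume "weight_mass = 0"
    then have "AE t in lborel. weight 2 t = 0"
      unfolding weight_mass_def by (subst (asm) integral_nonneg_eq_0_iff_AE) (auto intro: integrable_weight)
    moreover have "weight 2 t \<noteq> 0" for t by (metis weight_pos less_irrefl)
    ultimately show False by (auto simp: eventually_ae_filter null_sets_def top_unique)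
  qed
  ultimately show ?thesis by simp
qed

text \<open>After exchanging the integrals and translating, a shift by \<open>d * t\<close> costs a factor
  \<open>(1 + \<bar>t\<bar>) ^ N\<close>, which lowers the weight of order \<open>N + 2\<close> to the integrable one of order 2. For
  \<open>N = 0\<close> the bound does not depend on \<open>d\<close>.\<close>

lemma nn_integral_conv_weight:
  fixes g :: "real \<Rightarrow> ennreal"
  assumes [measurable]: "g \<in> borel_measurable borel" and "0 \<le> d"
  shows "(\<integral>\<^sup>+x. ennreal (weight N x) * (\<integral>\<^sup>+t. ennreal (weight (N + 2) t) * g (x + d * t) \<partial>lborel) \<partial>lborel)
    \<le> ennreal ((1 + d) ^ N * weight_mass) * (\<integral>\<^sup>+y. ennreal (weight N y) * g y \<partial>lborel)" (is "?l \<le> _ * ?I")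
proof -
  have "?l = (\<integral>\<^sup>+x. (\<integral>\<^sup>+t. ennreal (weight N x) * (ennreal (weight (N + 2) t) * g (x + d * t)) \<partial>lborel) \<partial>lborel)"
    by (intro nn_integral_cong nn_integral_cmult[symmetric]) measurable
  also have "\<dots> = (\<integral>\<^sup>+t. (\<integral>\<^sup>+x. ennreal (weight N x) * (ennreal (weight (N + 2) t) * g (x + d * t)) \<partial>lborel) \<partial>lborel)"
    by (rule lborel_pair.Fubini') measurable
  also have "\<dots> \<le> (\<integral>\<^sup>+t. ennreal ((1 + d) ^ N * weight 2 t) * ?I \<partial>lborel)"
  proof (rule nn_integral_mono)
    fix t :: real
    have "(\<integral>\<^sup>+x. ennreal (weight N x) * (ennreal (weight (N + 2) t) * g (x + d * t)) \<partial>lborel)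
      = (\<integral>\<^sup>+y. ennreal (weight N (y - d * t)) * (ennreal (weight (N + 2) t) * g y) \<partial>lborel)"
      by (subst nn_integral_real_affine[where c = 1 and t = "- d * t"]) (auto simp: algebra_simps)
    also have "\<dots> \<le> (\<integral>\<^sup>+y. ennreal ((1 + d) ^ N * weight 2 t) * (ennreal (weight N y) * g y) \<partial>lborel)"
    proof (rule nn_integral_mono)
      fix y :: real
      have "weight N (y - d * t) * weight (N + 2) t \<le> ((1 + \<bar>d * t\<bar>) ^ N * weight N y) * weight (N + 2) t"
        using weight_shift[of N "y - d * t" y] by (intro mult_right_mono) auto
      also have "\<dots> \<le> (((1 + d) * (1 + \<bar>t\<bar>)) ^ N * weight N y) * weight (N + 2) t"
        using \<open>0 \<le> d\<close> by (intro mult_right_mono power_mono) (auto simp: algebra_simps abs_mult)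
      also have "\<dots> = (1 + d) ^ N * weight 2 t * weight N y"
        by (subst weight_mult_power[of N 2 t, symmetric]) (simp add: power_mult_distrib mult_ac)
      finally have "ennreal (weight N (y - d * t) * weight (N + 2) t) \<le> ennreal ((1 + d) ^ N * weight 2 t * weight N y)"
        by (rule ennreal_leI)
      then have "ennreal (weight N (y - d * t) * weight (N + 2) t) * g y \<le> ennreal ((1 + d) ^ N * weight 2 t * weight N y) * g y"
        by (rule mult_right_mono) simp
      moreover have "ennreal (weight N (y - d * t)) * (ennreal (weight (N + 2) t) * g y)
          = ennreal (weight N (y - d * t) * weight (N + 2) t) * g y"
        by (simp add: ennreal_mult mult_ac)
      moreover have "ennreal ((1 + d) ^ N * weight 2 t) * (ennreal (weight N y) * g y)
          = ennreal ((1 + d) ^ N * weight 2 t * weight N y) * g y"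
        using \<open>0 \<le> d\<close> by (simp add: ennreal_mult mult_ac)
      ultimately show "ennreal (weight N (y - d * t)) * (ennreal (weight (N + 2) t) * g y)
        \<le> ennreal ((1 + d) ^ N * weight 2 t) * (ennreal (weight N y) * g y)" by simp
    qed
    also have "\<dots> = ennreal ((1 + d) ^ N * weight 2 t) * ?I"
      by (rule nn_integral_cmult) measurable
    finally show "(\<integral>\<^sup>+x. ennreal (weight N x) * (ennreal (weight (N + 2) t) * g (x + d * t)) \<partial>lborel)
      \<le> ennreal ((1 + d) ^ N * weight 2 t) * ?I" .
  qed
  also have "\<dots> = (\<integral>\<^sup>+t. ennreal ((1 + d) ^ N * weight 2 t) \<partial>lborel) * ?I"
    by (rule nn_integral_multc) measurable
  also have "(\<integral>\<^sup>+t. ennreal ((1 + d) ^ N * weight 2 t) \<partial>lborel) = ennreal ((1 + d) ^ N * weight_mass)"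
    using \<open>0 \<le> d\<close> weight_mass_pos
    by (subst ennreal_mult) (auto simp: nn_integral_cmult weight_mass_nn ennreal_mult)
  finally show ?thesis .
qed

definition decays :: "nat \<Rightarrow> (real \<Rightarrow> real) \<Rightarrow> bool" where
  "decays M K \<longleftrightarrow> K \<in> borel_measurable borel \<and> (\<exists>C. \<forall>t. \<bar>K t\<bar> \<le> C * weight M t)"

definition wL1 :: "nat \<Rightarrow> (real \<Rightarrow> complex) set" where
  "wL1 N = {f \<in> borel_measurable borel. integrable lborel (\<lambda>t. weight N t * cmod (f t))}"

text \<open>The kernel is applied in the unscaled variable: the step \<open>d\<close> sits in the argument of \<open>f\<close>, so
  estimates of kernels never mention it. The Steklov operator with step \<open>d\<close> has the indicator
  function of \<open>[0,1]\<close> as its kernel.\<close>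

definition dconv :: "real \<Rightarrow> (real \<Rightarrow> real) \<Rightarrow> (real \<Rightarrow> complex) \<Rightarrow> real \<Rightarrow> complex" where
  "dconv d K f x = (LINT t|lborel. of_real (K t) * f (x + d * t))"

definition convolution :: "(real \<Rightarrow> real) \<Rightarrow> (real \<Rightarrow> real) \<Rightarrow> real \<Rightarrow> real" where
  "convolution L K s = (LINT t|lborel. L t * K (s - t))"

lemma decays_measurable [measurable_dest]: "decays M K \<Longrightarrow> K \<in> borel_measurable borel"
  by (simp add: decays_def)

lemma wL1_measurable [measurable_dest]: "f \<in> wL1 N \<Longrightarrow> f \<in> borel_measurable borel"
  by (simp add: wL1_def)

lemma decays_bound:
  assumes "decays M K"
  shows "\<exists>C\<ge>0. \<forall>t. \<bar>K t\<bar> \<le> C * weight M t"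
proof -
  from assms obtain C where C: "\<And>t. \<bar>K t\<bar> \<le> C * weight M t" unfolding decays_def by auto
  have "0 \<le> C * weight M 0" using C[of 0] abs_ge_zero order_trans by blast
  then have "0 \<le> C" by (simp add: weight_def)
  with C show ?thesis by blast
qed

lemma decays_mono: "decays M K \<Longrightarrow> N \<le> M \<Longrightarrow> decays N K"
proof -
  assume K: "decays M K" and "N \<le> M"
  obtain C where "0 \<le> C" "\<And>t. \<bar>K t\<bar> \<le> C * weight M t" using decays_bound[OF K] by blast
  then have "\<bar>K t\<bar> \<le> C * weight N t" for t
    using mult_left_mono[OF weight_antimono[OF \<open>N \<le> M\<close>, of t] \<open>0 \<le> C\<close>] by (metis order_trans)
  then show "decays N K" using K unfolding decays_def by auto
qed

lemma decays_abs: "decays M K \<Longrightarrow> decays M (\<lambda>t. \<bar>K t\<bar>)"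
  unfolding decays_def by auto

lemma decays_integrable:
  assumes "decays M K" "2 \<le> M"
  shows "integrable lborel K"
proof -
  obtain C where C: "0 \<le> C" "\<And>t. \<bar>K t\<bar> \<le> C * weight M t" using decays_bound[OF assms(1)] by blast
  show ?thesis
  proof (rule Bochner_Integration.integrable_bound)
    show "integrable lborel (\<lambda>t. C * weight M t)" using integrable_weight[OF assms(2)] by simp
    show "AE t in lborel. norm (K t) \<le> norm (C * weight M t)"
      using C by (intro AE_I2) (simp add: abs_mult)
  qed (use assms(1) in measurable)
qed

lemma wL1_iff_nn:
  "f \<in> wL1 N \<longleftrightarrow> f \<in> borel_measurable borel \<and>
     (\<integral>\<^sup>+t. ennreal (weight N t) * ennreal (cmod (f t)) \<partial>lborel) < \<infinity>"
  unfolding wL1_def by (auto simp: integrable_iff_bounded ennreal_mult abs_mult)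

lemma wL1_mono: "f \<in> wL1 N \<Longrightarrow> N \<le> M \<Longrightarrow> f \<in> wL1 M"
  unfolding wL1_def
  by (auto elim!: Bochner_Integration.integrable_bound intro!: AE_I2 mult_right_mono weight_antimono
      simp: abs_mult)

lemma wL1_cmod: "f \<in> wL1 N \<Longrightarrow> (\<lambda>t. of_real (cmod (f t))) \<in> wL1 N"
  unfolding wL1_def by auto

lemma wL1_add: "f \<in> wL1 N \<Longrightarrow> g \<in> wL1 N \<Longrightarrow> (\<lambda>t. f t + g t) \<in> wL1 N"
proof -
  assume f: "f \<in> wL1 N" and g: "g \<in> wL1 N"
  have "integrable lborel (\<lambda>t. weight N t * cmod (f t) + weight N t * cmod (g t))"
    using f g unfolding wL1_def by auto
  then have "integrable lborel (\<lambda>t. weight N t * cmod (f t + g t))"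
    using f g by (elim Bochner_Integration.integrable_bound)
      (auto simp: wL1_def abs_mult distrib_left[symmetric] norm_triangle_ineq intro!: mult_left_mono)
  then show ?thesis using f g unfolding wL1_def by auto
qed

lemma wL1_cmult: "f \<in> wL1 N \<Longrightarrow> (\<lambda>t. c * f t) \<in> wL1 N"
proof -
  assume f: "f \<in> wL1 N"
  then have "integrable lborel (\<lambda>t. cmod c * (weight N t * cmod (f t)))" unfolding wL1_def by auto
  then show ?thesis using f unfolding wL1_def by (auto simp: norm_mult mult_ac)
qed

lemma wL1_affine_integrable:
  assumes f: "f \<in> wL1 N" and "0 < d"
  shows "integrable lborel (\<lambda>t. weight N t * cmod (f (x + d * t)))"
proof -
  note [measurable] = wL1_measurable[OF f]
  have "integrable lborel (\<lambda>t. weight N (x + d * t) * cmod (f (x + d * t)))"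
    using f \<open>0 < d\<close> unfolding wL1_def
    by (intro lborel_integrable_real_affine[where f = "\<lambda>y. weight N y * cmod (f y)"]) auto
  then have "integrable lborel (\<lambda>t. ((1 + \<bar>x\<bar>) * (1 + d)) ^ N * (weight N (x + d * t) * cmod (f (x + d * t))))"
    by simp
  then show ?thesis
  proof (rule Bochner_Integration.integrable_bound)
    show "AE t in lborel. norm (weight N t * cmod (f (x + d * t)))
        \<le> norm (((1 + \<bar>x\<bar>) * (1 + d)) ^ N * (weight N (x + d * t) * cmod (f (x + d * t))))"
    proof (rule AE_I2)
      fix t
      have "weight N t * cmod (f (x + d * t)) \<le> (((1 + \<bar>x\<bar>) * (1 + d)) ^ N * weight N (x + d * t)) * cmod (f (x + d * t))"
        using weight_affine[of d N t x] \<open>0 < d\<close> by (intro mult_right_mono) auto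
      then show "norm (weight N t * cmod (f (x + d * t)))
        \<le> norm (((1 + \<bar>x\<bar>) * (1 + d)) ^ N * (weight N (x + d * t) * cmod (f (x + d * t))))"
        using \<open>0 < d\<close> by (simp add: abs_mult mult_ac)
    qed
  qed measurable
qed

lemma dconv_integrable:
  assumes f: "f \<in> wL1 N" and K: "decays M K" and "0 < d" "N \<le> M"
  shows "integrable lborel (\<lambda>t. of_real (K t) * f (x + d * t))"
proof -
  note [measurable] = wL1_measurable[OF f] decays_measurable[OF K]
  obtain C where C: "0 \<le> C" "\<And>t. \<bar>K t\<bar> \<le> C * weight N t"
    using decays_bound[OF decays_mono[OF K \<open>N \<le> M\<close>]] by blast
  have "integrable lborel (\<lambda>t. C * (weight N t * cmod (f (x + d * t))))"
    using wL1_affine_integrable[OF f \<open>0 < d\<close>] by simp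
  then show ?thesis
  proof (rule Bochner_Integration.integrable_bound)
    show "AE t in lborel. norm (of_real (K t) * f (x + d * t)) \<le> norm (C * (weight N t * cmod (f (x + d * t))))"
      using C by (intro AE_I2) (simp add: norm_mult abs_mult mult.assoc[symmetric] mult_right_mono)
  qed measurable
qed

lemma dconv_measurable:
  assumes f: "f \<in> borel_measurable borel" and K: "K \<in> borel_measurable borel"
  shows "dconv d K f \<in> borel_measurable borel"
proof -
  note [measurable] = f K
  show ?thesis unfolding dconv_def by measurable
qed

lemma cmod_dconv_le:
  "cmod (dconv d K f x) \<le> (LINT t|lborel. \<bar>K t\<bar> * cmod (f (x + d * t)))"
  unfolding dconv_def by (rule order_trans[OF integral_norm_bound]) (simp add: norm_mult)

lemma dconv_wL1:
  assumes f: "f \<in> wL1 N" and K: "decays M K" and "0 < d" "N + 2 \<le> M"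
  shows "dconv d K f \<in> wL1 N"
proof -
  note [measurable] = wL1_measurable[OF f] decays_measurable[OF K]
  obtain C where C: "0 \<le> C" "\<And>t. \<bar>K t\<bar> \<le> C * weight (N + 2) t"
    using decays_bound[OF decays_mono[OF K \<open>N + 2 \<le> M\<close>]] by blast
  have m[measurable]: "dconv d K f \<in> borel_measurable borel" by (rule dconv_measurable) measurable
  let ?g = "\<lambda>y. ennreal (cmod (f y))"
  have b: "ennreal (cmod (dconv d K f x)) \<le> ennreal C * (\<integral>\<^sup>+t. ennreal (weight (N + 2) t) * ?g (x + d * t) \<partial>lborel)" for x
  proof -
    have "ennreal (cmod (dconv d K f x)) \<le> (\<integral>\<^sup>+t. ennreal (norm (of_real (K t) * f (x + d * t))) \<partial>lborel)"
      unfolding dconv_def by (rule integral_norm_bound_ennreal, rule dconv_integrable[OF f K]) (use assms in auto)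
    also have "\<dots> \<le> (\<integral>\<^sup>+t. ennreal C * (ennreal (weight (N + 2) t) * ?g (x + d * t)) \<partial>lborel)"
    proof (rule nn_integral_mono)
      fix t
      have "norm (complex_of_real (K t) * f (x + d * t)) \<le> (C * weight (N + 2) t) * cmod (f (x + d * t))"
        using C by (simp add: norm_mult mult_right_mono)
      then show "ennreal (norm (of_real (K t) * f (x + d * t))) \<le> ennreal C * (ennreal (weight (N + 2) t) * ?g (x + d * t))"
        using C by (simp add: ennreal_mult[symmetric] mult_ac)
    qed
    also have "\<dots> = ennreal C * (\<integral>\<^sup>+t. ennreal (weight (N + 2) t) * ?g (x + d * t) \<partial>lborel)"
      by (rule nn_integral_cmult) measurable
    finally show ?thesis .
  qed
  have "(\<integral>\<^sup>+x. ennreal (weight N x) * ennreal (cmod (dconv d K f x)) \<partial>lborel)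
     \<le> (\<integral>\<^sup>+x. ennreal C * (ennreal (weight N x) * (\<integral>\<^sup>+t. ennreal (weight (N + 2) t) * ?g (x + d * t) \<partial>lborel)) \<partial>lborel)"
  proof (rule nn_integral_mono)
    fix x
    have "ennreal (weight N x) * ennreal (cmod (dconv d K f x))
        \<le> ennreal (weight N x) * (ennreal C * (\<integral>\<^sup>+t. ennreal (weight (N + 2) t) * ?g (x + d * t) \<partial>lborel))"
      by (rule mult_left_mono[OF b]) simp
    then show "ennreal (weight N x) * ennreal (cmod (dconv d K f x))
        \<le> ennreal C * (ennreal (weight N x) * (\<integral>\<^sup>+t. ennreal (weight (N + 2) t) * ?g (x + d * t) \<partial>lborel))"
      by (simp only: mult.left_commute)
  qed
  also have "\<dots> = ennreal C * (\<integral>\<^sup>+x. (ennreal (weight N x) * (\<integral>\<^sup>+t. ennreal (weight (N + 2) t) * ?g (x + d * t) \<partial>lborel)) \<partial>lborel)"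
    by (rule nn_integral_cmult) measurable
  also have "\<dots> \<le> ennreal C * (ennreal ((1 + d) ^ N * weight_mass) * (\<integral>\<^sup>+y. ennreal (weight N y) * ?g y \<partial>lborel))"
    by (rule mult_left_mono[OF nn_integral_conv_weight]) (use assms in auto)
  also have "\<dots> < \<infinity>"
    using f unfolding wL1_iff_nn by (auto simp: ennreal_mult_less_top)
  finally show ?thesis using m unfolding wL1_iff_nn by simp
qed

lemma dconv_add:
  assumes "f \<in> wL1 N" "g \<in> wL1 N" "decays M K" "0 < d" "N \<le> M"
  shows "dconv d K (\<lambda>t. f t + g t) x = dconv d K f x + dconv d K g x"
  unfolding dconv_def distrib_left using assms
  by (intro Bochner_Integration.integral_add dconv_integrable) auto

lemma dconv_diff:
  assumes "f \<in> wL1 N" "g \<in> wL1 N" "decays M K" "0 < d" "N \<le> M"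
  shows "dconv d K (\<lambda>t. f t - g t) x = dconv d K f x - dconv d K g x"
  unfolding dconv_def right_diff_distrib using assms
  by (intro Bochner_Integration.integral_diff dconv_integrable) auto

lemma dconv_cmult: "dconv d K (\<lambda>t. c * f t) x = c * dconv d K f x"
proof -
  have "(\<lambda>t. of_real (K t) * (c * f (x + d * t))) = (\<lambda>t. c * (of_real (K t) * f (x + d * t)))"
    by (simp add: mult_ac)
  then show ?thesis unfolding dconv_def by (simp only: integral_mult_right_zero)
qed

lemma dconv_kernel_diff:
  assumes "f \<in> wL1 N" "decays M K" "decays M L" "0 < d" "N \<le> M"
  shows "dconv d (\<lambda>t. K t - L t) f x = dconv d K f x - dconv d L f x"
  unfolding dconv_def of_real_diff left_diff_distrib using assms
  by (intro Bochner_Integration.integral_diff dconv_integrable) auto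

text \<open>Integrability in the order that Fubini's criterion asks for: the inner integral of the absolute
  value is again a convolution operator, applied to \<open>\<bar>f\<bar>\<close>, and stays in the weighted space.\<close>

lemma dconv_iterate_integrable:
  assumes f: "f \<in> wL1 N" and K: "decays M K" and L: "decays M L" and "0 < d" "N + 2 \<le> M"
  shows "integrable (lborel \<Otimes>\<^sub>M lborel) (\<lambda>(t, s). of_real (L t) * (of_real (K s) * f (x + d * t + d * s)))"
proof (rule lborel_pair.Fubini_integrable)
  note [measurable] = wL1_measurable[OF f] decays_measurable[OF K] decays_measurable[OF L]
  show "(\<lambda>(t, s). of_real (L t) * (of_real (K s) * f (x + d * t + d * s))) \<in> borel_measurable (lborel \<Otimes>\<^sub>M lborel)"
    by measurable
  let ?h = "dconv d (\<lambda>t. \<bar>K t\<bar>) (\<lambda>t. of_real (cmod (f t)))"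
  have hX: "?h \<in> wL1 N" using assms by (intro dconv_wL1[OF wL1_cmod decays_abs]) auto
  have h: "?h y = of_real (LINT s|lborel. \<bar>K s\<bar> * cmod (f (y + d * s)))" for y
    unfolding dconv_def of_real_mult[symmetric] by (rule integral_complex_of_real)
  have "integrable lborel (\<lambda>t. norm (of_real \<bar>L t\<bar> * ?h (x + d * t)))"
    using assms by (intro integrable_norm dconv_integrable[OF hX decays_abs]) auto
  moreover have "norm (of_real \<bar>L t\<bar> * ?h (x + d * t))
      = (LINT s|lborel. norm (case (t, s) of (t, s) \<Rightarrow> of_real (L t) * (of_real (K s) * f (x + d * t + d * s))))" for t
  proof -
    have "0 \<le> (LINT s|lborel. \<bar>K s\<bar> * cmod (f (x + d * t + d * s)))"
      by (rule integral_nonneg_AE) simp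
    then have "norm (of_real \<bar>L t\<bar> * ?h (x + d * t)) = \<bar>L t\<bar> * (LINT s|lborel. \<bar>K s\<bar> * cmod (f (x + d * t + d * s)))"
      unfolding h norm_mult by simp
    also have "\<dots> = (LINT s|lborel. \<bar>L t\<bar> * (\<bar>K s\<bar> * cmod (f (x + d * t + d * s))))"
      by (rule integral_mult_right_zero[symmetric])
    finally show ?thesis by (simp add: norm_mult)
  qed
  ultimately show "integrable lborel (\<lambda>t. LINT s|lborel. norm (case (t, s) of (t, s) \<Rightarrow> of_real (L t) * (of_real (K s) * f (x + d * t + d * s))))"
    by simp
  show "AE t in lborel. integrable lborel (\<lambda>s. case (t, s) of (t, s) \<Rightarrow> of_real (L t) * (of_real (K s) * f (x + d * t + d * s)))"
    using dconv_integrable[OF f K \<open>0 < d\<close>] assms by (intro AE_I2) auto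
qed

lemma dconv_convop:
  "dconv d L (dconv d K f) x
     = (LINT t|lborel. LINT s|lborel. of_real (L t) * (of_real (K s) * f (x + d * t + d * s)))"
  unfolding dconv_def by (simp only: integral_mult_right_zero)

lemma dconv_commute:
  assumes f: "f \<in> wL1 N" and K: "decays M K" and L: "decays M L" and "0 < d" "N + 2 \<le> M"
  shows "dconv d L (dconv d K f) x = dconv d K (dconv d L f) x"
proof -
  have "dconv d L (dconv d K f) x
     = (LINT s|lborel. LINT t|lborel. of_real (L t) * (of_real (K s) * f (x + d * t + d * s)))"
    unfolding dconv_convop
    by (rule lborel_pair.Fubini_integral[symmetric]) (use dconv_iterate_integrable[OF assms] in simp)
  also have "\<dots> = dconv d K (dconv d L f) x"
    unfolding dconv_convop by (simp add: algebra_simps)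
  finally show ?thesis .
qed

lemma dconv_convolution:
  assumes f: "f \<in> wL1 N" and K: "decays M K" and L: "decays M L" and "0 < d" "N + 2 \<le> M"
  shows "dconv d L (dconv d K f) x = dconv d (convolution L K) f x"
proof -
  note [measurable] = wL1_measurable[OF f] decays_measurable[OF K] decays_measurable[OF L]
  let ?F = "\<lambda>t s. of_real (L t) * (of_real (K (s - t)) * f (x + d * s)) :: complex"
  have shift: "(LINT s|lborel. g s) = (LINT s|lborel. g (s - t))" for g :: "real \<Rightarrow> 'b::{banach, second_countable_topology}" and t
    by (subst lborel_integral_real_affine[where c = 1 and t = "-t"]) auto
  have int: "integrable (lborel \<Otimes>\<^sub>M lborel) (\<lambda>(t, s). ?F t s)"
  proof (rule lborel_pair.Fubini_integrable)
    note I = dconv_iterate_integrable[OF assms, of x]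
    show "(\<lambda>(t, s). ?F t s) \<in> borel_measurable (lborel \<Otimes>\<^sub>M lborel)" by measurable
    have "integrable lborel (\<lambda>t. LINT s|lborel. norm (of_real (L t) * (of_real (K s) * f (x + d * t + d * s))))"
      using lborel_pair.integrable_fst'[OF integrable_norm[OF I]] by simp
    also have "(\<lambda>t. LINT s|lborel. norm (of_real (L t) * (of_real (K s) * f (x + d * t + d * s))))
        = (\<lambda>t. LINT s|lborel. norm (?F t s))"
    proof
      fix t
      show "(LINT s|lborel. norm (of_real (L t) * (of_real (K s) * f (x + d * t + d * s)))) = (LINT s|lborel. norm (?F t s))"
        by (subst shift[of _ t]) (simp add: algebra_simps)
    qed
    finally show "integrable lborel (\<lambda>t. LINT s|lborel. norm (case (t, s) of (t, s) \<Rightarrow> ?F t s))" by simp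
    have "integrable lborel (\<lambda>s. ?F t s)" for t
    proof -
      have "integrable lborel (\<lambda>s. of_real (K s) * f (x + d * t + d * s))"
        using assms by (intro dconv_integrable[OF f K]) auto
      from lborel_integrable_real_affine[OF this, of 1 "-t"] show ?thesis
        by (simp add: algebra_simps)
    qed
    then show "AE t in lborel. integrable lborel (\<lambda>s. case (t, s) of (t, s) \<Rightarrow> ?F t s)" by simp
  qed
  have "dconv d L (dconv d K f) x = (LINT t|lborel. LINT s|lborel. ?F t s)"
    unfolding dconv_convop
  proof (rule Bochner_Integration.integral_cong[OF refl])
    fix t
    show "(LINT s|lborel. of_real (L t) * (of_real (K s) * f (x + d * t + d * s))) = (LINT s|lborel. ?F t s)"
      by (subst shift[of _ t]) (simp add: algebra_simps)
  qed
  also have "\<dots> = (LINT s|lborel. LINT t|lborel. ?F t s)"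
    by (rule lborel_pair.Fubini_integral[symmetric]) (use int in simp)
  also have "\<dots> = dconv d (convolution L K) f x"
  proof -
    have "(LINT t|lborel. ?F t s) = of_real (convolution L K s) * f (x + d * s)" for s
    proof -
      have "(LINT t|lborel. ?F t s) = (LINT t|lborel. of_real (L t * K (s - t)) * f (x + d * s))"
        by (simp add: mult_ac)
      also have "\<dots> = (LINT t|lborel. complex_of_real (L t * K (s - t))) * f (x + d * s)"
        by (rule integral_mult_left_zero)
      also have "(LINT t|lborel. complex_of_real (L t * K (s - t))) = of_real (convolution L K s)"
        unfolding convolution_def by (rule integral_complex_of_real)
      finally show ?thesis .
    qed
    then show ?thesis unfolding dconv_def by simp
  qed
  finally show ?thesis .
qed

section \<open>Averages of functions with modular at most one\<close>

lemma borel_imp_lebesgue: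
  "f \<in> borel_measurable borel \<Longrightarrow> f \<in> borel_measurable lebesgue"
  by (rule measurable_completion) simp

text \<open>Exponents that differ by \<open>O(1 / ln \<bar>x\<bar>)\<close> are interchangeable for \<open>t \<le> 1\<close>: if \<open>t\<close> is at least
  \<open>weight 2 x\<close>, then \<open>t powr (a - b)\<close> is bounded, and if \<open>t\<close> is smaller, then \<open>t powr a \<le> t\<close> is absorbed by the
  integrable error term.\<close>

lemma powr_compare:
  fixes a b t x c2 :: real
  assumes "1 \<le> a" "0 \<le> t" "t \<le> 1" and ab: "\<bar>a - b\<bar> * ln (exp 1 + \<bar>x\<bar>) \<le> c2"
  shows "t powr a \<le> exp (2 * c2) * t powr b + weight 2 x"
proof (cases "t < weight 2 x")
  case True
  have "t powr a \<le> t powr 1"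
  proof (cases "t = 0")
    case False
    then show ?thesis using assms by (intro powr_mono') auto
  qed simp
  also have "\<dots> \<le> weight 2 x" using True assms by simp
  finally show ?thesis using assms by (simp add: add_increasing)
next
  case False
  define s where "s = 1 + \<bar>x\<bar>"
  have s: "1 \<le> s" "s \<le> exp 1 + \<bar>x\<bar>" unfolding s_def using exp_ge_add_one_self[of "1::real"] by auto
  have w: "weight 2 x = s powr (-2)" unfolding weight_def s_def
    using powr_realpow[of "1 + \<bar>x\<bar>" 2] by (simp add: powr_minus_divide)
  have t0: "0 < t" using False weight_pos[of 2 x] by linarith
  have "t powr (a - b) \<le> t powr (- \<bar>a - b\<bar>)"
    using t0 assms by (intro powr_mono') auto
  also have "\<dots> \<le> (s powr (-2)) powr (- \<bar>a - b\<bar>)"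
    using False w t0 s by (intro powr_mono2') auto
  also have "\<dots> = s powr (2 * \<bar>a - b\<bar>)" by (simp add: powr_powr)
  also have "\<dots> \<le> (exp 1 + \<bar>x\<bar>) powr (2 * \<bar>a - b\<bar>)"
    using s by (intro powr_mono2) auto
  also have "\<dots> = exp (2 * (\<bar>a - b\<bar> * ln (exp 1 + \<bar>x\<bar>)))"
    using s by (simp add: powr_def)
  also have "\<dots> \<le> exp (2 * c2)" using ab by simp
  finally have "t powr (a - b) \<le> exp (2 * c2)" .
  then have "t powr (a - b) * t powr b \<le> exp (2 * c2) * t powr b"
    by (rule mult_right_mono) simp
  moreover have "t powr (a - b) * t powr b = t powr a" by (simp add: powr_add[symmetric])
  ultimately show ?thesis using weight_nonneg[of 2 x] by linarith
qed

text \<open>A substitute for Jensen's inequality. Averaging it and then choosing \<open>l\<close> so that the two terms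
  balance bounds a power of an average by the average of the power, even if the exponent \<open>b\<close>
  varies with the point over which one averages.\<close>

lemma young_split:
  fixes l f b :: real
  assumes "0 < l" "0 \<le> f" "1 \<le> b"
  shows "f \<le> l + l powr (1 - b) * f powr b"
proof (cases "f \<le> l")
  case True
  then show ?thesis using assms by (simp add: add_increasing2)
next
  case False
  then have f: "l < f" "0 < f" using assms by auto
  have "f / l \<le> (f / l) powr b"
    using powr_mono[of 1 b "f / l"] f assms by simp
  then have "l * (f / l) \<le> l * (f / l) powr b" using assms by (intro mult_left_mono) auto
  also have "l * (f / l) powr b = l powr (1 - b) * f powr b"
    using assms f by (simp add: powr_divide powr_diff)
  finally show ?thesis using assms by simp
qed

text \<open>Here \<open>q\<close> is the value of the exponent at infinity. The upper bound \<open>P\<close> is a natural number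
  because it determines the order of decay that is required of the kernels.\<close>

locale log_hoelder =
  fixes p :: "real \<Rightarrow> real" and c1 c2 q :: real and P :: nat
  assumes p_measurable [measurable]: "p \<in> borel_measurable borel"
    and p_ge1: "\<And>x. 1 \<le> p x" and p_le: "\<And>x. p x \<le> real P" and q_ge1: "1 \<le> q"
    and c1_pos: "0 < c1" and c2_pos: "0 < c2"
    and local_log: "\<And>x y. \<bar>p x - p y\<bar> * ln (exp 1 + 1 / \<bar>x - y\<bar>) \<le> c1"
    and decay_log: "\<And>x. \<bar>p x - q\<bar> * ln (exp 1 + \<bar>x\<bar>) \<le> c2"
begin

lemma p_pos: "0 < p x" using p_ge1[of x] by linarith

lemma osc_le: "\<bar>p x - p y\<bar> \<le> real P"
  using p_ge1[of x] p_ge1[of y] p_le[of x] p_le[of y] by linarith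

text \<open>The form in which the local condition is used: near the diagonal the exponent oscillates so
  little that this power of the inverse distance stays bounded.\<close>

lemma inverse_dist_powr:
  assumes "x \<noteq> y"
  shows "(1 / \<bar>x - y\<bar>) powr \<bar>p x - p y\<bar> \<le> exp c1"
proof -
  have pos: "0 < exp 1 + 1 / \<bar>x - y\<bar>" by (auto intro!: add_pos_nonneg)
  have "(1 / \<bar>x - y\<bar>) powr \<bar>p x - p y\<bar> \<le> (exp 1 + 1 / \<bar>x - y\<bar>) powr \<bar>p x - p y\<bar>"
    by (intro powr_mono2) auto
  also have "\<dots> = exp (\<bar>p x - p y\<bar> * ln (exp 1 + 1 / \<bar>x - y\<bar>))"
    using pos unfolding powr_def by auto
  also have "\<dots> \<le> exp c1" using local_log by simp
  finally show ?thesis .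
qed

text \<open>For \<open>f \<ge> 1\<close> on its support one has \<open>f y \<le> f y powr p y\<close>, which settles the points with
  \<open>\<Psi> x < 1\<close>. At the other points \<open>\<Psi> x \<le> 1 / d\<close>, because \<open>f\<close> has modular at most one, and this forces
  \<open>d \<le> 1\<close>. Replacing \<open>p y\<close> by \<open>p x\<close> in the balanced splitting then costs \<open>(1 / d) powr \<bar>p x - p y\<bar>\<close>; with
  \<open>\<bar>x - y\<bar> = d * \<bar>t\<bar>\<close> this is at most \<open>exp c1 * (1 + \<bar>t\<bar>) ^ P\<close>, and the extra \<open>P\<close> orders of decay of the kernel
  absorb the polynomial.\<close>

lemma large_values_average:
  fixes f :: "real \<Rightarrow> real"
  assumes [measurable]: "f \<in> borel_measurable borel" and f01: "\<And>y. f y = 0 \<or> 1 \<le> f y"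
    and intF: "integrable lborel (\<lambda>y. f y powr p y)" and F1: "(LINT y|lborel. f y powr p y) \<le> 1"
    and "0 < d"
  defines "\<Psi> \<equiv> \<lambda>x. LINT t|lborel. weight 2 t * f (x + d * t) powr p (x + d * t)"
  shows "integrable lborel (\<lambda>t. weight 2 t * f (x + d * t) powr p (x + d * t))" (is ?i1)
    and "integrable lborel (\<lambda>t. weight (P + 2) t * f (x + d * t))" (is ?i2)
    and "(LINT t|lborel. weight (P + 2) t * f (x + d * t)) \<le> (weight_mass + exp c1) * \<Psi> x powr (1 / p x)" (is ?A)
proof -
  let ?F = "\<lambda>y. f y powr p y"
  have f0: "0 \<le> f y" for y using f01[of y] by auto
  have fF: "f y \<le> ?F y" for y
    using f01[of y] powr_mono[of 1 "p y" "f y"] p_ge1[of y] by auto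
  have iF: "integrable lborel (\<lambda>t. ?F (x + d * t))"
    using lborel_integrable_real_affine[OF intF, of d x] \<open>0 < d\<close> by simp
  have wt2: "weight 2 t \<le> 1" for t by (simp add: weight_def)
  have wP: "weight (P + 2) t \<le> weight 2 t" for t by (rule weight_antimono) simp
  show i1: ?i1
    by (rule Bochner_Integration.integrable_bound[OF iF])
       (auto simp: abs_mult wt2 intro!: mult_left_le_one_le)
  show i2: ?i2
    by (rule Bochner_Integration.integrable_bound[OF i1])
       (auto simp: abs_mult f0 simp del: add_2_eq_Suc' intro!: AE_I2 mult_mono wP fF)
  have \<Psi>0: "0 \<le> \<Psi> x" unfolding \<Psi>_def by (rule integral_nonneg_AE) simp
  have \<Psi>d: "\<Psi> x \<le> 1 / d"
  proof -
    have "\<Psi> x \<le> (LINT t|lborel. ?F (x + d * t))"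
      unfolding \<Psi>_def by (rule integral_mono[OF i1 iF]) (auto simp: wt2 intro!: mult_left_le_one_le)
    moreover have "(LINT y|lborel. ?F y) = d * (LINT t|lborel. ?F (x + d * t))"
      using \<open>0 < d\<close> lborel_integral_real_affine[of d ?F x] by simp
    ultimately have "d * \<Psi> x \<le> 1" using F1 \<open>0 < d\<close>
      by (metis mult_left_mono order_trans less_imp_le)
    then show ?thesis using \<open>0 < d\<close> by (simp add: field_simps)
  qed
  have e1: "1 \<le> exp c1" using c1_pos by simp
  show ?A
  proof (cases "\<Psi> x < 1")
    case True
    have "(LINT t|lborel. weight (P + 2) t * f (x + d * t)) \<le> \<Psi> x"
      unfolding \<Psi>_def by (rule integral_mono[OF i2 i1]) (intro mult_mono wP fF f0 weight_nonneg)
    also have "\<dots> \<le> \<Psi> x powr (1 / p x)"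
    proof (cases "\<Psi> x = 0")
      case False
      then show ?thesis using powr_mono'[of "1 / p x" 1 "\<Psi> x"] True \<Psi>0 p_ge1[of x] by simp
    qed simp
    also have "\<dots> \<le> (weight_mass + exp c1) * \<Psi> x powr (1 / p x)"
    proof -
      have "1 \<le> weight_mass + exp c1" using weight_mass_pos e1 by linarith
      from mult_right_mono[OF this, of "\<Psi> x powr (1 / p x)"] show ?thesis by simp
    qed
    finally show ?thesis .
  next
    case False
    then have \<Psi>1: "1 \<le> \<Psi> x" by simp
    then have d1: "1 \<le> 1 / d" using \<Psi>d by linarith
    (* the value of l that balances the two terms of young_split at the point x *)
    define l where "l = \<Psi> x powr (1 / p x)"
    have l1: "1 \<le> l" unfolding l_def using \<Psi>1 p_pos[of x] by (intro ge_one_powr_ge_zero) auto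
    have lp: "l powr p x = \<Psi> x" unfolding l_def using \<Psi>1 p_pos[of x] by (simp add: powr_powr)
    define b where "b = exp c1 * l powr (1 - p x)"
    have pt: "weight (P + 2) t * f (x + d * t) \<le> l * weight 2 t + b * (weight 2 t * ?F (x + d * t))" for t
    proof -
      define y where "y = x + d * t"
      define a where "a = \<bar>p x - p y\<bar>"
      have "l powr (p x - p y) \<le> l powr a"
        unfolding a_def using l1 by (intro powr_mono) auto
      also have "\<dots> = \<Psi> x powr (a / p x)" unfolding l_def by (simp add: powr_powr)
      also have "\<dots> \<le> \<Psi> x powr a"
      proof (intro powr_mono)
        have "a / p x \<le> a / 1" unfolding a_def using p_ge1[of x] by (intro divide_left_mono) auto
        then show "a / p x \<le> a" by simp
      qed (use \<Psi>1 in auto)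
      also have "\<dots> \<le> (1 / d) powr a"
        using \<Psi>d \<Psi>0 unfolding a_def by (intro powr_mono2) auto
      also have "\<dots> \<le> exp c1 * (1 + \<bar>t\<bar>) ^ P"
      proof (cases "t = 0")
        case True
        then show ?thesis using e1 d1 \<open>0 < d\<close> unfolding a_def y_def by simp
      next
        case False
        have "1 / d = (1 / \<bar>x - y\<bar>) * \<bar>t\<bar>"
          unfolding y_def using False \<open>0 < d\<close> by (simp add: abs_mult)
        then have "(1 / d) powr a = (1 / \<bar>x - y\<bar>) powr a * \<bar>t\<bar> powr a"
          by (simp only: powr_mult abs_ge_zero divide_nonneg_nonneg zero_le_one)
        also have "\<dots> \<le> exp c1 * (1 + \<bar>t\<bar>) ^ P"
        proof (rule mult_mono)
          show "(1 / \<bar>x - y\<bar>) powr a \<le> exp c1"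
            unfolding a_def using inverse_dist_powr[of x y] False \<open>0 < d\<close> unfolding y_def by auto
          have "\<bar>t\<bar> powr a \<le> (1 + \<bar>t\<bar>) powr a" unfolding a_def by (intro powr_mono2) auto
          also have "\<dots> \<le> (1 + \<bar>t\<bar>) powr real P"
            unfolding a_def using osc_le by (intro powr_mono) auto
          also have "\<dots> = (1 + \<bar>t\<bar>) ^ P" by (rule powr_realpow) auto
          finally show "\<bar>t\<bar> powr a \<le> (1 + \<bar>t\<bar>) ^ P" .
        qed auto
        finally show ?thesis .
      qed
      finally have L: "l powr (p x - p y) \<le> exp c1 * (1 + \<bar>t\<bar>) ^ P" .
      have "f y \<le> l + l powr (1 - p y) * ?F y"
        using young_split[of l "f y" "p y"] l1 f0 p_ge1 by auto
      also have "l powr (1 - p y) = l powr (1 - p x) * l powr (p x - p y)"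
        by (simp add: powr_add[symmetric])
      also have "l + l powr (1 - p x) * l powr (p x - p y) * ?F y
          \<le> l + l powr (1 - p x) * (exp c1 * (1 + \<bar>t\<bar>) ^ P) * ?F y"
        by (intro add_left_mono mult_right_mono mult_left_mono L) auto
      finally have "weight (P + 2) t * f y \<le> weight (P + 2) t * (l + l powr (1 - p x) * (exp c1 * (1 + \<bar>t\<bar>) ^ P) * ?F y)"
        by (rule mult_left_mono) simp
      also have "\<dots> = l * weight (P + 2) t + b * ((weight (P + 2) t * (1 + \<bar>t\<bar>) ^ P) * ?F y)"
        unfolding b_def by (simp add: algebra_simps)
      also have "weight (P + 2) t * (1 + \<bar>t\<bar>) ^ P = weight 2 t" by (rule weight_mult_power)
      also have "l * weight (P + 2) t + b * (weight 2 t * ?F y) \<le> l * weight 2 t + b * (weight 2 t * ?F y)"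
        using l1 wP[of t] by (intro add_right_mono mult_left_mono) auto
      finally show ?thesis unfolding y_def .
    qed
    have iw: "integrable lborel (\<lambda>t. l * weight 2 t)" using integrable_weight[of 2] by simp
    have ib: "integrable lborel (\<lambda>t. b * (weight 2 t * ?F (x + d * t)))" using i1 by simp
    have "(LINT t|lborel. weight (P + 2) t * f (x + d * t))
        \<le> (LINT t|lborel. l * weight 2 t + b * (weight 2 t * ?F (x + d * t)))"
      by (rule integral_mono[OF i2 Bochner_Integration.integrable_add[OF iw ib] pt])
    also have "\<dots> = l * weight_mass + b * \<Psi> x"
      unfolding Bochner_Integration.integral_add[OF iw ib] by (simp add: weight_mass_def \<Psi>_def)
    also have "b * \<Psi> x = exp c1 * (l powr (1 - p x) * l powr p x)" unfolding b_def lp by simp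
    also have "l powr (1 - p x) * l powr p x = l" using l1 by (simp add: powr_add[symmetric])
    finally show ?thesis unfolding l_def by (simp add: algebra_simps)
  qed
qed

text \<open>For the constant exponent \<open>q\<close> this is Jensen's inequality up to the factor \<open>2 powr q\<close>, by
  \<open>young_split\<close>; the case \<open>\<Theta> x = 0\<close> needs arbitrarily small \<open>l\<close>.\<close>

lemma small_values_average:
  fixes f :: "real \<Rightarrow> real" and d :: real
  assumes [measurable]: "f \<in> borel_measurable borel" and f01: "\<And>y. 0 \<le> f y" "\<And>y. f y \<le> 1"
  defines "\<Theta> \<equiv> \<lambda>x. LINT t|lborel. weight 2 t * f (x + d * t) powr q"
  shows "integrable lborel (\<lambda>t. weight 2 t * f (x + d * t) powr q)" (is ?i1)
    and "integrable lborel (\<lambda>t. weight 2 t * f (x + d * t))" (is ?i2)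
    and "(LINT t|lborel. weight 2 t * f (x + d * t)) \<le> weight_mass" (is ?B)
    and "((LINT t|lborel. weight 2 t * f (x + d * t)) / weight_mass) powr q \<le> 2 powr q * (\<Theta> x / weight_mass)" (is ?A)
proof -
  have iw: "integrable lborel (weight 2)" using integrable_weight[of 2] by simp
  have fq: "f y powr q \<le> 1" for y using f01[of y] q_ge1 by (intro powr_le1) auto
  show i1: ?i1
    by (rule Bochner_Integration.integrable_bound[OF iw])
       (auto simp: abs_mult intro!: mult_left_le fq)
  show i2: ?i2
    by (rule Bochner_Integration.integrable_bound[OF iw])
       (auto simp: abs_mult f01 intro!: mult_left_le)
  show ?B unfolding weight_mass_def
    by (rule integral_mono[OF i2 iw]) (auto simp: f01 intro!: mult_left_le)
  define b where "b = (LINT t|lborel. weight 2 t * f (x + d * t)) / weight_mass"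
  define \<theta> where "\<theta> = \<Theta> x / weight_mass"
  have b0: "0 \<le> b" unfolding b_def using weight_mass_pos
    by (intro divide_nonneg_pos integral_nonneg_AE) (auto simp: f01)
  have \<theta>0: "0 \<le> \<theta>" unfolding \<theta>_def \<Theta>_def using weight_mass_pos
    by (intro divide_nonneg_pos integral_nonneg_AE) auto
  have main: "b \<le> l + l powr (1 - q) * \<theta>" if "0 < l" for l
  proof -
    have iw': "integrable lborel (\<lambda>t. l * weight 2 t)" using iw by simp
    have i1': "integrable lborel (\<lambda>t. l powr (1 - q) * (weight 2 t * f (x + d * t) powr q))" using i1 by simp
    have "(LINT t|lborel. weight 2 t * f (x + d * t))
       \<le> (LINT t|lborel. l * weight 2 t + l powr (1 - q) * (weight 2 t * f (x + d * t) powr q))"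
    proof (rule integral_mono[OF i2 Bochner_Integration.integrable_add[OF iw' i1']])
      fix t
      have "weight 2 t * f (x + d * t) \<le> weight 2 t * (l + l powr (1 - q) * f (x + d * t) powr q)"
        by (intro mult_left_mono young_split that f01 q_ge1) auto
      then show "weight 2 t * f (x + d * t) \<le> l * weight 2 t + l powr (1 - q) * (weight 2 t * f (x + d * t) powr q)"
        by (simp add: algebra_simps)
    qed
    also have "\<dots> = l * weight_mass + l powr (1 - q) * \<Theta> x"
      unfolding Bochner_Integration.integral_add[OF iw' i1'] by (simp add: weight_mass_def \<Theta>_def)
    finally show ?thesis unfolding b_def \<theta>_def using weight_mass_pos by (simp add: field_simps)
  qed
  have "b powr q \<le> 2 powr q * \<theta>"
  proof (cases "\<theta> = 0")
    case True
    have "b \<le> 0"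
    proof (rule ccontr)
      assume "\<not> b \<le> 0"
      then have "b \<le> b / 2" using main[of "b / 2"] True by simp
      with \<open>\<not> b \<le> 0\<close> show False by simp
    qed
    with b0 True show ?thesis by simp
  next
    case False
    with \<theta>0 have \<theta>: "0 < \<theta>" by simp
    define l where "l = \<theta> powr (1 / q)"
    have l: "0 < l" "l powr q = \<theta>" unfolding l_def using \<theta> q_ge1 by (auto simp: powr_powr)
    have "b \<le> l + l powr (1 - q) * l powr q" using main[OF l(1)] l(2) by simp
    also have "l powr (1 - q) * l powr q = l" using l(1) by (simp add: powr_add[symmetric])
    finally have "b \<le> 2 * l" by simp
    then have "b powr q \<le> (2 * l) powr q" using b0 q_ge1 by (intro powr_mono2) auto
    then show ?thesis using l by (simp add: powr_mult)
  qed
  then show ?A unfolding b_def \<theta>_def .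
qed

lemma sum_powr_le:
  fixes a b :: real
  assumes "0 \<le> a" "0 \<le> b"
  shows "(a + b) powr p x \<le> 2 ^ P * (a powr p x + b powr p x)"
proof -
  have "(a + b) powr p x \<le> (2 * max a b) powr p x"
    using assms p_pos[of x] by (intro powr_mono2) auto
  also have "\<dots> = 2 powr p x * max a b powr p x" using assms by (simp add: powr_mult)
  also have "\<dots> \<le> 2 ^ P * (a powr p x + b powr p x)"
  proof (rule mult_mono)
    have "(2::real) powr p x \<le> 2 powr real P" using p_le by (intro powr_mono) auto
    then show "(2::real) powr p x \<le> 2 ^ P" by (simp add: powr_realpow)
  qed (auto simp: max_def)
  finally show ?thesis .
qed

lemma const_powr_le:
  fixes c a :: real
  assumes "1 \<le> c" "0 \<le> a"
  shows "(c * a) powr p x \<le> c ^ P * a powr p x"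
proof -
  have "c powr p x \<le> c powr real P" using p_le assms by (intro powr_mono) auto
  also have "\<dots> = c ^ P" using assms by (intro powr_realpow) auto
  finally show ?thesis using assms by (simp add: powr_mult mult_right_mono)
qed

text \<open>The large values are handled by \<open>large_values_average\<close> and the values in \<open>[0,1]\<close> by \<open>small_values_average\<close>. The latter
  concerns the constant exponent \<open>q\<close>; \<open>powr_compare\<close> passes from \<open>p x\<close> to \<open>q\<close> before averaging and from
  \<open>q\<close> to \<open>p y\<close> afterwards.\<close>

proposition average_modular_bound:
  "\<exists>C>0. \<forall>d>0. \<forall>f. f \<in> borel_measurable borel \<longrightarrow> (\<forall>y. 0 \<le> f y) \<longrightarrow>
     (\<integral>\<^sup>+y. ennreal (f y powr p y) \<partial>lborel) \<le> 1 \<longrightarrow>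
     (\<forall>x. integrable lborel (\<lambda>t. weight (P + 2) t * f (x + d * t))) \<and>
     (\<integral>\<^sup>+x. ennreal ((LINT t|lborel. weight (P + 2) t * f (x + d * t)) powr p x) \<partial>lborel) \<le> ennreal C"
proof -
  define a1 where "a1 = 2 ^ P * (weight_mass + exp c1) ^ P"
  define w' where "w' = 1 + weight_mass"
  define a2 where "a2 = 2 ^ P * w' ^ P * exp (2 * c2) * 2 powr q / weight_mass"
  define a3 where "a3 = 2 ^ P * w' ^ P"
  define C where "C = a1 * weight_mass + a2 * (weight_mass * (exp (2 * c2) + weight_mass)) + a3 * weight_mass"
  have nn: "0 \<le> a1" "0 \<le> a2" "0 < a3"
    unfolding a1_def a2_def a3_def w'_def using weight_mass_pos by (auto intro!: zero_less_power mult_nonneg_nonneg divide_nonneg_pos)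
  have "0 < C" unfolding C_def using nn weight_mass_pos
    by (auto intro!: add_nonneg_pos mult_nonneg_nonneg add_nonneg_nonneg)
  moreover have "(\<forall>x. integrable lborel (\<lambda>t. weight (P + 2) t * f (x + d * t))) \<and>
     (\<integral>\<^sup>+x. ennreal ((LINT t|lborel. weight (P + 2) t * f (x + d * t)) powr p x) \<partial>lborel) \<le> ennreal C"
    if "0 < d" and [measurable]: "f \<in> borel_measurable borel" and f0: "\<forall>y. 0 \<le> f y"
      and mod: "(\<integral>\<^sup>+y. ennreal (f y powr p y) \<partial>lborel) \<le> 1" for d and f :: "real \<Rightarrow> real"
  proof -
    define f1 where "f1 = (\<lambda>y. if 1 < f y then f y else 0)"
    define f2 where "f2 = (\<lambda>y. if 1 < f y then 0 else f y)"
    have [measurable]: "f1 \<in> borel_measurable borel" "f2 \<in> borel_measurable borel"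
      unfolding f1_def f2_def by measurable
    have f12: "f y = f1 y + f2 y" for y unfolding f1_def f2_def by simp
    have f1: "f1 y = 0 \<or> 1 \<le> f1 y" "0 \<le> f1 y" for y using f0 unfolding f1_def by auto
    have f2: "0 \<le> f2 y" "f2 y \<le> 1" for y using f0 unfolding f2_def by auto
    have m1: "(\<integral>\<^sup>+y. ennreal (f1 y powr p y) \<partial>lborel) \<le> 1"
      by (rule order_trans[OF nn_integral_mono mod]) (auto simp: f1_def)
    have m2: "(\<integral>\<^sup>+y. ennreal (f2 y powr p y) \<partial>lborel) \<le> 1"
      by (rule order_trans[OF nn_integral_mono mod]) (auto simp: f2_def)
    have i1: "integrable lborel (\<lambda>y. f1 y powr p y)"
      using m1 by (auto simp: integrable_iff_bounded intro: le_less_trans)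
    have l1: "(LINT y|lborel. f1 y powr p y) \<le> 1"
    proof -
      have "ennreal (LINT y|lborel. f1 y powr p y) \<le> 1"
        using m1 nn_integral_eq_integral[OF i1] by simp
      then show ?thesis by simp
    qed
    define \<Psi> where "\<Psi> = (\<lambda>x. LINT t|lborel. weight 2 t * f1 (x + d * t) powr p (x + d * t))"
    define \<Theta> where "\<Theta> = (\<lambda>x. LINT t|lborel. weight 2 t * f2 (x + d * t) powr q)"
    define A1 where "A1 = (\<lambda>x. LINT t|lborel. weight (P + 2) t * f1 (x + d * t))"
    define B2 where "B2 = (\<lambda>x. LINT t|lborel. weight 2 t * f2 (x + d * t))"
    note big = large_values_average[OF \<open>f1 \<in> _\<close> f1(1) i1 l1 \<open>0 < d\<close>, folded \<Psi>_def]
    note small = small_values_average[OF \<open>f2 \<in> _\<close> f2, of _ d, folded \<Theta>_def]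
    have small': "integrable lborel (\<lambda>t. weight (P + 2) t * f2 (x + d * t))" for x
      by (rule Bochner_Integration.integrable_bound[OF small(2)[of x]])
         (auto simp: abs_mult f2 intro!: mult_right_mono weight_antimono)
    have int: "integrable lborel (\<lambda>t. weight (P + 2) t * f (x + d * t))" for x
      unfolding f12 distrib_left by (intro Bochner_Integration.integrable_add big(2) small')
    have A1_0: "0 \<le> A1 x" for x unfolding A1_def by (rule integral_nonneg_AE) (auto simp: f1)
    have B2_0: "0 \<le> B2 x" for x unfolding B2_def by (rule integral_nonneg_AE) (auto simp: f2)
    have \<Psi>0: "0 \<le> \<Psi> x" for x unfolding \<Psi>_def by (rule integral_nonneg_AE) auto
    have \<Theta>0: "0 \<le> \<Theta> x" for x unfolding \<Theta>_def by (rule integral_nonneg_AE) auto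
    have pt: "(LINT t|lborel. weight (P + 2) t * f (x + d * t)) powr p x \<le> a1 * \<Psi> x + a2 * \<Theta> x + a3 * weight 2 x" for x
    proof -
      have "(LINT t|lborel. weight (P + 2) t * f (x + d * t)) = A1 x + (LINT t|lborel. weight (P + 2) t * f2 (x + d * t))"
        unfolding f12 distrib_left A1_def by (rule Bochner_Integration.integral_add[OF big(2) small'])
      moreover have "(LINT t|lborel. weight (P + 2) t * f2 (x + d * t)) \<le> B2 x"
        unfolding B2_def by (rule integral_mono[OF small' small(2)]) (auto simp: f2 intro!: mult_right_mono weight_antimono)
      ultimately have le: "(LINT t|lborel. weight (P + 2) t * f (x + d * t)) \<le> A1 x + B2 x" by simp
      have "0 \<le> (LINT t|lborel. weight (P + 2) t * f (x + d * t))"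
        by (rule integral_nonneg_AE) (auto simp: f0)
      with le have "(LINT t|lborel. weight (P + 2) t * f (x + d * t)) powr p x \<le> (A1 x + B2 x) powr p x"
        using p_pos[of x] by (intro powr_mono2) auto
      also have "\<dots> \<le> 2 ^ P * (A1 x powr p x + B2 x powr p x)" by (rule sum_powr_le[OF A1_0 B2_0])
      also have "A1 x powr p x \<le> (weight_mass + exp c1) ^ P * \<Psi> x"
      proof -
        have "A1 x powr p x \<le> ((weight_mass + exp c1) * \<Psi> x powr (1 / p x)) powr p x"
          using big(3)[of x] A1_0[of x] p_pos[of x] unfolding A1_def \<Psi>_def by (intro powr_mono2) auto
        also have "\<dots> \<le> (weight_mass + exp c1) ^ P * (\<Psi> x powr (1 / p x)) powr p x"
          using weight_mass_pos c1_pos by (intro const_powr_le) (auto simp: add_increasing)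
        also have "(\<Psi> x powr (1 / p x)) powr p x = \<Psi> x"
          using \<Psi>0[of x] p_pos[of x] by (simp add: powr_powr)
        finally show ?thesis .
      qed
      also have "B2 x powr p x \<le> w' ^ P * (exp (2 * c2) * (2 powr q * (\<Theta> x / weight_mass)) + weight 2 x)"
      proof -
        define b where "b = B2 x / weight_mass"
        have b: "0 \<le> b" "b \<le> 1" unfolding b_def using B2_0[of x] small(3)[of x] weight_mass_pos unfolding B2_def by auto
        have "B2 x \<le> w' * b" unfolding w'_def b_def using B2_0[of x] weight_mass_pos by (simp add: field_simps)
        then have "B2 x powr p x \<le> (w' * b) powr p x" using B2_0[of x] p_pos[of x] by (intro powr_mono2) auto
        also have "\<dots> \<le> w' ^ P * b powr p x"
          using b weight_mass_pos unfolding w'_def by (intro const_powr_le) auto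
        also have "b powr p x \<le> exp (2 * c2) * b powr q + weight 2 x"
          by (rule powr_compare[OF p_ge1 b decay_log])
        also have "b powr q \<le> 2 powr q * (\<Theta> x / weight_mass)"
          using small(4)[of x] unfolding b_def B2_def \<Theta>_def .
        finally show ?thesis using weight_mass_pos unfolding w'_def by (simp add: mult_left_mono)
      qed
      finally show ?thesis unfolding a1_def a2_def a3_def by (simp add: algebra_simps)
    qed
    have "(\<integral>\<^sup>+x. ennreal ((LINT t|lborel. weight (P + 2) t * f (x + d * t)) powr p x) \<partial>lborel)
        \<le> (\<integral>\<^sup>+x. ennreal a1 * ennreal (\<Psi> x) + ennreal a2 * ennreal (\<Theta> x) + ennreal a3 * ennreal (weight 2 x) \<partial>lborel)"
    proof (rule nn_integral_mono)
      fix x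
      show "ennreal ((LINT t|lborel. weight (P + 2) t * f (x + d * t)) powr p x)
        \<le> ennreal a1 * ennreal (\<Psi> x) + ennreal a2 * ennreal (\<Theta> x) + ennreal a3 * ennreal (weight 2 x)"
        using ennreal_leI[OF pt[of x]] nn \<Psi>0[of x] \<Theta>0[of x]
        by (simp add: ennreal_mult[symmetric] ennreal_plus[symmetric] mult_nonneg_nonneg add_nonneg_nonneg del: ennreal_plus)
    qed
    also have "\<dots> = ennreal a1 * (\<integral>\<^sup>+x. ennreal (\<Psi> x) \<partial>lborel) + ennreal a2 * (\<integral>\<^sup>+x. ennreal (\<Theta> x) \<partial>lborel)
        + ennreal a3 * ennreal weight_mass"
    proof -
      have [measurable]: "\<Psi> \<in> borel_measurable borel" "\<Theta> \<in> borel_measurable borel"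
        unfolding \<Psi>_def \<Theta>_def by measurable
      show ?thesis by (simp add: nn_integral_add nn_integral_cmult weight_mass_nn)
    qed
    also have "(\<integral>\<^sup>+x. ennreal (\<Psi> x) \<partial>lborel) \<le> ennreal weight_mass"
    proof -
      have "ennreal (\<Psi> x) = (\<integral>\<^sup>+t. ennreal (weight (0 + 2) t) * ennreal (f1 (x + d * t) powr p (x + d * t)) \<partial>lborel)" for x
      proof -
        have "(\<integral>\<^sup>+t. ennreal (weight 2 t * f1 (x + d * t) powr p (x + d * t)) \<partial>lborel) = ennreal (\<Psi> x)"
          unfolding \<Psi>_def by (rule nn_integral_eq_integral[OF big(1)]) auto
        then show ?thesis by (simp only: ennreal_mult'[OF weight_nonneg] add_0)
      qed
      then have "(\<integral>\<^sup>+x. ennreal (\<Psi> x) \<partial>lborel)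
        = (\<integral>\<^sup>+x. ennreal (weight 0 x) * (\<integral>\<^sup>+t. ennreal (weight (0 + 2) t) * ennreal (f1 (x + d * t) powr p (x + d * t)) \<partial>lborel) \<partial>lborel)"
        by (simp add: weight_def)
      also have "\<dots> \<le> ennreal ((1 + d) ^ 0 * weight_mass) * (\<integral>\<^sup>+y. ennreal (weight 0 y) * ennreal (f1 y powr p y) \<partial>lborel)"
        by (rule nn_integral_conv_weight) (use \<open>0 < d\<close> in auto)
      also have "(\<integral>\<^sup>+y. ennreal (weight 0 y) * ennreal (f1 y powr p y) \<partial>lborel) \<le> 1"
        using m1 by (simp add: weight_def)
      finally show ?thesis by (simp add: mult_left_mono)
    qed
    also have "(\<integral>\<^sup>+x. ennreal (\<Theta> x) \<partial>lborel) \<le> ennreal (weight_mass * (exp (2 * c2) + weight_mass))"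
    proof -
      have "ennreal (\<Theta> x) = (\<integral>\<^sup>+t. ennreal (weight (0 + 2) t) * ennreal (f2 (x + d * t) powr q) \<partial>lborel)" for x
      proof -
        have "(\<integral>\<^sup>+t. ennreal (weight 2 t * f2 (x + d * t) powr q) \<partial>lborel) = ennreal (\<Theta> x)"
          unfolding \<Theta>_def by (rule nn_integral_eq_integral[OF small(1)]) auto
        then show ?thesis by (simp only: ennreal_mult'[OF weight_nonneg] add_0)
      qed
      then have "(\<integral>\<^sup>+x. ennreal (\<Theta> x) \<partial>lborel)
        = (\<integral>\<^sup>+x. ennreal (weight 0 x) * (\<integral>\<^sup>+t. ennreal (weight (0 + 2) t) * ennreal (f2 (x + d * t) powr q) \<partial>lborel) \<partial>lborel)"
        by (simp add: weight_def)
      also have "\<dots> \<le> ennreal ((1 + d) ^ 0 * weight_mass) * (\<integral>\<^sup>+y. ennreal (weight 0 y) * ennreal (f2 y powr q) \<partial>lborel)"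
        by (rule nn_integral_conv_weight) (use \<open>0 < d\<close> in auto)
      also have "(\<integral>\<^sup>+y. ennreal (weight 0 y) * ennreal (f2 y powr q) \<partial>lborel)
         \<le> (\<integral>\<^sup>+y. ennreal (exp (2 * c2)) * ennreal (f2 y powr p y) + ennreal (weight 2 y) \<partial>lborel)"
      proof (rule nn_integral_mono)
        fix y
        have "f2 y powr q \<le> exp (2 * c2) * f2 y powr p y + weight 2 y"
          by (rule powr_compare[OF q_ge1 f2]) (use decay_log[of y] in \<open>simp add: abs_minus_commute\<close>)
        then show "ennreal (weight 0 y) * ennreal (f2 y powr q) \<le> ennreal (exp (2 * c2)) * ennreal (f2 y powr p y) + ennreal (weight 2 y)"
          by (simp add: weight_def[of 0] ennreal_mult[symmetric] ennreal_plus[symmetric] ennreal_leI del: ennreal_plus)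
      qed
      also have "\<dots> = ennreal (exp (2 * c2)) * (\<integral>\<^sup>+y. ennreal (f2 y powr p y) \<partial>lborel) + ennreal weight_mass"
        by (simp add: nn_integral_add nn_integral_cmult weight_mass_nn)
      also have "(\<integral>\<^sup>+y. ennreal (f2 y powr p y) \<partial>lborel) \<le> 1" by (rule m2)
      finally have "(\<integral>\<^sup>+x. ennreal (\<Theta> x) \<partial>lborel) \<le> ennreal weight_mass * (ennreal (exp (2 * c2)) * 1 + ennreal weight_mass)"
        by (simp add: mult_left_mono)
      then show ?thesis using weight_mass_pos
        by (simp add: ennreal_mult[symmetric] ennreal_plus[symmetric] del: ennreal_plus)
    qed
    finally have "(\<integral>\<^sup>+x. ennreal ((LINT t|lborel. weight (P + 2) t * f (x + d * t)) powr p x) \<partial>lborel)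
      \<le> ennreal a1 * ennreal weight_mass + ennreal a2 * ennreal (weight_mass * (exp (2 * c2) + weight_mass)) + ennreal a3 * ennreal weight_mass"
      by (simp add: mult_left_mono add_mono)
    also have "\<dots> = ennreal C"
      unfolding C_def using nn weight_mass_pos
      by (simp add: ennreal_mult[symmetric] ennreal_plus[symmetric] add_nonneg_nonneg del: ennreal_plus)
    finally show ?thesis using int by blast
  qed
  ultimately show ?thesis by blast
qed

end

section \<open>Uniform boundedness on variable exponent spaces\<close>

context log_hoelder begin

lemma modular_lborel: "modular p f = (\<integral>\<^sup>+ y. ennreal (cmod (f y) powr p y) \<partial>lborel)"
  unfolding modular_def by (rule nn_integral_completion)

lemma modular_mono: "(\<And>y. cmod (f y) \<le> cmod (g y)) \<Longrightarrow> modular p f \<le> modular p g"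
  unfolding modular_def
  by (intro nn_integral_mono ennreal_leI powr_mono2) (auto intro: less_imp_le p_pos)

lemma modular_integrand_measurable:
  assumes "g \<in> borel_measurable lebesgue"
  shows "(\<lambda>y. ennreal (cmod (g y) powr p y)) \<in> borel_measurable lebesgue"
  by (rule measurable_compose[OF powr_real_measurable[OF
        measurable_compose[OF assms borel_measurable_norm] borel_imp_lebesgue[OF p_measurable]] measurable_ennreal])

text \<open>As \<open>p \<ge> 1\<close>, a factor below one comes out of the modular at least linearly. This turns a mere
  bound for a modular into a bound below one.\<close>

lemma modular_shrink:
  assumes "0 \<le> c" "c \<le> 1" "\<And>y. cmod (f y) \<le> c * cmod (g y)" "g \<in> borel_measurable lebesgue"
  shows "modular p f \<le> ennreal c * modular p g"
proof -
  have pt: "cmod (f y) powr p y \<le> c * cmod (g y) powr p y" for y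
  proof -
    have "cmod (f y) powr p y \<le> (c * cmod (g y)) powr p y"
      using assms(3)[of y] p_pos[of y] by (intro powr_mono2) auto
    also have "\<dots> = c powr p y * cmod (g y) powr p y" using assms by (simp add: powr_mult)
    also have "c powr p y \<le> c powr 1"
    proof (cases "c = 0")
      case False
      then show ?thesis using assms p_ge1[of y] by (intro powr_mono') auto
    qed simp
    finally show ?thesis using assms by (simp add: mult_right_mono)
  qed
  have "modular p f \<le> (\<integral>\<^sup>+ y. ennreal c * ennreal (cmod (g y) powr p y) \<partial>lebesgue)"
    unfolding modular_def
    by (rule nn_integral_mono) (use assms pt in \<open>simp add: ennreal_mult[symmetric] ennreal_leI\<close>)
  also have "\<dots> = ennreal c * modular p g"
    unfolding modular_def by (rule nn_integral_cmult[OF modular_integrand_measurable[OF assms(4)]])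
  finally show ?thesis .
qed

lemma Lp_small:
  assumes f: "f \<in> Lp_var p"
  shows "\<exists>\<eta>>0. modular p (\<lambda>y. f y / of_real \<eta>) < 1"
proof -
  from f obtain l :: real where l: "0 < l" "modular p (\<lambda>y. f y / of_real l) < \<infinity>"
    unfolding Lp_var_def by blast
  have [measurable]: "f \<in> borel_measurable lebesgue" using f unfolding Lp_var_def by blast
  define m where "m = enn2real (modular p (\<lambda>y. f y / of_real l))"
  have m: "modular p (\<lambda>y. f y / of_real l) = ennreal m" "0 \<le> m"
    using l(2) unfolding m_def by (simp_all add: ennreal_enn2real)
  define s where "s = 2 + m"
  have s: "1 \<le> s" "m / s < 1" unfolding s_def using m by auto
  have "modular p (\<lambda>y. f y / of_real (l * s)) \<le> ennreal (1 / s) * modular p (\<lambda>y. f y / of_real l)"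
    by (rule modular_shrink) (use s l in \<open>simp_all add: norm_divide norm_mult field_simps\<close>)
  also have "\<dots> = ennreal (m / s)" unfolding m(1) using s m by (simp add: ennreal_mult[symmetric])
  also have "\<dots> < 1" using s by (simp add: ennreal_less_one_iff)
  finally show ?thesis using l s by (intro exI[of _ "l * s"]) auto
qed

text \<open>A norm inequality \<open>\<parallel>h\<parallel> \<le> D \<parallel>f\<parallel>\<close> stated before taking infima. In this form it composes, and
  operators can be added by an elementary inequality in place of the triangle inequality for the
  norm.\<close>

definition modular_dom :: "real \<Rightarrow> (real \<Rightarrow> complex) \<Rightarrow> (real \<Rightarrow> complex) \<Rightarrow> bool" where
  "modular_dom D h f \<longleftrightarrow> 0 < D \<and> h \<in> borel_measurable lebesgue \<and> f \<in> borel_measurable lebesgue \<and>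
     (\<forall>\<eta>>0. modular p (\<lambda>y. f y / of_real \<eta>) < 1 \<longrightarrow> modular p (\<lambda>y. h y / of_real (D * \<eta>)) < 1)"

lemma modular_domD:
  "modular_dom D h f \<Longrightarrow> 0 < \<eta> \<Longrightarrow> modular p (\<lambda>y. f y / of_real \<eta>) < 1 \<Longrightarrow>
     modular p (\<lambda>y. h y / of_real (D * \<eta>)) < 1"
  unfolding modular_dom_def by blast

lemma modular_dom_pos: "modular_dom D h f \<Longrightarrow> 0 < D"
  and modular_dom_measurable: "modular_dom D h f \<Longrightarrow> h \<in> borel_measurable lebesgue"
    "modular_dom D h f \<Longrightarrow> f \<in> borel_measurable lebesgue"
  unfolding modular_dom_def by blast+

lemma modular_domI:
  assumes "0 < D" "h \<in> borel_measurable lebesgue" "f \<in> borel_measurable lebesgue"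
    and "\<And>\<eta>. 0 < \<eta> \<Longrightarrow> modular p (\<lambda>y. f y / of_real \<eta>) < 1 \<Longrightarrow>
      modular p (\<lambda>y. h y / of_real (D * \<eta>)) < 1"
  shows "modular_dom D h f"
  unfolding modular_dom_def using assms by blast

lemma modular_dom_refl: "f \<in> borel_measurable lebesgue \<Longrightarrow> modular_dom 1 f f"
  unfolding modular_dom_def by simp

lemma modular_dom_trans: "modular_dom D1 h g \<Longrightarrow> modular_dom D2 g f \<Longrightarrow> modular_dom (D1 * D2) h f"
proof -
  assume a: "modular_dom D1 h g" "modular_dom D2 g f"
  show ?thesis
  proof (rule modular_domI)
    show "0 < D1 * D2" using a modular_dom_pos by simp
    fix \<eta> :: real assume \<eta>: "0 < \<eta>" "modular p (\<lambda>y. f y / of_real \<eta>) < 1"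
    have "0 < D2 * \<eta>" using modular_dom_pos[OF a(2)] \<eta> by simp
    from modular_domD[OF a(1) this modular_domD[OF a(2) \<eta>]]
    show "modular p (\<lambda>y. h y / of_real (D1 * D2 * \<eta>)) < 1" by (simp only: mult.assoc)
  qed (use a modular_dom_measurable in blast)+
qed

lemma modular_dom_mono: "modular_dom D h f \<Longrightarrow> D \<le> D' \<Longrightarrow> modular_dom D' h f"
proof -
  assume D: "modular_dom D h f" "D \<le> D'"
  have "modular p (\<lambda>y. h y / of_real (D' * \<eta>)) \<le> modular p (\<lambda>y. h y / of_real (D * \<eta>))" if "0 < \<eta>" for \<eta>
    by (rule modular_mono) (use D(2) modular_dom_pos[OF D(1)] that in \<open>auto simp: norm_divide norm_mult intro!: divide_left_mono mult_right_mono mult_pos_pos\<close>)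
  then show ?thesis
    using D modular_dom_pos[OF D(1)] modular_dom_measurable[OF D(1)] modular_domD[OF D(1)]
    by (intro modular_domI) (auto intro: le_less_trans)
qed

lemma modular_dom_scale: "modular_dom D h f \<Longrightarrow> 0 < c \<Longrightarrow> modular_dom (D * c) (\<lambda>x. of_real c * h x) f"
proof -
  assume D: "modular_dom D h f" "0 < c"
  note [measurable] = modular_dom_measurable[OF D(1)]
  have "modular p (\<lambda>y. of_real c * h y / of_real (D * c * \<eta>)) = modular p (\<lambda>y. h y / of_real (D * \<eta>))" for \<eta>
    using D(2) modular_dom_pos[OF D(1)] by (intro arg_cong[where f = "modular p"] ext) (simp add: field_simps)
  then show ?thesis using D(2) modular_dom_pos[OF D(1)] modular_domD[OF D(1)]
    by (intro modular_domI) (auto simp del: of_real_mult)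
qed

text \<open>The factor 4 splits as \<open>2 * 2\<close>: one 2 bounds \<open>(a + b) / 2\<close> by the maximum of \<open>a\<close> and \<open>b\<close>, whose
  power is at most the sum of the powers, and the other one halves that sum of two modulars.\<close>

lemma modular_dom_add:
  assumes "modular_dom D1 h1 f" "modular_dom D2 h2 f"
  shows "modular_dom (4 * (D1 + D2)) (\<lambda>x. h1 x + h2 x) f"
proof -
  define D where "D = D1 + D2"
  have D12: "0 < D1" "0 < D2" using assms by (auto dest: modular_dom_pos)
  then have D: "0 < D" unfolding D_def by simp
  have d1: "modular_dom D h1 f" and d2: "modular_dom D h2 f"
    using D12 modular_dom_mono[OF assms(1), of D] modular_dom_mono[OF assms(2), of D] unfolding D_def by simp_all
  have [measurable]: "h1 \<in> borel_measurable lebesgue" "h2 \<in> borel_measurable lebesgue"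
    "f \<in> borel_measurable lebesgue" using assms by (auto dest: modular_dom_measurable)
  have gm: "(\<lambda>y. h y / of_real c) \<in> borel_measurable lebesgue"
    if "h \<in> borel_measurable lebesgue" for h :: "real \<Rightarrow> complex" and c :: real
    using that by (intro borel_measurable_divide borel_measurable_const)
  have "modular p (\<lambda>y. (h1 y + h2 y) / of_real (4 * D * \<eta>)) < 1"
    if "0 < \<eta>" and m: "modular p (\<lambda>y. f y / of_real \<eta>) < 1" for \<eta>
  proof -
    let ?g1 = "\<lambda>y. h1 y / of_real (D * \<eta>)" and ?g2 = "\<lambda>y. h2 y / of_real (D * \<eta>)"
    have m12: "modular p ?g1 < 1" "modular p ?g2 < 1" using modular_domD[OF d1 that] modular_domD[OF d2 that] by simp_all
    have De: "0 < D * \<eta>" using D that by simp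
    have pt: "cmod ((h1 y + h2 y) / of_real (4 * D * \<eta>)) powr p y
        \<le> (1/2) * (cmod (?g1 y) powr p y + cmod (?g2 y) powr p y)" for y
    proof -
      define a where "a = cmod (?g1 y)"
      define b where "b = cmod (?g2 y)"
      have "(h1 y + h2 y) / of_real (4 * D * \<eta>) = (?g1 y + ?g2 y) / 4"
        using D \<open>0 < \<eta>\<close> by (simp add: field_simps)
      then have "cmod ((h1 y + h2 y) / of_real (4 * D * \<eta>)) = cmod (?g1 y + ?g2 y) / 4"
        by (simp only: norm_divide norm_numeral)
      also have "\<dots> \<le> (a + b) / 4"
        unfolding a_def b_def by (intro divide_right_mono norm_triangle_ineq) simp
      finally have "cmod ((h1 y + h2 y) / of_real (4 * D * \<eta>)) \<le> (a + b) / 4" .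
      also have "\<dots> \<le> (1/2) * max a b" by (simp add: max_def)
      finally have "cmod ((h1 y + h2 y) / of_real (4 * D * \<eta>)) powr p y \<le> ((1/2) * max a b) powr p y"
        using p_pos[of y] by (intro powr_mono2) auto
      also have "\<dots> = (1/2) powr p y * max a b powr p y"
        by (rule powr_mult)
      also have "\<dots> \<le> (1/2) powr 1 * (a powr p y + b powr p y)"
        using p_ge1[of y] by (intro mult_mono powr_mono') (auto simp: max_def)
      finally show ?thesis unfolding a_def b_def by simp
    qed
    have "modular p (\<lambda>y. (h1 y + h2 y) / of_real (4 * D * \<eta>))
      \<le> (\<integral>\<^sup>+ y. ennreal (1/2) * (ennreal (cmod (?g1 y) powr p y) + ennreal (cmod (?g2 y) powr p y)) \<partial>lebesgue)"
      unfolding modular_def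
    proof (rule nn_integral_mono)
      fix y
      show "ennreal (cmod ((h1 y + h2 y) / of_real (4 * D * \<eta>)) powr p y)
         \<le> ennreal (1/2) * (ennreal (cmod (?g1 y) powr p y) + ennreal (cmod (?g2 y) powr p y))"
        using ennreal_leI[OF pt[of y]]
        by (subst (asm) ennreal_mult) (auto simp: ennreal_plus)
    qed
    also have "\<dots> = ennreal (1/2) * (modular p ?g1 + modular p ?g2)"
      unfolding modular_def
      by (simp only: nn_integral_cmult nn_integral_add borel_measurable_add modular_integrand_measurable gm
          \<open>h1 \<in> borel_measurable lebesgue\<close> \<open>h2 \<in> borel_measurable lebesgue\<close>)
    also have "\<dots> < 1"
    proof -
      obtain a b where ab: "modular p ?g1 = ennreal a" "modular p ?g2 = ennreal b" "0 \<le> a" "0 \<le> b"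
        using m12 by (cases "modular p ?g1"; cases "modular p ?g2") auto
      then have "a < 1" "b < 1" using m12 by (auto simp: ennreal_less_one_iff)
      then have "(1/2) * (a + b) < 1" by simp
      then have "ennreal ((1/2) * (a + b)) < 1" by (simp only: ennreal_less_one_iff)
      moreover have "ennreal ((1/2) * (a + b)) = ennreal (1/2) * (ennreal a + ennreal b)"
        using ab by (subst ennreal_mult) (auto simp: ennreal_plus)
      ultimately show ?thesis unfolding ab(1,2) by (simp only:)
    qed
    finally show ?thesis .
  qed
  then show ?thesis using D unfolding D_def[symmetric]
    by (intro modular_domI) (auto simp del: of_real_mult)
qed

lemma modular_dom_norm_le:
  assumes "modular_dom D h f" "f \<in> Lp_var p"
  shows "h \<in> Lp_var p" "norm_var p h \<le> D * norm_var p f"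
proof -
  let ?S = "\<lambda>g. {\<eta>::real. \<eta> > 0 \<and> modular p (\<lambda>y. g y / of_real \<eta>) < 1}"
  have D: "0 < D" using assms by (simp add: modular_dom_def)
  obtain \<eta> where \<eta>: "\<eta> \<in> ?S f" using Lp_small[OF assms(2)] by auto
  have tr: "D * \<eta> \<in> ?S h" if "\<eta> \<in> ?S f" for \<eta> using modular_domD[OF assms(1), of \<eta>] D that by (simp del: of_real_mult)
  show "h \<in> Lp_var p"
    unfolding Lp_var_def using tr[OF \<eta>] modular_dom_measurable(1)[OF assms(1)]
    by (auto intro!: exI[of _ "D * \<eta>"] intro: less_trans simp del: of_real_mult)
  have bdd: "bdd_below (?S h)" by (rule bdd_belowI[of _ 0]) auto
  have "norm_var p h / D \<le> \<eta>'" if "\<eta>' \<in> ?S f" for \<eta>'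
  proof -
    have "norm_var p h \<le> D * \<eta>'" unfolding norm_var_def by (rule cInf_lower[OF tr[OF that] bdd])
    then show ?thesis using D by (simp add: field_simps)
  qed
  then have "norm_var p h / D \<le> norm_var p f"
    unfolding norm_var_def[of p f] using \<eta> by (intro cInf_greatest) auto
  then show "norm_var p h \<le> D * norm_var p f" using D by (simp add: field_simps)
qed

lemma norm_var_nonneg: "f \<in> Lp_var p \<Longrightarrow> 0 \<le> norm_var p f"
  unfolding norm_var_def using Lp_small[of f] by (intro cInf_greatest) auto

text \<open>By \<open>young_split\<close> with \<open>l = 1\<close>, \<open>\<bar>f\<bar>\<close> is at most \<open>1 + \<bar>f\<bar> powr p\<close>.\<close>

lemma Lp_wL1:
  assumes f: "f \<in> Lp_var p" and [measurable]: "f \<in> borel_measurable borel"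
  shows "f \<in> wL1 2"
proof -
  obtain l :: real where l: "0 < l" "modular p (\<lambda>y. f y / of_real l) < 1" using Lp_small[OF f] by auto
  have "(\<integral>\<^sup>+t. ennreal (weight 2 t) * ennreal (cmod (f t)) \<partial>lborel)
     \<le> (\<integral>\<^sup>+t. ennreal l * (ennreal (weight 2 t) + ennreal (cmod (f t / of_real l) powr p t)) \<partial>lborel)"
  proof (rule nn_integral_mono)
    fix t
    have "cmod (f t / of_real l) \<le> 1 + 1 powr (1 - p t) * cmod (f t / of_real l) powr p t"
      using p_ge1 by (intro young_split) auto
    then have "cmod (f t) \<le> l * (1 + cmod (f t / of_real l) powr p t)"
      using l by (simp add: norm_divide field_simps)
    then have "weight 2 t * cmod (f t) \<le> weight 2 t * (l * (1 + cmod (f t / of_real l) powr p t))"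
      by (rule mult_left_mono) simp
    also have "\<dots> = l * (weight 2 t + weight 2 t * cmod (f t / of_real l) powr p t)" by (simp add: algebra_simps)
    also have "\<dots> \<le> l * (weight 2 t + cmod (f t / of_real l) powr p t)"
      using l by (intro mult_left_mono add_left_mono mult_left_le_one_le) (auto simp: weight_def)
    finally have "ennreal (weight 2 t * cmod (f t)) \<le> ennreal (l * (weight 2 t + cmod (f t / of_real l) powr p t))"
      by (rule ennreal_leI)
    then show "ennreal (weight 2 t) * ennreal (cmod (f t)) \<le> ennreal l * (ennreal (weight 2 t) + ennreal (cmod (f t / of_real l) powr p t))"
      using l by (simp add: ennreal_mult ennreal_plus)
  qed
  also have "\<dots> = ennreal l * (ennreal weight_mass + modular p (\<lambda>y. f y / of_real l))"
    unfolding modular_lborel by (subst nn_integral_cmult) (auto simp: nn_integral_add weight_mass_nn)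
  also have "\<dots> < \<infinity>"
    using l by (auto simp: ennreal_mult_less_top intro: less_trans)
  finally show ?thesis unfolding wL1_iff_nn by simp
qed

text \<open>The kernel is majorised by a multiple of the weight of order \<open>P + 2\<close>, so \<open>average_modular_bound\<close> applies to
  \<open>\<bar>f\<bar>\<close>; enlarging the constant makes the resulting modular smaller than one.\<close>

proposition dconv_modular_dom:
  assumes K: "decays (P + 2) K"
  shows "\<exists>D>0. \<forall>d>0. \<forall>f. f \<in> borel_measurable borel \<longrightarrow> modular_dom D (dconv d K f) f"
proof -
  obtain C where C: "0 \<le> C" "\<And>t. \<bar>K t\<bar> \<le> C * weight (P + 2) t" using decays_bound[OF K] by blast
  note [measurable] = decays_measurable[OF K]
  obtain C' where C': "0 < C'" and avg: "\<And>d f. 0 < d \<Longrightarrow> f \<in> borel_measurable borel \<Longrightarrow> (\<And>y. 0 \<le> f y) \<Longrightarrow>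
     (\<integral>\<^sup>+y. ennreal (f y powr p y) \<partial>lborel) \<le> 1 \<Longrightarrow>
     (\<forall>x. integrable lborel (\<lambda>t. weight (P + 2) t * f (x + d * t))) \<and>
     (\<integral>\<^sup>+x. ennreal ((LINT t|lborel. weight (P + 2) t * f (x + d * t)) powr p x) \<partial>lborel) \<le> ennreal C'"
    using average_modular_bound by blast
  define D where "D = (C + 1) * (C' + 1)"
  have D: "0 < D" unfolding D_def using C C' by auto
  have "modular_dom D (dconv d K f) f" if "0 < d" and [measurable]: "f \<in> borel_measurable borel" for d f
  proof -
    have cm: "dconv d K f \<in> borel_measurable borel" by (rule dconv_measurable) measurable
    have fl: "f \<in> borel_measurable lebesgue" "dconv d K f \<in> borel_measurable lebesgue"
      using \<open>f \<in> borel_measurable borel\<close> cm by (auto intro: borel_imp_lebesgue)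
    have "modular p (\<lambda>y. dconv d K f y / of_real (D * \<eta>)) < 1"
      if "0 < \<eta>" and m: "modular p (\<lambda>y. f y / of_real \<eta>) < 1" for \<eta>
    proof -
      define g where "g = (\<lambda>y. cmod (f y) / \<eta>)"
      have [measurable]: "g \<in> borel_measurable borel" unfolding g_def by measurable
      have g0: "0 \<le> g y" for y unfolding g_def using that by simp
      have "(\<integral>\<^sup>+y. ennreal (g y powr p y) \<partial>lborel) \<le> 1"
        using m that unfolding modular_lborel g_def by (simp add: norm_divide)
      from avg[OF \<open>0 < d\<close> \<open>g \<in> _\<close> g0 this]
      have int: "\<And>x. integrable lborel (\<lambda>t. weight (P + 2) t * g (x + d * t))"
        and le: "(\<integral>\<^sup>+x. ennreal ((LINT t|lborel. weight (P + 2) t * g (x + d * t)) powr p x) \<partial>lborel) \<le> ennreal C'"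
        by auto
      define A where "A = (\<lambda>x. LINT t|lborel. weight (P + 2) t * g (x + d * t))"
      have [measurable]: "A \<in> borel_measurable borel" unfolding A_def by measurable
      have A0: "0 \<le> A x" for x unfolding A_def by (rule integral_nonneg_AE) (use g0 in auto)
      have pt: "cmod (dconv d K f x) \<le> C * \<eta> * A x" for x
      proof -
        have fg: "cmod (f y) = \<eta> * g y" for y unfolding g_def using that by simp
        have "cmod (dconv d K f x) \<le> (LINT t|lborel. \<bar>K t\<bar> * cmod (f (x + d * t)))"
          by (rule cmod_dconv_le)
        also have "\<dots> \<le> (LINT t|lborel. C * \<eta> * (weight (P + 2) t * g (x + d * t)))"
        proof (rule Bochner_Integration.integral_mono_AE')
          show "integrable lborel (\<lambda>t. C * \<eta> * (weight (P + 2) t * g (x + d * t)))" using int by simp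
          have "\<bar>K t\<bar> * (\<eta> * g (x + d * t)) \<le> C * weight (P + 2) t * (\<eta> * g (x + d * t))" for t
            using C that g0 by (intro mult_right_mono) auto
          then show "AE t in lborel. \<bar>K t\<bar> * cmod (f (x + d * t)) \<le> C * \<eta> * (weight (P + 2) t * g (x + d * t))"
            unfolding fg by (intro AE_I2) (simp add: mult_ac)
          show "AE t in lborel. 0 \<le> C * \<eta> * (weight (P + 2) t * g (x + d * t))"
            using C that g0 by simp
        qed
        also have "\<dots> = C * \<eta> * A x" unfolding A_def by simp
        finally show ?thesis .
      qed
      have "modular p (\<lambda>y. dconv d K f y / of_real (D * \<eta>)) \<le> ennreal (1 / (C' + 1)) * modular p (\<lambda>y. of_real (A y))"
      proof (rule modular_shrink)
        fix y
        have "cmod (dconv d K f y / of_real (D * \<eta>)) \<le> C * \<eta> * A y / (D * \<eta>)"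
          unfolding norm_divide norm_of_real using D that
          by (simp only: abs_of_pos mult_pos_pos) (intro divide_right_mono pt, simp)
        also have "\<dots> = (C / (C + 1)) * (A y / (C' + 1))" using that unfolding D_def by simp
        also have "\<dots> \<le> 1 * (A y / (C' + 1))"
          using C C' A0[of y] by (intro mult_right_mono) auto
        finally show "cmod (dconv d K f y / of_real (D * \<eta>)) \<le> 1 / (C' + 1) * cmod (complex_of_real (A y))"
          using A0[of y] by simp
        show "(\<lambda>y. complex_of_real (A y)) \<in> borel_measurable lebesgue"
          by (rule borel_imp_lebesgue) measurable
      qed (use C' in auto)
      also have "modular p (\<lambda>y. of_real (A y)) \<le> ennreal C'"
        using le A0 unfolding modular_lborel A_def by simp
      also have "ennreal (1 / (C' + 1)) * ennreal C' < 1"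
        using C' by (simp add: ennreal_mult[symmetric] ennreal_less_one_iff)
      finally show ?thesis by (simp add: mult_left_mono)
    qed
    then show ?thesis by (intro modular_domI D fl)
  qed
  then show ?thesis using D by blast
qed

end

text \<open>The logarithm in the decay condition is at least one, so \<open>p\<close> is bounded everywhere and not only
  almost everywhere. The local condition makes \<open>p\<close> continuous, hence Borel, and the decay
  condition makes \<open>c3\<close> the limit of \<open>p\<close> at infinity, hence at least one.\<close>

lemma log_exponents_log_hoelder:
  assumes "p \<in> log_exponents"
  shows "\<exists>c1 c2 q P. log_hoelder p c1 c2 q P"
proof -
  from assms obtain c1 c2 c3 :: real where c: "0 < c1" "0 < c2"
    and loc: "\<And>x y. \<bar>p x - p y\<bar> * ln (exp 1 + 1 / \<bar>x - y\<bar>) \<le> c1"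
    and dec: "\<And>x. \<bar>p x - c3\<bar> * ln (exp 1 + \<bar>x\<bar>) \<le> c2"
    and p1: "\<And>x. 1 \<le> p x"
    unfolding log_exponents_def exponents_def by blast
  have ln1: "1 \<le> ln (exp 1 + a)" if "0 \<le> a" for a :: real
  proof -
    have "ln (exp 1) \<le> ln (exp 1 + a)" using that by (subst ln_le_cancel_iff) (auto intro: add_pos_nonneg)
    then show ?thesis by simp
  qed
  have bd: "\<bar>p x - c3\<bar> \<le> c2" for x
  proof -
    have "\<bar>p x - c3\<bar> * 1 \<le> \<bar>p x - c3\<bar> * ln (exp 1 + \<bar>x\<bar>)"
      by (intro mult_left_mono ln1) auto
    then show ?thesis using dec[of x] by simp
  qed
  obtain P :: nat where P: "c3 + c2 \<le> real P" using real_arch_simple by blast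
  have pP: "p x \<le> real P" for x using bd[of x] P by linarith
  have q: "1 \<le> c3"
  proof (rule ccontr)
    assume "\<not> 1 \<le> c3"
    define a where "a = 1 - c3"
    have a: "0 < a" using \<open>\<not> 1 \<le> c3\<close> unfolding a_def by simp
    (* far enough out for the decay condition to contradict a gap of size a *)
    define x where "x = exp (c2 / a + 1)"
    have "0 < x" unfolding x_def by simp
    have "c2 / a + 1 = ln x" unfolding x_def by simp
    also have "\<dots> \<le> ln (exp 1 + \<bar>x\<bar>)" using \<open>0 < x\<close> by (subst ln_le_cancel_iff) (auto intro: add_pos_pos)
    finally have "a * (c2 / a + 1) \<le> a * ln (exp 1 + \<bar>x\<bar>)" using a by (intro mult_left_mono) auto
    also have "\<dots> \<le> \<bar>p x - c3\<bar> * ln (exp 1 + \<bar>x\<bar>)"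
      using p1[of x] ln1[of "\<bar>x\<bar>"] unfolding a_def by (intro mult_right_mono) auto
    also have "\<dots> \<le> c2" by (rule dec)
    also have "c2 < c2 + a" using a by simp
    also have "c2 + a = a * (c2 / a + 1)" using a by (simp add: distrib_left)
    finally show False by simp
  qed
  have "continuous_on UNIV p"
    unfolding continuous_on_iff
  proof (intro ballI allI impI)
    fix x e :: real assume "0 < e"
    define \<delta> where "\<delta> = exp (- (c1 / e + 1))"
    have "dist (p y) (p x) < e" if "dist y x < \<delta>" for y
    proof (cases "y = x")
      case False
      define s where "s = \<bar>y - x\<bar>"
      have s: "0 < s" "s < \<delta>" using False that unfolding s_def by (auto simp: dist_real_def)
      have "c1 / e + 1 = ln (1 / \<delta>)" unfolding \<delta>_def by (simp add: ln_div)
      also have "\<dots> \<le> ln (exp 1 + 1 / s)"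
        using s by (subst ln_le_cancel_iff) (auto intro!: add_increasing add_pos_pos divide_left_mono simp: \<delta>_def)
      finally have L: "c1 / e + 1 \<le> ln (exp 1 + 1 / s)" .
      have "\<bar>p y - p x\<bar> * (c1 / e + 1) \<le> \<bar>p y - p x\<bar> * ln (exp 1 + 1 / s)"
        by (rule mult_left_mono[OF L]) simp
      also have "\<dots> \<le> c1" unfolding s_def by (rule loc)
      finally have "\<bar>p y - p x\<bar> * (c1 / e + 1) < e * (c1 / e + 1)"
        using \<open>0 < e\<close> by (simp add: distrib_left)
      then have "\<bar>p y - p x\<bar> < e"
        using c \<open>0 < e\<close> by (subst (asm) mult_less_cancel_right_pos) (auto intro: add_pos_pos)
      then show ?thesis by (simp add: dist_real_def)
    qed (use \<open>0 < e\<close> in simp)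
    moreover have "0 < \<delta>" unfolding \<delta>_def by simp
    ultimately show "\<exists>\<delta>>0. \<forall>y\<in>UNIV. dist y x < \<delta> \<longrightarrow> dist (p y) (p x) < e" by blast
  qed
  then have "p \<in> borel_measurable borel" by (rule borel_measurable_continuous_onI)
  then have "log_hoelder p c1 c2 c3 P"
    using c loc dec p1 pP q by unfold_locales auto
  then show ?thesis by blast
qed

section \<open>A kernel of exponential type and its tails\<close>

definition complex_sinc :: "complex \<Rightarrow> complex" where
  "complex_sinc z = (if z = 0 then 1 else sin z / z)"

lemma complex_sinc_holomorphic: "complex_sinc holomorphic_on UNIV"
proof -
  have "(\<lambda>z. if z = 0 then deriv sin 0 else (sin z - sin 0) / (z - 0)) holomorphic_on (UNIV :: complex set)"
    by (rule pole_lemma_open) (auto intro: holomorphic_intros)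
  moreover have "deriv sin (0::complex) = 1"
    using DERIV_imp_deriv[OF DERIV_sin[of "0::complex"]] by simp
  ultimately show ?thesis unfolding complex_sinc_def by (simp cong: if_cong)
qed

lemma norm_sin_le_exp: "cmod (sin z) \<le> exp \<bar>Im z\<bar>"
proof -
  have "cmod (sin z) = cmod (exp (\<i> * z) - exp (- (\<i> * z))) / 2"
    unfolding sin_exp_eq by (simp add: norm_divide norm_mult)
  also have "\<dots> \<le> (cmod (exp (\<i> * z)) + cmod (exp (- (\<i> * z)))) / 2"
    by (intro divide_right_mono norm_triangle_ineq4) auto
  also have "\<dots> = (exp (- Im z) + exp (Im z)) / 2" by simp
  also have "\<dots> \<le> exp \<bar>Im z\<bar>"
  proof -
    have "exp (- Im z) \<le> exp \<bar>Im z\<bar>" "exp (Im z) \<le> exp \<bar>Im z\<bar>" by auto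
    from add_mono[OF this] show ?thesis by simp
  qed
  finally show ?thesis .
qed

lemma complex_sinc_bound: "\<exists>B>0. \<forall>z. cmod (complex_sinc z) \<le> B * exp \<bar>Im z\<bar> / (1 + cmod z)"
proof -
  have "compact (complex_sinc ` cball 0 1)"
    by (intro compact_continuous_image holomorphic_on_imp_continuous_on
        holomorphic_on_subset[OF complex_sinc_holomorphic]) auto
  then obtain B0 where B0: "\<And>z. cmod z \<le> 1 \<Longrightarrow> cmod (complex_sinc z) \<le> B0"
    by (force simp: bounded_iff dest: compact_imp_bounded)
  define B where "B = 2 * (1 + \<bar>B0\<bar>)"
  have "cmod (complex_sinc z) \<le> B * exp \<bar>Im z\<bar> / (1 + cmod z)" for z
  proof (cases "cmod z \<le> 1")
    case True
    have "cmod (complex_sinc z) * (1 + cmod z) \<le> (1 + \<bar>B0\<bar>) * 2"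
      using B0[OF True] True by (intro mult_mono) auto
    also have "\<dots> = B * 1" unfolding B_def by simp
    also have "\<dots> \<le> B * exp \<bar>Im z\<bar>" unfolding B_def by (intro mult_left_mono) auto
    finally show ?thesis by (simp add: field_simps add_pos_nonneg)
  next
    case False
    then have z: "z \<noteq> 0" "1 < cmod z" by auto
    have "cmod (complex_sinc z) = cmod (sin z) / cmod z" using z unfolding complex_sinc_def by (simp add: norm_divide)
    also have "\<dots> \<le> exp \<bar>Im z\<bar> / cmod z" by (intro divide_right_mono norm_sin_le_exp) auto
    also have "\<dots> \<le> 2 * exp \<bar>Im z\<bar> / (1 + cmod z)"
      using z by (simp add: field_simps)
    also have "\<dots> \<le> B * exp \<bar>Im z\<bar> / (1 + cmod z)"
      unfolding B_def by (intro divide_right_mono mult_right_mono) auto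
    finally show ?thesis .
  qed
  moreover have "0 < B" unfolding B_def by simp
  ultimately show ?thesis by blast
qed

text \<open>The function \<open>(sin (z / n) / (z / n)) ^ n\<close> has exponential type \<open>n * (1 / n) = 1\<close> and decays like
  \<open>\<bar>z\<bar>\<close> to the power \<open>- n\<close> along horizontal lines; it only has to be normalised.\<close>

proposition exp_type_kernel:
  "\<exists>(Vc :: complex \<Rightarrow> complex) V C. Vc holomorphic_on UNIV \<and> (\<forall>t. Vc (of_real t) = of_real (V t)) \<and> decays M V \<and>
     (LINT t|lborel. V t) = 1 \<and> 0 \<le> C \<and>
     (\<forall>z. cmod (Vc z) \<le> C * exp \<bar>Im z\<bar> * weight M (Re z))"
proof -
  (* An even exponent makes the kernel nonnegative on the line, so that its integral is positive. *)
  define n where "n = 2 * (M + 1)"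
  have n: "0 < n" "even n" "M \<le> n" "2 \<le> n" unfolding n_def by auto
  obtain B where B: "0 < B" "\<And>z. cmod (complex_sinc z) \<le> B * exp \<bar>Im z\<bar> / (1 + cmod z)"
    using complex_sinc_bound by blast
  define S where "S = (\<lambda>z. complex_sinc (z / of_nat n) ^ n)"
  define s where "s = (\<lambda>t::real. (if t = 0 then 1 else sin (t / real n) / (t / real n)) ^ n)"
  have S_hol: "S holomorphic_on UNIV"
    unfolding S_def using n
    by (intro holomorphic_on_power holomorphic_on_compose_gen[OF _ complex_sinc_holomorphic, unfolded o_def] holomorphic_intros) auto
  have Ss: "S (of_real t) = of_real (s t)" for t
  proof -
    have "sin (complex_of_real t / of_nat n) = of_real (sin (t / real n))"
      by (metis of_real_divide of_real_of_nat_eq sin_of_real)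
    then show ?thesis unfolding S_def s_def complex_sinc_def using n by simp
  qed
  define C0 where "C0 = B ^ n * real n ^ n"
  have S_bound: "cmod (S z) \<le> C0 * exp \<bar>Im z\<bar> * weight n (Re z)" for z
  proof -
    have "cmod (S z) \<le> (B * exp \<bar>Im (z / of_nat n)\<bar> / (1 + cmod (z / of_nat n))) ^ n"
      unfolding S_def norm_power by (intro power_mono B) auto
    also have "\<dots> = B ^ n * exp (\<bar>Im (z / of_nat n)\<bar>) ^ n / (1 + cmod (z / of_nat n)) ^ n"
      by (simp add: power_divide power_mult_distrib)
    also have "exp (\<bar>Im (z / of_nat n)\<bar>) ^ n = exp \<bar>Im z\<bar>"
    proof -
      have "Im (z / of_nat n) = Im z / real n" by simp
      then have "real n * \<bar>Im (z / of_nat n)\<bar> = \<bar>Im z\<bar>" using n by simp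
      then show ?thesis by (metis exp_of_nat_mult)
    qed
    also have "B ^ n * exp \<bar>Im z\<bar> / (1 + cmod (z / of_nat n)) ^ n
       \<le> B ^ n * exp \<bar>Im z\<bar> / ((1 + \<bar>Re z\<bar>) / real n) ^ n"
    proof (intro divide_left_mono power_mono mult_nonneg_nonneg mult_pos_pos zero_less_power)
      have "(1 + \<bar>Re z\<bar>) / real n \<le> (real n + cmod z) / real n"
        using abs_Re_le_cmod[of z] n by (intro divide_right_mono add_mono) auto
      also have "\<dots> = 1 + cmod (z / of_nat n)" using n by (simp add: norm_divide add_divide_distrib)
      finally show "(1 + \<bar>Re z\<bar>) / real n \<le> 1 + cmod (z / of_nat n)" .
    qed (use B n in \<open>auto intro: add_pos_nonneg divide_pos_pos\<close>)
    also have "\<dots> = C0 * exp \<bar>Im z\<bar> * weight n (Re z)"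
      unfolding C0_def weight_def by (simp add: power_divide)
    finally show ?thesis .
  qed
  have C0: "0 \<le> C0" unfolding C0_def using B by simp
  have s_cont: "continuous_on UNIV s"
  proof -
    have "s = (\<lambda>t. Re (S (of_real t)))" using Ss by auto
    moreover have "continuous_on UNIV (\<lambda>t. Re (S (of_real t)))"
      by (intro continuous_intros continuous_on_compose2[OF holomorphic_on_imp_continuous_on[OF S_hol]]) auto
    ultimately show ?thesis by simp
  qed
  have s_meas [measurable]: "s \<in> borel_measurable borel"
    by (rule borel_measurable_continuous_onI[OF s_cont])
  have s_bound: "\<bar>s t\<bar> \<le> C0 * weight n t" for t
  proof -
    have "\<bar>s t\<bar> = cmod (S (of_real t))" unfolding Ss by simp
    then show ?thesis using S_bound[of "of_real t"] by simp
  qed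
  have s_kern: "decays n s" unfolding decays_def using s_meas s_bound by blast
  have s_int: "integrable lborel s" by (rule decays_integrable[OF s_kern n(4)])
  have s_nn: "0 \<le> s t" for t unfolding s_def using n(2) by (rule zero_le_even_power)
  define J where "J = (LINT t|lborel. s t)"
  have "J \<noteq> 0"
  proof
    assume "J = 0"
    then have "AE t in lborel. s t = 0"
      unfolding J_def using integral_nonneg_eq_0_iff_AE[OF s_int] s_nn by auto
    moreover have "s t \<noteq> 0" if "t \<in> {0<..<1}" for t
    proof -
      have "t < real n" using that n by auto
      then have "t / real n < 1" using n by (simp add: divide_less_eq)
      moreover have "0 < t / real n" using that n by simp
      ultimately have "0 < sin (t / real n)" using pi_gt3 by (intro sin_gt_zero) linarith+
      then show ?thesis using that n unfolding s_def by simp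
    qed
    ultimately have "AE t in lborel. t \<notin> {0<..<1::real}" by (auto elim!: eventually_mono)
    then have "emeasure lborel {0<..<1::real} = 0" by (subst (asm) AE_iff_null_sets[symmetric]) (auto simp: null_sets_def)
    then show False by simp
  qed
  moreover have "0 \<le> J" unfolding J_def by (rule integral_nonneg_AE) (use s_nn in auto)
  ultimately have J: "0 < J" by simp
  define Vc where "Vc = (\<lambda>z. S z / of_real J)"
  define V where "V = (\<lambda>t. s t / J)"
  have "Vc holomorphic_on UNIV" unfolding Vc_def using J by (intro holomorphic_intros S_hol) auto
  moreover have "Vc (of_real t) = of_real (V t)" for t unfolding Vc_def V_def Ss by simp
  moreover have "cmod (Vc z) \<le> (C0 / J) * exp \<bar>Im z\<bar> * weight M (Re z)" for z
  proof -
    have "cmod (Vc z) = cmod (S z) / J" unfolding Vc_def using J by (simp add: norm_divide)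
    also have "\<dots> \<le> (C0 * exp \<bar>Im z\<bar> * weight n (Re z)) / J" using S_bound J by (intro divide_right_mono) auto
    also have "\<dots> \<le> (C0 * exp \<bar>Im z\<bar> * weight M (Re z)) / J"
      using J C0 n by (intro divide_right_mono mult_left_mono weight_antimono) auto
    finally show ?thesis by simp
  qed
  moreover have "decays M V"
  proof -
    have "V \<in> borel_measurable borel" unfolding V_def by measurable
    moreover have "\<bar>V t\<bar> \<le> (C0 / J) * weight n t" for t
      unfolding V_def using s_bound[of t] J by (simp add: abs_divide field_simps)
    ultimately have "decays n V" unfolding decays_def by blast
    then show ?thesis using decays_mono n by blast
  qed
  moreover have "(LINT t|lborel. V t) = 1" unfolding V_def using J J_def by simp
  moreover have "0 \<le> C0 / J" using C0 J by simp
  ultimately show ?thesis by blast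
qed

lemma tail_integral_bound:
  assumes V: "decays (M + 2) V"
  shows "\<exists>C\<ge>0. \<forall>a\<ge>0. (LINT s|lborel. \<bar>V s\<bar> * indicator {s. a \<le> \<bar>s\<bar>} s) \<le> C * weight M a"
proof -
  obtain C where C: "0 \<le> C" "\<And>t. \<bar>V t\<bar> \<le> C * weight (M + 2) t" using decays_bound[OF V] by blast
  have "(LINT s|lborel. \<bar>V s\<bar> * indicator {s. a \<le> \<bar>s\<bar>} s) \<le> (C * weight_mass) * weight M a" if "0 \<le> a" for a
  proof -
    have pt: "\<bar>V s\<bar> * indicator {s. a \<le> \<bar>s\<bar>} s \<le> (C * weight M a) * weight 2 s" for s
    proof (cases "a \<le> \<bar>s\<bar>")
      case True
      have "weight (M + 2) s = weight M s * weight 2 s" unfolding weight_def by (simp add: power_add power2_eq_square)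
      moreover have "weight M s \<le> weight M a"
        unfolding weight_def using True that by (intro divide_left_mono power_mono mult_pos_pos zero_less_power) auto
      ultimately have "weight (M + 2) s \<le> weight M a * weight 2 s" by (simp add: mult_right_mono)
      then have "C * weight (M + 2) s \<le> C * (weight M a * weight 2 s)" using C by (intro mult_left_mono) auto
      then show ?thesis using C(2)[of s] True by (simp add: mult.assoc)
    qed (use C in simp)
    have "(LINT s|lborel. \<bar>V s\<bar> * indicator {s. a \<le> \<bar>s\<bar>} s) \<le> (LINT s|lborel. (C * weight M a) * weight 2 s)"
      by (rule Bochner_Integration.integral_mono_AE') (use pt C integrable_weight[of 2] in auto)
    also have "\<dots> = (C * weight_mass) * weight M a" unfolding weight_mass_def by simp
    finally show ?thesis .
  qed
  moreover have "0 \<le> C * weight_mass" using C weight_mass_pos by simp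
  ultimately show ?thesis by blast
qed

text \<open>For \<open>t > 0\<close> this is minus the integral of \<open>V\<close> over the half-line to the right of \<open>t\<close>, for \<open>t < 0\<close> the
  integral over the half-line to the left of \<open>t\<close>. If \<open>V\<close> has integral one, its distributional
  derivative is \<open>V - \<delta>\<^sub>0\<close>.\<close>

definition tail_kernel :: "(real \<Rightarrow> real) \<Rightarrow> real \<Rightarrow> real" where
  "tail_kernel V t = (LINT s|lborel. V s * (indicator {s. s < t \<and> t < 0} s - indicator {s. 0 < t \<and> t < s} s))"

text \<open>This bounds the integral of the absolute value, not just \<open>tail_kernel\<close>, and thereby also provides
  the integrability for exchanging integrals in \<open>density_tail_identity\<close>.\<close>

lemma tail_abs_bound:
  assumes V: "decays (M + 2) V"
  shows "\<exists>C\<ge>0. \<forall>t. (LINT s|lborel. \<bar>V s * (indicator {s. s < t \<and> t < 0} s - indicator {s. 0 < t \<and> t < s} s)\<bar>) \<le> C * weight M t"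
proof -
  note [measurable] = decays_measurable[OF V]
  obtain C where C: "0 \<le> C" "\<And>a. 0 \<le> a \<Longrightarrow> (LINT s|lborel. \<bar>V s\<bar> * indicator {s. a \<le> \<bar>s\<bar>} s) \<le> C * weight M a"
    using tail_integral_bound[OF V] by blast
  have iV: "integrable lborel V" by (rule decays_integrable[OF V]) simp
  have "(LINT s|lborel. \<bar>V s * (indicator {s. s < t \<and> t < 0} s - indicator {s. 0 < t \<and> t < s} s)\<bar>) \<le> C * weight M t" for t
  proof -
    have "(LINT s|lborel. \<bar>V s * (indicator {s. s < t \<and> t < 0} s - indicator {s. 0 < t \<and> t < s} s)\<bar>)
      \<le> (LINT s|lborel. \<bar>V s\<bar> * indicator {s. \<bar>t\<bar> \<le> \<bar>s\<bar>} s)"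
    proof (rule Bochner_Integration.integral_mono_AE')
      show "integrable lborel (\<lambda>s. \<bar>V s\<bar> * indicator {s. \<bar>t\<bar> \<le> \<bar>s\<bar>} s)"
        by (rule Bochner_Integration.integrable_bound[OF iV]) (auto simp: indicator_def)
    qed (auto simp: indicator_def abs_mult)
    also have "\<dots> \<le> C * weight M \<bar>t\<bar>" by (rule C) simp
    finally show ?thesis by (simp add: weight_def)
  qed
  then show ?thesis using C(1) by blast
qed

lemma tail_kernel_decays:
  assumes V: "decays (M + 2) V"
  shows "decays M (tail_kernel V)"
proof -
  note [measurable] = decays_measurable[OF V]
  obtain C where C: "\<And>t. (LINT s|lborel. \<bar>V s * (indicator {s. s < t \<and> t < 0} s - indicator {s. 0 < t \<and> t < s} s)\<bar>) \<le> C * weight M t"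
    using tail_abs_bound[OF V] by blast
  have "\<bar>tail_kernel V t\<bar> \<le> C * weight M t" for t
    unfolding tail_kernel_def by (rule order_trans[OF integral_abs_bound C])
  moreover have "tail_kernel V \<in> borel_measurable borel" unfolding tail_kernel_def by measurable
  ultimately show ?thesis unfolding decays_def by blast
qed

section \<open>The renewal density of the uniform distribution\<close>

abbreviation unit_box :: "real \<Rightarrow> real" where
  "unit_box \<equiv> indicator {0..1}"

lemma unit_box_decays: "decays M unit_box"
  unfolding decays_def
proof (intro conjI exI[of _ "2 ^ M"] allI)
  fix t :: real
  show "\<bar>unit_box t\<bar> \<le> 2 ^ M * weight M t"
  proof (cases "t \<in> {0..1}")
    case True
    then have "(1 + \<bar>t\<bar>) ^ M \<le> 2 ^ M" by (intro power_mono) auto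
    then show ?thesis using True unfolding weight_def by simp
  qed simp
qed simp

lemma convolution_measurable:
  assumes "L \<in> borel_measurable borel" "K \<in> borel_measurable borel"
  shows "convolution L K \<in> borel_measurable borel"
proof -
  note [measurable] = assms
  show ?thesis unfolding convolution_def by measurable
qed

lemma integral_reflect: "(LINT t|lborel. g (s - t)) = (LINT t|lborel. g t)" for g :: "real \<Rightarrow> real"
  by (subst (2) lborel_integral_real_affine[where c = "-1" and t = s]) auto

lemma convolution_commute: "convolution L K s = convolution K L s"
  unfolding convolution_def by (subst integral_reflect[of _ s, symmetric]) (simp add: mult.commute)

lemma Icc_integrable: "integrable lborel (indicator {a..b} :: real \<Rightarrow> real)"
  by (intro integrable_real_indicator) (auto simp: emeasure_lborel_Icc_eq)

lemma box_integrable: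
  fixes v :: "real \<Rightarrow> real"
  assumes [measurable]: "v \<in> borel_measurable borel" and b: "\<And>t. 0 \<le> t \<Longrightarrow> t \<le> 1 \<Longrightarrow> \<bar>v (s - t)\<bar> \<le> B"
  shows "integrable lborel (\<lambda>t. unit_box t * v (s - t))"
proof (rule Bochner_Integration.integrable_bound)
  show "integrable lborel (\<lambda>t. B * unit_box t)"
    by (intro integrable_mult_right integrable_real_indicator) auto
  show "AE t in lborel. norm (unit_box t * v (s - t)) \<le> norm (B * unit_box t)"
    using b by (intro AE_I2) (auto simp: indicator_def intro: order_trans[OF _ abs_ge_self])
qed measurable

text \<open>The density of the sum of \<open>n + 1\<close> independent uniformly distributed random variables.\<close>

fun box_power :: "nat \<Rightarrow> real \<Rightarrow> real" where
  "box_power 0 = unit_box"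
| "box_power (Suc n) = convolution unit_box (box_power n)"

lemma box_power_measurable [measurable]: "box_power n \<in> borel_measurable borel"
  by (induction n) (auto intro: convolution_measurable)

lemma box_power_nonneg: "0 \<le> box_power n s"
proof (induction n arbitrary: s)
  case (Suc n)
  then show ?case by (auto simp: convolution_def intro!: integral_nonneg_AE)
qed simp

lemma box_power_neg: "s < 0 \<Longrightarrow> box_power n s = 0"
proof (induction n arbitrary: s)
  case (Suc n)
  have "unit_box t * box_power n (s - t) = 0" for t
    using Suc by (auto simp: indicator_def)
  then have "(\<lambda>t. unit_box t * box_power n (s - t)) = (\<lambda>t. 0)" by (rule ext)
  then show ?case unfolding box_power.simps convolution_def by simp
qed simp

text \<open>The powers of the indicator function of \<open>[0,1]\<close> are dominated by those of the indicator function
  of \<open>[0,\<infinity>)\<close>, which are the monomials \<open>s ^ n / fact n\<close>.\<close>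

lemma box_power_le: "0 \<le> s \<Longrightarrow> box_power n s \<le> s ^ n / fact n"
proof (induction n arbitrary: s)
  case (Suc n)
  define F where "F = (\<lambda>t. - ((s - t) ^ Suc n) / fact (Suc n))"
  have D: "(F has_real_derivative (s - t) ^ n / fact n) (at t)" for t
  proof -
    have "(F has_real_derivative - (real (Suc n) * (s - t) ^ n * (-1)) / fact (Suc n)) (at t)"
      unfolding F_def by (auto intro!: derivative_eq_intros simp del: power_Suc)
    moreover have "- (real (Suc n) * (s - t) ^ n * (-1)) / fact (Suc n) = (s - t) ^ n / fact n"
      by (simp add: fact_Suc del: of_nat_Suc)
    ultimately show ?thesis by simp
  qed
  have I: "has_bochner_integral lborel (\<lambda>t. (s - t) ^ n / fact n * indicator {0..s} t) (F s - F 0)"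
    by (rule has_bochner_integral_FTC_Icc_real) (use Suc D in \<open>auto intro!: continuous_intros\<close>)
  have "box_power (Suc n) s \<le> (LINT t|lborel. (s - t) ^ n / fact n * indicator {0..s} t)"
    unfolding box_power.simps convolution_def
  proof (rule Bochner_Integration.integral_mono_AE')
    show "AE t in lborel. unit_box t * box_power n (s - t) \<le> (s - t) ^ n / fact n * indicator {0..s} t"
    proof (rule AE_I2)
      fix t
      show "unit_box t * box_power n (s - t) \<le> (s - t) ^ n / fact n * indicator {0..s} t"
      proof (cases "0 \<le> t \<and> t \<le> s")
        case True
        then show ?thesis using Suc.IH[of "s - t"] box_power_nonneg[of n "s - t"] by (auto simp: indicator_def)
      next
        case False
        then show ?thesis using box_power_neg[of "s - t" n] by (auto simp: indicator_def)
      qed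
    qed
  qed (use I in \<open>auto simp: has_bochner_integral_iff indicator_def\<close>)
  also have "\<dots> = s ^ Suc n / fact (Suc n)"
    using I unfolding has_bochner_integral_iff F_def by (simp del: power_Suc fact_Suc)
  finally show ?case .
qed (simp add: indicator_def)

lemma box_power_summable: "summable (\<lambda>n. box_power n s)"
proof (cases "0 \<le> s")
  case True
  show ?thesis
    by (rule summable_comparison_test'[OF summable_exp[of s], of 0])
       (use True box_power_le[of s] box_power_nonneg in \<open>simp add: field_simps\<close>)
qed (simp add: box_power_neg)

definition renewal_density :: "real \<Rightarrow> real" where
  "renewal_density s = (\<Sum>n. box_power n s)"

lemma renewal_density_measurable [measurable]: "renewal_density \<in> borel_measurable borel"
  unfolding renewal_density_def by measurable

lemma renewal_density_nonneg: "0 \<le> renewal_density s"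
  unfolding renewal_density_def by (intro suminf_nonneg box_power_summable box_power_nonneg)

lemma renewal_density_neg: "s < 0 \<Longrightarrow> renewal_density s = 0"
  unfolding renewal_density_def by (simp add: box_power_neg)

lemma renewal_density_le: "renewal_density s \<le> exp \<bar>s\<bar>"
proof (cases "0 \<le> s")
  case True
  have "renewal_density s \<le> (\<Sum>n. s ^ n /\<^sub>R fact n)"
    unfolding renewal_density_def
    by (intro suminf_le box_power_summable summable_exp_generic) (use True box_power_le[of s] in \<open>simp add: field_simps\<close>)
  also have "\<dots> = exp s" by (simp add: exp_def)
  finally show ?thesis using True by simp
qed (simp add: renewal_density_neg)

lemma renewal_density_renewal: "renewal_density s = unit_box s + convolution unit_box renewal_density s"
proof -
  have b: "\<bar>box_power n (s - t)\<bar> \<le> exp (\<bar>s\<bar> + 1)" if "0 \<le> t" "t \<le> 1" for n t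
  proof -
    have "box_power n (s - t) \<le> renewal_density (s - t)"
      unfolding renewal_density_def using sum_le_suminf[OF box_power_summable, of "{n}" "s - t"] box_power_nonneg by simp
    also have "\<dots> \<le> exp \<bar>s - t\<bar>" by (rule renewal_density_le)
    also have "\<dots> \<le> exp (\<bar>s\<bar> + 1)" using that by simp
    finally show ?thesis using box_power_nonneg by simp
  qed
  have int: "integrable lborel (\<lambda>t. unit_box t * box_power n (s - t))" for n
    by (rule box_integrable[OF box_power_measurable b])
  have "(\<Sum>n. box_power (Suc n) s) = (\<Sum>n. LINT t|lborel. unit_box t * box_power n (s - t))"
    by (simp add: convolution_def)
  also have "\<dots> = (LINT t|lborel. (\<Sum>n. unit_box t * box_power n (s - t)))"
  proof (rule integral_suminf[symmetric])
    have nrm: "norm (unit_box t * box_power n (s - t)) = unit_box t * box_power n (s - t)" for t n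
      using box_power_nonneg[of n "s - t"] by (simp add: abs_mult)
    show "AE t in lborel. summable (\<lambda>n. norm (unit_box t * box_power n (s - t)))"
      unfolding nrm by (intro AE_I2 summable_mult box_power_summable)
    show "summable (\<lambda>n. LINT t|lborel. norm (unit_box t * box_power n (s - t)))"
      unfolding nrm using box_power_summable[of s] by (subst (asm) summable_Suc_iff[symmetric]) (simp add: convolution_def)
  qed (rule int)
  also have "\<dots> = convolution unit_box renewal_density s"
    unfolding convolution_def renewal_density_def by (intro Bochner_Integration.integral_cong refl suminf_mult box_power_summable)
  finally have "(\<Sum>n. box_power (Suc n) s) = convolution unit_box renewal_density s" .
  moreover have "(\<Sum>n. box_power (Suc n) s) = renewal_density s - box_power 0 s"
    unfolding renewal_density_def by (rule suminf_split_head[OF box_power_summable])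
  ultimately show ?thesis by simp
qed

text \<open>The exponential bound only serves to have local boundedness in a form that is stable under
  negation.\<close>

definition averaging :: "(real \<Rightarrow> real) \<Rightarrow> bool" where
  "averaging v \<longleftrightarrow> v \<in> borel_measurable borel \<and> (\<forall>s. \<bar>v s\<bar> \<le> exp \<bar>s\<bar>) \<and>
     (\<forall>s>1. v s = (LINT t|lborel. unit_box t * v (s - t)))"

lemma averaging_uminus: "averaging v \<Longrightarrow> averaging (\<lambda>s. - v s)"
  unfolding averaging_def by auto

lemma averaging_renewal_density: "averaging renewal_density"
  unfolding averaging_def
proof (intro conjI allI impI)
  fix s :: real
  show "\<bar>renewal_density s\<bar> \<le> exp \<bar>s\<bar>" using renewal_density_le[of s] renewal_density_nonneg[of s] by simp
  assume "1 < s"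
  then show "renewal_density s = (LINT t|lborel. unit_box t * renewal_density (s - t))"
    using renewal_density_renewal[of s] unfolding convolution_def by (simp only: indicator_simps atLeastAtMost_iff) simp
qed measurable

lemma averaging_integrable:
  assumes "averaging v"
  shows "integrable lborel (\<lambda>t. unit_box t * v (s - t))"
proof (rule box_integrable)
  show "v \<in> borel_measurable borel" using assms by (simp add: averaging_def)
  fix t :: real assume "0 \<le> t" "t \<le> 1"
  have "\<bar>v (s - t)\<bar> \<le> exp \<bar>s - t\<bar>" using assms by (simp add: averaging_def)
  also have "\<dots> \<le> exp (\<bar>s\<bar> + 1)" using \<open>0 \<le> t\<close> \<open>t \<le> 1\<close> by simp
  finally show "\<bar>v (s - t)\<bar> \<le> exp (\<bar>s\<bar> + 1)" .
qed

text \<open>The tool for all estimates of an average: the upper bound \<open>M\<close> may be changed by \<open>r\<close> on the part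
  \<open>{a..b}\<close> of the averaging interval.\<close>

lemma averaging_le:
  assumes v: "averaging v" and "1 < s" and ab: "a \<le> b"
    and pt: "\<And>t. 0 \<le> t \<Longrightarrow> t \<le> 1 \<Longrightarrow> v (s - t) \<le> M + (if a \<le> t \<and> t \<le> b then r else 0)"
    and "0 \<le> a" "b \<le> 1"
  shows "v s \<le> M + r * (b - a)"
proof -
  have "v s = (LINT t|lborel. unit_box t * v (s - t))" using v \<open>1 < s\<close> by (simp add: averaging_def)
  also have "\<dots> \<le> (LINT t|lborel. M * unit_box t + r * indicator {a..b} t)"
  proof (rule integral_mono[OF averaging_integrable[OF v]])
    show "integrable lborel (\<lambda>t. M * unit_box t + r * indicator {a..b} t)"
      by (intro Bochner_Integration.integrable_add integrable_mult_right Icc_integrable)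
    fix t
    show "unit_box t * v (s - t) \<le> M * unit_box t + r * indicator {a..b} t"
      using pt[of t] \<open>0 \<le> a\<close> \<open>b \<le> 1\<close> by (auto simp: indicator_def split: if_splits)
  qed
  also have "\<dots> = M + r * (b - a)"
    unfolding Bochner_Integration.integral_add[OF integrable_mult_right[OF Icc_integrable] integrable_mult_right[OF Icc_integrable]]
    using ab by (simp add: emeasure_lborel_Icc_eq)
  finally show ?thesis .
qed

text \<open>For \<open>s \<le> c + 3/2\<close> at least half of the averaging interval of \<open>s\<close> lies in \<open>[c, c + 1]\<close>. So the excess of
  the supremum \<open>S\<close> over \<open>M\<close> is at most half of itself, hence not positive. A step of full length
  one would not give a factor below one.\<close>

lemma averaging_max_step:
  assumes v: "averaging v" and "0 \<le> c" and M: "\<And>s. c \<le> s \<Longrightarrow> s \<le> c + 1 \<Longrightarrow> v s \<le> M"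
    and s: "c \<le> s" "s \<le> c + 3/2"
  shows "v s \<le> M"
proof -
  define S where "S = (SUP s\<in>{c..c + 3/2}. v s)"
  have bdd: "bdd_above (v ` {c..c + 3/2})"
  proof (rule bdd_aboveI2)
    fix s assume "s \<in> {c..c + 3/2}"
    have "v s \<le> exp \<bar>s\<bar>" using v unfolding averaging_def by (meson abs_le_D1)
    also have "\<dots> \<le> exp (c + 3/2)" using \<open>s \<in> _\<close> \<open>0 \<le> c\<close> by simp
    finally show "v s \<le> exp (c + 3/2)" .
  qed
  have vS: "v s \<le> S" if "s \<in> {c..c + 3/2}" for s
    unfolding S_def using that bdd by (rule cSUP_upper)
  have "S \<le> M"
  proof (rule ccontr)
    assume "\<not> S \<le> M"
    have "v s \<le> M + (S - M) * (1/2 - 0)" if "s \<in> {c..c + 3/2}" for s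
    proof (cases "s \<le> c + 1")
      case True
      then have "v s \<le> M" using M[of s] that by simp
      moreover have "0 \<le> (S - M) * (1/2 - 0)" using \<open>\<not> S \<le> M\<close> by simp
      ultimately show ?thesis by linarith
    next
      case False
      show ?thesis
      proof (rule averaging_le[OF v])
        fix t :: real assume t: "0 \<le> t" "t \<le> 1"
        show "v (s - t) \<le> M + (if 0 \<le> t \<and> t \<le> 1/2 then S - M else 0)"
          using M[of "s - t"] vS[of "s - t"] t that False \<open>\<not> S \<le> M\<close> by auto
      qed (use False \<open>0 \<le> c\<close> in auto)
    qed
    then have "S \<le> M + (S - M) * (1/2 - 0)"
      unfolding S_def by (intro cSUP_least) auto
    then show False using \<open>\<not> S \<le> M\<close> by (simp add: field_simps)
  qed
  then show ?thesis using vS[of s] s by auto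
qed

lemma averaging_max:
  assumes v: "averaging v" and "0 \<le> c" and M: "\<And>s. c \<le> s \<Longrightarrow> s \<le> c + 1 \<Longrightarrow> v s \<le> M"
    and s: "c \<le> s"
  shows "v s \<le> M"
proof -
  have "\<forall>s. c \<le> s \<longrightarrow> s \<le> c + 1 + real n / 2 \<longrightarrow> v s \<le> M" for n
  proof (induction n)
    case (Suc n)
    show ?case
    proof (intro allI impI)
      fix s assume s: "c \<le> s" "s \<le> c + 1 + real (Suc n) / 2"
      show "v s \<le> M"
      proof (cases "s \<le> c + 1 + real n / 2")
        case True
        then show ?thesis using Suc s by blast
      next
        case False
        show ?thesis
        proof (rule averaging_max_step[OF v, of "c + real n / 2"])
          fix y assume "c + real n / 2 \<le> y" "y \<le> c + real n / 2 + 1"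
          then have "c \<le> y" "y \<le> c + 1 + real n / 2" using of_nat_0_le_iff[of n] by linarith+
          then show "v y \<le> M" using Suc by blast
        next
          show "s \<le> c + real n / 2 + 3 / 2" using s by (simp add: add_divide_distrib)
        qed (use False \<open>0 \<le> c\<close> in auto)
      qed
    qed
  qed (use M in auto)
  note H = this
  obtain n :: nat where "2 * (s - c) \<le> real n" using real_arch_simple by blast
  then have "s \<le> c + 1 + real n / 2" by (simp add: field_simps)
  then show ?thesis using H[of n] s by blast
qed

text \<open>The averages over two unit intervals differ only by the integrals over the two end pieces of
  length \<open>\<bar>s - s'\<bar>\<close>, where \<open>v\<close> oscillates by at most \<open>M - m\<close>.\<close>

lemma averaging_lipschitz:
  assumes v: "averaging v" and "0 < c" and b: "\<And>y. c \<le> y \<Longrightarrow> m \<le> v y \<and> v y \<le> M"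
    and s: "c + 1 \<le> s" "c + 1 \<le> s'"
  shows "v s \<le> v s' + (M - m) * \<bar>s - s'\<bar>"
proof -
  note vm [measurable] = v[unfolded averaging_def, THEN conjunct1]
  have eq: "v x - m = (LINT y|lborel. indicator {x - 1..x} y * (v y - m))"
    and int: "integrable lborel (\<lambda>y. indicator {x - 1..x} y * (v y - m))" if "1 < x" for x
  proof -
    have i1: "integrable lborel (\<lambda>t. unit_box t * (v (x - t) - m))"
      unfolding right_diff_distrib
      by (intro Bochner_Integration.integrable_diff averaging_integrable[OF v] integrable_mult_left integrable_real_indicator) auto
    have "(LINT t|lborel. unit_box t * (v (x - t) - m)) = v x - m"
      unfolding right_diff_distrib using averaging_integrable[OF v, of x] v that
      by (subst Bochner_Integration.integral_diff) (auto simp: averaging_def)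
    moreover have "(\<lambda>t. unit_box t * (v (x - t) - m)) = (\<lambda>t. indicator {x - 1..x} (x - t) * (v (x - t) - m))"
      by (auto simp: indicator_def fun_eq_iff)
    ultimately show "v x - m = (LINT y|lborel. indicator {x - 1..x} y * (v y - m))"
      using integral_reflect[of "\<lambda>y. indicator {x - 1..x} y * (v y - m)" x] by (simp only:)
    have "integrable lborel (\<lambda>y. unit_box (x + -1 * y) * (v (x - (x + -1 * y)) - m))"
      by (rule lborel_integrable_real_affine[OF i1]) simp
    also have "(\<lambda>y. unit_box (x + -1 * y) * (v (x - (x + -1 * y)) - m)) = (\<lambda>y. indicator {x - 1..x} y * (v y - m))"
      by (auto simp: indicator_def fun_eq_iff)
    finally show "integrable lborel (\<lambda>y. indicator {x - 1..x} y * (v y - m))" .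
  qed
  have "1 < s" "1 < s'" using s \<open>0 < c\<close> by auto
  have "m \<le> M" using b[of c] by simp
  have "v s - m \<le> (LINT y|lborel. indicator {s' - 1..s'} y * (v y - m) + (M - m) * indicator {a'..a' + \<bar>s - s'\<bar>} y)"
    if a': "a' = (if s' \<le> s then s' else s - 1)" for a'
    unfolding eq[OF \<open>1 < s\<close>]
  proof (rule integral_mono[OF int[OF \<open>1 < s\<close>]])
    show "integrable lborel (\<lambda>y. indicator {s' - 1..s'} y * (v y - m) + (M - m) * indicator {a'..a' + \<bar>s - s'\<bar>} y)"
      by (intro Bochner_Integration.integrable_add int[OF \<open>1 < s'\<close>] integrable_mult_right integrable_real_indicator) auto
    fix y
    show "indicator {s - 1..s} y * (v y - m) \<le> indicator {s' - 1..s'} y * (v y - m) + (M - m) * indicator {a'..a' + \<bar>s - s'\<bar>} y"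
    proof (cases "y \<in> {s - 1..s}")
      case True
      then have "c \<le> y" using s by auto
      then show ?thesis using True b[of y] \<open>m \<le> M\<close> unfolding a'
        by (auto simp: indicator_def split: if_splits)
    next
      case False
      show ?thesis
      proof (cases "y \<in> {s' - 1..s'}")
        case True
        then have "c \<le> y" using s by auto
        then show ?thesis using False b[of y] \<open>m \<le> M\<close> by (auto simp: indicator_def)
      qed (use False \<open>m \<le> M\<close> in \<open>auto simp: indicator_def\<close>)
    qed
  qed
  from this[OF refl] have "v s - m \<le> (v s' - m) + (M - m) * \<bar>s - s'\<bar>"
    unfolding eq[OF \<open>1 < s'\<close>]
    by (subst (asm) Bochner_Integration.integral_add[OF int[OF \<open>1 < s'\<close>]])
       (auto intro!: integrable_mult_right integrable_real_indicator)
  then show ?thesis by simp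
qed

text \<open>Each averaging interval of a point of \<open>[c + 2, c + 3]\<close> contains \<open>c + 2\<close>. If \<open>v\<close> is at most the midpoint
  of \<open>[m, M]\<close> there, then by the Lipschitz estimate it stays below \<open>M - (M - m) / 4\<close> on a piece of length
  \<open>1/4\<close> of that interval, which lowers the average by \<open>(M - m) / 16\<close>.\<close>

lemma averaging_drop:
  assumes v: "averaging v" and "0 < c" and b: "\<And>y. c \<le> y \<Longrightarrow> m \<le> v y \<and> v y \<le> M"
    and mid: "v (c + 2) \<le> (m + M) / 2" and s: "c + 2 \<le> s"
  shows "v s \<le> M - (M - m) / 16"
proof (rule averaging_max[OF v _ _ s])
  show "0 \<le> c + 2" using \<open>0 < c\<close> by simp
  have "m \<le> M" using b[of c] by simp
  have near: "v y \<le> M + (m - M) / 4" if "\<bar>y - (c + 2)\<bar> \<le> 1/4" for y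
  proof -
    have "v y \<le> v (c + 2) + (M - m) * \<bar>y - (c + 2)\<bar>"
      by (rule averaging_lipschitz[OF v \<open>0 < c\<close> b]) (use that in linarith)+
    also have "\<dots> \<le> (m + M) / 2 + (M - m) * (1/4)"
      using mid that \<open>m \<le> M\<close> by (intro add_mono mult_left_mono) auto
    finally show ?thesis by (simp add: field_simps)
  qed
  fix s assume s: "c + 2 \<le> s" "s \<le> c + 2 + 1"
  define e where "e = s - (c + 2)"
  (* the times t in [a, a + 1/4], a part of [0,1], lead to points s - t within 1/4 of c + 2 *)
  define a where "a = (if e \<le> 3/4 then e else e - 1/4)"
  have "v s \<le> M + (- (M - m) / 4) * ((a + 1/4) - a)"
  proof (rule averaging_le[OF v])
    fix t :: real assume t: "0 \<le> t" "t \<le> 1"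
    have "c \<le> s - t" using s t by simp
    then show "v (s - t) \<le> M + (if a \<le> t \<and> t \<le> a + 1 / 4 then - (M - m) / 4 else 0)"
      using near[of "s - t"] b[of "s - t"] t s unfolding a_def e_def by (auto split: if_splits)
  qed (use s \<open>0 < c\<close> in \<open>auto simp: a_def e_def\<close>)
  then show "v s \<le> M - (M - m) / 16" by (simp add: field_simps)
qed

text \<open>At \<open>c + 2\<close> the function is either below or above the midpoint of its range, and \<open>averaging_drop\<close>
  lowers the upper bound or, applied to \<open>- v\<close>, raises the lower bound.\<close>

lemma averaging_contract:
  assumes v: "averaging v" and "0 < c" and b: "\<And>y. c \<le> y \<Longrightarrow> m \<le> v y \<and> v y \<le> M"
  shows "\<exists>m' M'. M' - m' = 15/16 * (M - m) \<and> (\<forall>y\<ge>c + 2. m' \<le> v y \<and> v y \<le> M')"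
proof (cases "v (c + 2) \<le> (m + M) / 2")
  case True
  have "\<forall>y\<ge>c + 2. m \<le> v y \<and> v y \<le> M - (M - m) / 16"
    using averaging_drop[OF v \<open>0 < c\<close> b True] b by force
  then show ?thesis by (intro exI[of _ m] exI[of _ "M - (M - m) / 16"]) (simp add: field_simps)
next
  case False
  have "- v y \<le> - m - (- m - - M) / 16" if "c + 2 \<le> y" for y
    by (rule averaging_drop[OF averaging_uminus[OF v] \<open>0 < c\<close> _ _ that]) (use b False in \<open>auto simp: field_simps\<close>)
  then have "\<forall>y\<ge>c + 2. m + (M - m) / 16 \<le> v y \<and> v y \<le> M"
    using b by (force simp: field_simps)
  then show ?thesis by (intro exI[of _ "m + (M - m) / 16"] exI[of _ M]) (simp add: field_simps)
qed

lemma renewal_density_le_3: "renewal_density s \<le> 3"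
proof (cases "0 \<le> s")
  case True
  show ?thesis
  proof (rule averaging_max[OF averaging_renewal_density _ _ True])
    fix s :: real assume s: "0 \<le> s" "s \<le> 0 + 1"
    have "renewal_density s \<le> exp \<bar>s\<bar>" by (rule renewal_density_le)
    also have "\<dots> \<le> exp 1" using s by simp
    also have "\<dots> \<le> 3" by (rule exp_le)
    finally show "renewal_density s \<le> 3" .
  qed simp
qed (simp add: renewal_density_neg)

lemma renewal_density_oscillation:
  assumes "1 + 2 * real n \<le> x" "1 + 2 * real n \<le> y"
  shows "\<bar>renewal_density x - renewal_density y\<bar> \<le> 3 * (15/16) ^ n"
proof -
  have "\<exists>m M. M - m = 3 * (15/16) ^ n \<and> (\<forall>y\<ge>1 + 2 * real n. m \<le> renewal_density y \<and> renewal_density y \<le> M)"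
  proof (induction n)
    case 0
    show ?case by (rule exI[of _ 0], rule exI[of _ 3]) (simp add: renewal_density_nonneg renewal_density_le_3)
  next
    case (Suc n)
    then obtain m M where mM: "M - m = 3 * (15/16) ^ n" "\<And>y. 1 + 2 * real n \<le> y \<Longrightarrow> m \<le> renewal_density y \<and> renewal_density y \<le> M" by blast
    have "0 < 1 + 2 * real n" by simp
    from averaging_contract[OF averaging_renewal_density this mM(2)] obtain m' M'
      where *: "M' - m' = 15/16 * (M - m)" "\<And>y. 1 + 2 * real n + 2 \<le> y \<Longrightarrow> m' \<le> renewal_density y \<and> renewal_density y \<le> M'" by blast
    have eq: "1 + 2 * real (Suc n) = 1 + 2 * real n + 2" by simp
    show ?case
      unfolding eq using * mM(1) by (intro exI[of _ m'] exI[of _ M']) auto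
  qed
  then obtain m M where "M - m = 3 * (15/16) ^ n" "\<And>y. 1 + 2 * real n \<le> y \<Longrightarrow> m \<le> renewal_density y \<and> renewal_density y \<le> M" by blast
  from this(1) this(2)[OF assms(1)] this(2)[OF assms(2)] show ?thesis by linarith
qed

text \<open>Convergence of the density to a limit, in the form needed below and without naming the limit.
  Both points lie beyond \<open>x / 2\<close> if \<open>x \<ge> 0\<close>, and both are negative if \<open>x < 0\<close>.\<close>

lemma renewal_density_decay: "\<exists>D\<ge>0. \<forall>x y. \<bar>x - y\<bar> \<le> \<bar>x\<bar> / 2 \<longrightarrow> \<bar>renewal_density x - renewal_density y\<bar> \<le> D * weight M x"
proof -
  have "(\<lambda>n. (15/16) ^ n * (4 * real n + 7) ^ M) \<longlonglongrightarrow> 0"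
    by real_asymp
  then have "Bseq (\<lambda>n. (15/16) ^ n * (4 * real n + 7) ^ M)" by (intro convergent_imp_Bseq convergentI)
  then obtain B where B: "0 < B" "\<And>n. (15/16) ^ n * (4 * real n + 7) ^ M \<le> B"
    unfolding Bseq_def by (auto simp: abs_le_iff)
  define D where "D = 3 * B + 3 * 3 ^ M"
  have "\<bar>renewal_density x - renewal_density y\<bar> \<le> D * weight M x" if xy: "\<bar>x - y\<bar> \<le> \<bar>x\<bar> / 2" for x y
  proof (cases "x < 0")
    case True
    then have "y < 0" using xy by linarith
    then show ?thesis using True B unfolding D_def by (simp add: renewal_density_neg)
  next
    case False
    show ?thesis
    proof (cases "x < 2")
      case True
      have "(1 + \<bar>x\<bar>) ^ M \<le> 3 ^ M" using True False by (intro power_mono) auto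
      then have "1 \<le> 3 ^ M * weight M x" unfolding weight_def by (simp add: zero_less_power)
      then have "3 \<le> 3 * 3 ^ M * weight M x" by simp
      also have "\<dots> \<le> D * weight M x" unfolding D_def using B by (intro mult_right_mono) auto
      finally have "3 \<le> D * weight M x" .
      then show ?thesis using renewal_density_nonneg[of x] renewal_density_nonneg[of y] renewal_density_le_3[of x] renewal_density_le_3[of y] by linarith
    next
      case False
      define n where "n = nat \<lfloor>(x / 2 - 1) / 2\<rfloor>"
      have n: "real n \<le> (x / 2 - 1) / 2" "(x / 2 - 1) / 2 < real n + 1"
      proof -
        define z where "z = (x / 2 - 1) / 2"
        have "0 \<le> z" unfolding z_def using False by simp
        then have "real n = of_int \<lfloor>z\<rfloor>" unfolding n_def z_def[symmetric] by simp
        then show "real n \<le> (x / 2 - 1) / 2" "(x / 2 - 1) / 2 < real n + 1"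
          unfolding z_def[symmetric] using floor_correct[of z] by simp_all
      qed
      have "x / 2 \<le> y" using xy False by (simp add: abs_if field_simps split: if_splits)
      have "\<bar>renewal_density x - renewal_density y\<bar> \<le> 3 * (15/16) ^ n"
        by (rule renewal_density_oscillation) (use n \<open>x / 2 \<le> y\<close> False in auto)
      also have "(15/16) ^ n \<le> B * weight M x"
      proof -
        have "(15/16) ^ n * (1 + \<bar>x\<bar>) ^ M \<le> (15/16) ^ n * (4 * real n + 7) ^ M"
          using n False by (intro mult_left_mono power_mono) auto
        also have "\<dots> \<le> B" by (rule B)
        finally show ?thesis unfolding weight_def by (simp add: field_simps zero_less_power)
      qed
      finally show ?thesis unfolding D_def
        by (simp add: algebra_simps add_increasing2)
    qed
  qed
  moreover have "0 \<le> D" unfolding D_def using B by simp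
  ultimately show ?thesis by blast
qed

text \<open>With \<open>*\<close> for convolution and \<open>u\<close> for the renewal density, \<open>K = u - V - u * V\<close>. Convolving with the
  indicator function of \<open>[0,1]\<close> turns \<open>u\<close> into \<open>u\<close> minus this indicator function, by the renewal
  equation, and everything else cancels. For the decay, \<open>u - u * V\<close> is the integral of
  \<open>V t * (u s - u (s - t))\<close>: for \<open>\<bar>t\<bar> < \<bar>s\<bar> / 2\<close> the difference is small by \<open>renewal_density_decay\<close>, and the remaining \<open>t\<close> belong
  to the tails of \<open>V\<close>.\<close>

proposition renewal_kernel:
  assumes V: "decays (M + 2) V" and V1: "(LINT t|lborel. V t) = 1"
  shows "\<exists>K. decays M K \<and> (\<forall>s. convolution unit_box K s = K s - unit_box s + V s)"
proof -
  note [measurable] = decays_measurable[OF V]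
  have iV: "integrable lborel V" by (rule decays_integrable[OF V]) simp
  define J where "J = (LINT t|lborel. \<bar>V t\<bar>)"
  have J: "0 \<le> J" unfolding J_def by (rule integral_nonneg_AE) simp
  obtain C where C: "0 \<le> C" "\<And>a. 0 \<le> a \<Longrightarrow> (LINT s|lborel. \<bar>V s\<bar> * indicator {s. a \<le> \<bar>s\<bar>} s) \<le> C * weight M a"
    using tail_integral_bound[OF V] by blast
  obtain D where D: "0 \<le> D" "\<And>x y. \<bar>x - y\<bar> \<le> \<bar>x\<bar> / 2 \<Longrightarrow> \<bar>renewal_density x - renewal_density y\<bar> \<le> D * weight M x"
    using renewal_density_decay by blast
  have abs3: "\<bar>renewal_density x\<bar> \<le> 3" for x using renewal_density_nonneg[of x] renewal_density_le_3[of x] by simp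
  have iVb: "integrable lborel (\<lambda>t. V t * g t)"
    if [measurable]: "g \<in> borel_measurable borel" and "\<And>t. \<bar>g t\<bar> \<le> B" for g :: "real \<Rightarrow> real" and B
  proof (rule Bochner_Integration.integrable_bound)
    show "integrable lborel (\<lambda>t. B * V t)" using iV by simp
    show "AE t in lborel. norm (V t * g t) \<le> norm (B * V t)"
    proof (rule AE_I2)
      fix t
      have "\<bar>g t\<bar> \<le> \<bar>B\<bar>" using that(2)[of t] by simp
      then have "\<bar>V t\<bar> * \<bar>g t\<bar> \<le> \<bar>V t\<bar> * \<bar>B\<bar>" by (rule mult_left_mono) simp
      then show "norm (V t * g t) \<le> norm (B * V t)" by (simp add: abs_mult mult.commute)
    qed
  qed measurable
  define W where "W = convolution V renewal_density"
  have W_meas [measurable]: "W \<in> borel_measurable borel" unfolding W_def by (rule convolution_measurable) measurable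
  have W_bd: "\<bar>W s\<bar> \<le> 3 * J" for s
  proof -
    have "\<bar>W s\<bar> \<le> (LINT t|lborel. \<bar>V t * renewal_density (s - t)\<bar>)" unfolding W_def convolution_def by (rule integral_abs_bound)
    also have "\<dots> \<le> (LINT t|lborel. 3 * \<bar>V t\<bar>)"
    proof (rule Bochner_Integration.integral_mono_AE')
      show "AE t in lborel. \<bar>V t * renewal_density (s - t)\<bar> \<le> 3 * \<bar>V t\<bar>"
        using mult_right_mono[OF abs3 abs_ge_zero] by (intro AE_I2) (simp add: abs_mult mult.commute)
    qed (use iV in auto)
    finally show ?thesis unfolding J_def by simp
  qed
  (* the density of (delta_0 - V) * (delta_0 + u), without the point mass at 0 *)
  define K where "K = (\<lambda>s. renewal_density s - V s - W s)"
  have K_meas: "K \<in> borel_measurable borel" unfolding K_def by measurable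
  have diff: "renewal_density s - W s = (LINT t|lborel. V t * (renewal_density s - renewal_density (s - t)))" for s
  proof -
    have "(LINT t|lborel. V t * (renewal_density s - renewal_density (s - t))) = (LINT t|lborel. V t * renewal_density s - V t * renewal_density (s - t))"
      by (simp add: right_diff_distrib)
    also have "\<dots> = (LINT t|lborel. V t * renewal_density s) - W s"
      unfolding W_def convolution_def
      by (rule Bochner_Integration.integral_diff) (rule iVb[of _ 3]; use abs3 in auto)+
    finally show ?thesis using V1 by simp
  qed
  have weight_half: "weight M (\<bar>s\<bar> / 2) \<le> 2 ^ M * weight M s" for s
  proof -
    have "(1 + \<bar>s\<bar>) ^ M \<le> (2 * (1 + \<bar>s\<bar> / 2)) ^ M" by (intro power_mono) auto
    then have "(1 + \<bar>s\<bar>) ^ M \<le> 2 ^ M * (1 + \<bar>s\<bar> / 2) ^ M" by (simp only: power_mult_distrib)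
    moreover have "0 < (1 + \<bar>s\<bar>) ^ M" "0 < (1 + \<bar>s\<bar> / 2) ^ M" by (auto intro!: zero_less_power add_pos_nonneg)
    ultimately show ?thesis unfolding weight_def by (simp add: field_simps)
  qed
  have bound: "\<bar>renewal_density s - W s\<bar> \<le> (D * J + 3 * C * 2 ^ M) * weight M s" for s
  proof -
    let ?t = "\<lambda>t. \<bar>V t\<bar> * indicator {t. \<bar>s\<bar> / 2 \<le> \<bar>t\<bar>} t"
    have it: "integrable lborel ?t"
      by (rule Bochner_Integration.integrable_bound[OF iV]) (auto simp: indicator_def)
    have pt: "\<bar>V t * (renewal_density s - renewal_density (s - t))\<bar> \<le> D * weight M s * \<bar>V t\<bar> + 3 * ?t t" for t
    proof (cases "\<bar>s\<bar> / 2 \<le> \<bar>t\<bar>")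
      case True
      have "\<bar>renewal_density s - renewal_density (s - t)\<bar> \<le> 3"
        using renewal_density_nonneg[of s] renewal_density_nonneg[of "s - t"] renewal_density_le_3[of s] renewal_density_le_3[of "s - t"] by linarith
      then have "\<bar>V t\<bar> * \<bar>renewal_density s - renewal_density (s - t)\<bar> \<le> \<bar>V t\<bar> * 3" by (rule mult_left_mono) simp
      moreover have "0 \<le> D * weight M s * \<bar>V t\<bar>" using D by simp
      ultimately show ?thesis using True by (simp add: abs_mult)
    next
      case False
      then have "\<bar>renewal_density s - renewal_density (s - t)\<bar> \<le> D * weight M s" by (intro D) auto
      then have "\<bar>V t\<bar> * \<bar>renewal_density s - renewal_density (s - t)\<bar> \<le> \<bar>V t\<bar> * (D * weight M s)" by (rule mult_left_mono) simp
      then show ?thesis using False by (simp add: abs_mult mult_ac)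
    qed
    have i1: "integrable lborel (\<lambda>t. D * weight M s * \<bar>V t\<bar>)" and i2: "integrable lborel (\<lambda>t. 3 * ?t t)"
      using iV it by auto
    have "\<bar>renewal_density s - W s\<bar> \<le> (LINT t|lborel. \<bar>V t * (renewal_density s - renewal_density (s - t))\<bar>)"
      unfolding diff by (rule integral_abs_bound)
    also have "\<dots> \<le> (LINT t|lborel. D * weight M s * \<bar>V t\<bar> + 3 * ?t t)"
      by (rule Bochner_Integration.integral_mono_AE'[OF Bochner_Integration.integrable_add[OF i1 i2]])
         (use pt D in \<open>auto intro: order_trans[OF abs_ge_zero]\<close>)
    also have "\<dots> = D * weight M s * J + 3 * (LINT t|lborel. ?t t)"
      unfolding Bochner_Integration.integral_add[OF i1 i2] J_def by simp
    also have "\<dots> \<le> D * weight M s * J + 3 * (C * (2 ^ M * weight M s))"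
      using C(2)[of "\<bar>s\<bar> / 2"] mult_left_mono[OF weight_half C(1), of s] by simp
    finally show ?thesis by (simp add: algebra_simps)
  qed
  have "decays M (\<lambda>s. renewal_density s - W s)" unfolding decays_def using bound by (auto intro!: exI)
  then have K_kern: "decays M K"
  proof -
    obtain c where c: "0 \<le> c" "\<And>t. \<bar>V t\<bar> \<le> c * weight M t" using decays_bound[OF decays_mono[OF V]] by (meson le_add1)
    have "\<bar>K s\<bar> \<le> (D * J + 3 * C * 2 ^ M + c) * weight M s" for s
      using bound[of s] c(2)[of s] unfolding K_def by (simp add: distrib_right)
    then show ?thesis unfolding decays_def using K_meas by blast
  qed
  have "convolution unit_box K s = K s - unit_box s + V s" for s
  proof -
    have iu: "integrable lborel (\<lambda>t. unit_box t * renewal_density (s - t))" by (rule averaging_integrable[OF averaging_renewal_density])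
    have iv: "integrable lborel (\<lambda>t. unit_box t * V (s - t))"
    proof (rule Bochner_Integration.integrable_bound)
      show "integrable lborel (\<lambda>t. V (s - t))"
        using lborel_integrable_real_affine[OF iV, of "-1" s] by simp
    qed (auto simp: indicator_def)
    have iw: "integrable lborel (\<lambda>t. unit_box t * W (s - t))" by (rule box_integrable[OF W_meas W_bd])
    have "convolution unit_box K s = (LINT t|lborel. unit_box t * renewal_density (s - t) - unit_box t * V (s - t) - unit_box t * W (s - t))"
      unfolding convolution_def K_def by (simp add: right_diff_distrib)
    also have "\<dots> = convolution unit_box renewal_density s - convolution unit_box V s - convolution unit_box W s"
      unfolding convolution_def using iu iv iw by simp
    also have "convolution unit_box W s = convolution V (convolution unit_box renewal_density) s"
    proof -
      have F: "integrable (lborel \<Otimes>\<^sub>M lborel) (\<lambda>(t, r). unit_box t * (V r * renewal_density (s - t - r)))"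
      proof (rule lborel_pair.Fubini_integrable)
        show "(\<lambda>(t, r). unit_box t * (V r * renewal_density (s - t - r))) \<in> borel_measurable (lborel \<Otimes>\<^sub>M lborel)" by measurable
        have ir: "integrable lborel (\<lambda>r. unit_box t * (V r * renewal_density (s - t - r)))" for t
          by (intro integrable_mult_right iVb[of _ 3]) (use abs3 in auto)
        then show "AE t in lborel. integrable lborel (\<lambda>r. case (t, r) of (t, r) \<Rightarrow> unit_box t * (V r * renewal_density (s - t - r)))"
          by simp
        show "integrable lborel (\<lambda>t. LINT r|lborel. norm (case (t, r) of (t, r) \<Rightarrow> unit_box t * (V r * renewal_density (s - t - r))))"
        proof (rule Bochner_Integration.integrable_bound)
          show "integrable lborel (\<lambda>t. 3 * J * unit_box t)"
            by (intro integrable_mult_right integrable_real_indicator) auto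
          show "AE t in lborel. norm (LINT r|lborel. norm (case (t, r) of (t, r) \<Rightarrow> unit_box t * (V r * renewal_density (s - t - r))))
              \<le> norm (3 * J * unit_box t)"
          proof (rule AE_I2)
            fix t
            have "(LINT r|lborel. \<bar>unit_box t * (V r * renewal_density (s - t - r))\<bar>) \<le> (LINT r|lborel. unit_box t * (3 * \<bar>V r\<bar>))"
            proof (rule Bochner_Integration.integral_mono_AE')
              have "\<bar>V r\<bar> * \<bar>renewal_density (s - t - r)\<bar> \<le> \<bar>V r\<bar> * 3" for r by (intro mult_left_mono abs3) simp
              then show "AE r in lborel. \<bar>unit_box t * (V r * renewal_density (s - t - r))\<bar> \<le> unit_box t * (3 * \<bar>V r\<bar>)"
                by (auto simp: abs_mult indicator_def mult.commute)
            qed (use iV in auto)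
            also have "\<dots> = 3 * J * unit_box t" unfolding J_def by simp
            finally have "(LINT r|lborel. \<bar>unit_box t * (V r * renewal_density (s - t - r))\<bar>) \<le> 3 * J * unit_box t" .
            moreover have "0 \<le> (LINT r|lborel. \<bar>unit_box t * (V r * renewal_density (s - t - r))\<bar>)"
              by (rule integral_nonneg_AE) simp
            ultimately show "norm (LINT r|lborel. norm (case (t, r) of (t, r) \<Rightarrow> unit_box t * (V r * renewal_density (s - t - r))))
              \<le> norm (3 * J * unit_box t)" using J by simp
          qed
        qed measurable
      qed
      have "convolution unit_box W s = (LINT t|lborel. LINT r|lborel. unit_box t * (V r * renewal_density (s - t - r)))"
        unfolding W_def convolution_def by simp
      also have "\<dots> = (LINT r|lborel. LINT t|lborel. unit_box t * (V r * renewal_density (s - t - r)))"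
        by (rule lborel_pair.Fubini_integral[symmetric]) (use F in simp)
      also have "\<dots> = (LINT r|lborel. V r * (LINT t|lborel. unit_box t * renewal_density (s - r - t)))"
      proof (rule Bochner_Integration.integral_cong[OF refl])
        fix r
        have "(LINT t|lborel. unit_box t * (V r * renewal_density (s - t - r))) = (LINT t|lborel. V r * (unit_box t * renewal_density (s - r - t)))"
          by (simp add: algebra_simps)
        then show "(LINT t|lborel. unit_box t * (V r * renewal_density (s - t - r))) = V r * (LINT t|lborel. unit_box t * renewal_density (s - r - t))"
          by simp
      qed
      finally show ?thesis unfolding convolution_def .
    qed
    also have "convolution V (convolution unit_box renewal_density) s = W s - convolution V unit_box s"
    proof -
      have "convolution unit_box renewal_density x = renewal_density x - unit_box x" for x using renewal_density_renewal[of x] by simp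
      then have "convolution V (convolution unit_box renewal_density) s = (LINT t|lborel. V t * renewal_density (s - t) - V t * unit_box (s - t))"
        unfolding convolution_def[of V] by (simp add: right_diff_distrib)
      also have "\<dots> = W s - convolution V unit_box s"
        unfolding W_def convolution_def
        by (rule Bochner_Integration.integral_diff) (rule iVb[of _ 3]; use abs3 in \<open>auto simp: indicator_def\<close>)+
      finally show ?thesis .
    qed
    also have "convolution V unit_box s = convolution unit_box V s" by (rule convolution_commute)
    also have "convolution unit_box renewal_density s = renewal_density s - unit_box s" using renewal_density_renewal[of s] by simp
    finally show ?thesis unfolding K_def by simp
  qed
  with K_kern show ?thesis by blast
qed

section \<open>Entire extensions\<close>

text \<open>Difference quotients converge pointwise, and by Cauchy's inequality on discs of radius one they
  are dominated by the same \<open>H R\<close>, so dominated convergence applies.\<close>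

lemma holomorphic_parameter_integral:
  fixes F :: "complex \<Rightarrow> real \<Rightarrow> complex"
  assumes hol: "\<And>y. (\<lambda>z. F z y) holomorphic_on UNIV"
    and [measurable]: "\<And>z. F z \<in> borel_measurable lborel"
    and int: "\<And>R. integrable lborel (H R)"
    and bound: "\<And>R z y. cmod z \<le> R \<Longrightarrow> cmod (F z y) \<le> H R y"
  shows "(\<lambda>z. LINT y|lborel. F z y) holomorphic_on UNIV"
proof -
  have "(\<lambda>z. LINT y|lborel. F z y) field_differentiable at z0" for z0
  proof -
    define R where "R = cmod z0 + 2"
    define F' where "F' = (\<lambda>y. deriv (\<lambda>z. F z y) z0)"
    have der: "((\<lambda>z. F z y) has_field_derivative deriv (\<lambda>z. F z y) z) (at z)" for y z
      using hol[of y] holomorphic_derivI[of _ UNIV] by auto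
    have dq: "cmod ((F (z0 + h) y - F z0 y) / h) \<le> H R y" if h: "h \<noteq> 0" "cmod h < 1" for h y
    proof -
      have dbound: "cmod (deriv (\<lambda>z. F z y) z) \<le> H R y" if "z \<in> cball z0 1" for z
      proof -
        have "cmod ((deriv ^^ 1) (\<lambda>z. F z y) z) \<le> fact 1 * H R y / 1 ^ 1"
        proof (rule Cauchy_inequality)
          show "(\<lambda>z. F z y) holomorphic_on ball z 1" using hol holomorphic_on_subset by blast
          show "continuous_on (cball z 1) (\<lambda>z. F z y)"
            using hol holomorphic_on_imp_continuous_on holomorphic_on_subset by blast
          fix x assume "cmod (z - x) = 1"
          have "dist z0 z \<le> 1" using that by simp
          have "cmod x = cmod (z0 + (z - z0) + (x - z))" by simp
          also have "\<dots> \<le> cmod z0 + cmod (z - z0) + cmod (x - z)"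
            by (meson norm_triangle_le norm_triangle_ineq add_right_mono order_trans)
          also have "\<dots> \<le> R" unfolding R_def using \<open>cmod (z - x) = 1\<close> \<open>dist z0 z \<le> 1\<close>
            by (simp add: dist_norm norm_minus_commute)
          finally show "cmod (F x y) \<le> H R y" by (rule bound)
        qed simp
        then show ?thesis by simp
      qed
      have "cmod (F (z0 + h) y - F z0 y) \<le> H R y * cmod (z0 + h - z0)"
      proof (rule field_differentiable_bound[of "cball z0 1" "\<lambda>z. F z y" "\<lambda>z. deriv (\<lambda>z. F z y) z"])
        show "((\<lambda>z. F z y) has_field_derivative deriv (\<lambda>z. F z y) z) (at z within cball z0 1)" for z
          using der by (rule has_field_derivative_at_within)
      qed (use dbound h in \<open>auto simp: dist_norm\<close>)
      then show ?thesis using h by (simp add: norm_divide field_simps)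
    qed
    have lim: "(\<lambda>n. (F (z0 + h n) y - F z0 y) / h n) \<longlonglongrightarrow> F' y"
      if h: "h \<longlonglongrightarrow> 0" "\<And>n. h n \<noteq> 0" for h :: "nat \<Rightarrow> complex" and y
    proof -
      have "((\<lambda>k. (F (z0 + k) y - F z0 y) / k) \<longlongrightarrow> F' y) (at 0)"
        using der[of y z0] unfolding DERIV_def F'_def .
      then show ?thesis using h by (simp add: tendsto_at_iff_sequentially o_def)
    qed
    have F'_meas [measurable]: "F' \<in> borel_measurable lborel"
    proof (rule borel_measurable_LIMSEQ_metric)
      have "(\<lambda>n. 1 / of_nat (Suc n) :: complex) \<longlonglongrightarrow> 0"
        by (rule lim_1_over_n[THEN LIMSEQ_Suc])
      then show "(\<lambda>n. (F (z0 + 1 / of_nat (Suc n)) y - F z0 y) / (1 / of_nat (Suc n))) \<longlonglongrightarrow> F' y" for y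
        by (rule lim) (simp del: of_nat_Suc)
    qed measurable
    have Fint: "integrable lborel (F z)" for z
      by (rule Bochner_Integration.integrable_bound[OF int[of "cmod z"]])
         (auto intro!: AE_I2 order_trans[OF bound[OF order_refl]])
    have "((\<lambda>h. ((LINT y|lborel. F (z0 + h) y) - (LINT y|lborel. F z0 y)) / h) \<longlongrightarrow> (LINT y|lborel. F' y)) (at 0)"
      unfolding tendsto_at_iff_sequentially o_def
    proof (intro allI impI)
      fix h :: "nat \<Rightarrow> complex" assume h: "\<forall>i. h i \<in> UNIV - {0}" "h \<longlonglongrightarrow> 0"
      obtain n0 where n0: "\<And>n. n \<ge> n0 \<Longrightarrow> cmod (h n) < 1"
        using h(2) by (metis LIMSEQ_D zero_less_one diff_zero)
      have "(\<lambda>n. LINT y|lborel. (F (z0 + h (n + n0)) y - F z0 y) / h (n + n0)) \<longlonglongrightarrow> (LINT y|lborel. F' y)"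
      proof (rule integral_dominated_convergence)
        show "integrable lborel (H R)" by (rule int)
        show "AE y in lborel. (\<lambda>n. (F (z0 + h (n + n0)) y - F z0 y) / h (n + n0)) \<longlonglongrightarrow> F' y"
          using h by (intro AE_I2 lim LIMSEQ_ignore_initial_segment) auto
        show "AE y in lborel. norm ((F (z0 + h (n + n0)) y - F z0 y) / h (n + n0)) \<le> H R y" for n
          using h n0 by (intro AE_I2 dq) auto
      qed measurable
      then have "(\<lambda>n. LINT y|lborel. (F (z0 + h n) y - F z0 y) / h n) \<longlonglongrightarrow> (LINT y|lborel. F' y)"
        by (rule LIMSEQ_offset)
      moreover have "(\<lambda>n. LINT y|lborel. (F (z0 + h n) y - F z0 y) / h n)
          = (\<lambda>n. ((LINT y|lborel. F (z0 + h n) y) - (LINT y|lborel. F z0 y)) / h n)"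
        by (intro ext) (simp add: Fint)
      ultimately show "(\<lambda>n. ((LINT y|lborel. F (z0 + h n) y) - (LINT y|lborel. F z0 y)) / h n) \<longlonglongrightarrow> (LINT y|lborel. F' y)"
        by (simp only:)
    qed
    then show ?thesis unfolding field_differentiable_def DERIV_def by blast
  qed
  then show ?thesis by (simp add: holomorphic_on_def)
qed

text \<open>After the substitution \<open>y = x + t / \<sigma>\<close> the variable \<open>x\<close> only occurs in the kernel and can be made
  complex. The integral grows like \<open>exp (\<sigma> * \<bar>z\<bar>)\<close> times a polynomial, which every \<open>\<epsilon>\<close> absorbs.\<close>

proposition dconv_entire:
  assumes f: "f \<in> wL1 N" and "0 < \<sigma>" and Vhol: "Vc holomorphic_on UNIV"
    and VV: "\<And>t. Vc (of_real t) = of_real (V t)" and "0 \<le> C"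
    and Vb: "\<And>z. cmod (Vc z) \<le> C * exp \<bar>Im z\<bar> * weight N (Re z)"
  shows "\<exists>g. g holomorphic_on UNIV \<and> exp_type_le \<sigma> g \<and> (\<forall>x. g (of_real x) = dconv (1 / \<sigma>) V f x)"
proof -
  note [measurable] = wL1_measurable[OF f]
  define F where "F = (\<lambda>z y. of_real \<sigma> * Vc (of_real \<sigma> * (of_real y - z)) * f y)"
  define A where "A = \<sigma> * C * (1 + 1 / \<sigma>) ^ N"
  have A: "0 \<le> A" unfolding A_def using assms by simp
  have wtb: "weight N (\<sigma> * (y - x)) \<le> ((1 + 1 / \<sigma>) * (1 + \<bar>x\<bar>)) ^ N * weight N y" for x y
  proof -
    have "weight N (\<sigma> * (y - x)) \<le> (1 + 1 / \<sigma>) ^ N * weight N ((1 / \<sigma>) * (\<sigma> * (y - x)))"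
      by (rule weight_scale) (use \<open>0 < \<sigma>\<close> in simp)
    also have "(1 / \<sigma>) * (\<sigma> * (y - x)) = y - x" using \<open>0 < \<sigma>\<close> by simp
    also have "weight N (y - x) \<le> (1 + \<bar>y - (y - x)\<bar>) ^ N * weight N y" by (rule weight_shift)
    finally show ?thesis using \<open>0 < \<sigma>\<close> by (simp add: power_mult_distrib mult.assoc mult_left_mono)
  qed
  have Fb: "cmod (F z y) \<le> A * exp (\<sigma> * cmod z) * (1 + cmod z) ^ N * (weight N y * cmod (f y))" for z y
  proof -
    have im: "\<bar>Im (of_real \<sigma> * (of_real y - z))\<bar> \<le> \<sigma> * cmod z"
      using \<open>0 < \<sigma>\<close> abs_Im_le_cmod[of z] by (simp add: abs_mult)
    have re: "Re (of_real \<sigma> * (of_real y - z)) = \<sigma> * (y - Re z)" by simp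
    have "cmod (F z y) = \<sigma> * cmod (Vc (of_real \<sigma> * (of_real y - z))) * cmod (f y)"
      unfolding F_def using \<open>0 < \<sigma>\<close> by (simp add: norm_mult)
    also have "\<dots> \<le> \<sigma> * (C * exp (\<sigma> * cmod z) * (((1 + 1 / \<sigma>) * (1 + cmod z)) ^ N * weight N y)) * cmod (f y)"
    proof (intro mult_right_mono mult_left_mono)
      have "cmod (Vc (of_real \<sigma> * (of_real y - z))) \<le> C * exp \<bar>Im (of_real \<sigma> * (of_real y - z))\<bar> * weight N (\<sigma> * (y - Re z))"
        using Vb[of "of_real \<sigma> * (of_real y - z)"] unfolding re .
      also have "\<dots> \<le> C * exp (\<sigma> * cmod z) * (((1 + 1 / \<sigma>) * (1 + cmod z)) ^ N * weight N y)"
      proof (intro mult_mono)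
        show "weight N (\<sigma> * (y - Re z)) \<le> ((1 + 1 / \<sigma>) * (1 + cmod z)) ^ N * weight N y"
        proof (rule order_trans[OF wtb])
          show "((1 + 1 / \<sigma>) * (1 + \<bar>Re z\<bar>)) ^ N * weight N y \<le> ((1 + 1 / \<sigma>) * (1 + cmod z)) ^ N * weight N y"
            using abs_Re_le_cmod[of z] \<open>0 < \<sigma>\<close> by (intro mult_right_mono power_mono mult_left_mono) auto
        qed
      qed (use im \<open>0 \<le> C\<close> in auto)
      finally show "cmod (Vc (of_real \<sigma> * (of_real y - z))) \<le> C * exp (\<sigma> * cmod z) * (((1 + 1 / \<sigma>) * (1 + cmod z)) ^ N * weight N y)" .
    qed (use \<open>0 < \<sigma>\<close> in auto)
    also have "\<dots> = A * exp (\<sigma> * cmod z) * (1 + cmod z) ^ N * (weight N y * cmod (f y))"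
      unfolding A_def by (simp add: power_mult_distrib mult_ac)
    finally show ?thesis .
  qed
  have fint: "integrable lborel (\<lambda>y. weight N y * cmod (f y))" using f by (simp add: wL1_def)
  define J where "J = (LINT y|lborel. weight N y * cmod (f y))"
  have J: "0 \<le> J" unfolding J_def by (rule integral_nonneg_AE) simp
  have Vc_meas [measurable]: "Vc \<in> borel_measurable borel"
    by (intro borel_measurable_continuous_onI holomorphic_on_imp_continuous_on Vhol)
  define g where "g = (\<lambda>z. LINT y|lborel. F z y)"
  have "g holomorphic_on UNIV"
    unfolding g_def
  proof (rule holomorphic_parameter_integral)
    show "(\<lambda>z. F z y) holomorphic_on UNIV" for y
      unfolding F_def
      by (intro holomorphic_intros holomorphic_on_compose_gen[OF _ Vhol, unfolded o_def]) auto
    show "F z \<in> borel_measurable lborel" for z unfolding F_def by measurable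
    show "integrable lborel (\<lambda>y. A * exp (\<sigma> * R) * (1 + R) ^ N * (weight N y * cmod (f y)))" for R
      using fint by simp
    fix R z y assume "cmod z \<le> R"
    moreover from this have "0 \<le> R" using norm_ge_zero[of z] by linarith
    ultimately have "A * exp (\<sigma> * cmod z) * (1 + cmod z) ^ N * (weight N y * cmod (f y))
        \<le> A * exp (\<sigma> * R) * (1 + R) ^ N * (weight N y * cmod (f y))"
      using A \<open>0 < \<sigma>\<close> by (intro mult_mono power_mono) (auto intro: order_trans[OF norm_ge_zero])
    then show "cmod (F z y) \<le> A * exp (\<sigma> * R) * (1 + R) ^ N * (weight N y * cmod (f y))"
      using Fb[of z y] by linarith
  qed
  moreover have "exp_type_le \<sigma> g"
    unfolding exp_type_le_def
  proof (intro allI impI)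
    fix \<epsilon> :: real assume "0 < \<epsilon>"
    have gb: "cmod (g z) \<le> A * exp (\<sigma> * cmod z) * (1 + cmod z) ^ N * J" for z
    proof -
      have "cmod (g z) \<le> (LINT y|lborel. cmod (F z y))" unfolding g_def by (rule integral_norm_bound)
      also have "\<dots> \<le> (LINT y|lborel. A * exp (\<sigma> * cmod z) * (1 + cmod z) ^ N * (weight N y * cmod (f y)))"
        by (rule Bochner_Integration.integral_mono_AE') (use fint Fb A in auto)
      also have "\<dots> = A * exp (\<sigma> * cmod z) * (1 + cmod z) ^ N * J" unfolding J_def by simp
      finally show ?thesis .
    qed
    have "((\<lambda>r. (1 + r) ^ N * exp (- (\<epsilon> * r))) \<longlongrightarrow> 0) at_top"
      using \<open>0 < \<epsilon>\<close> by real_asymp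
    then have "eventually (\<lambda>r. (1 + r) ^ N * exp (- (\<epsilon> * r)) < 1) at_top"
      by (rule order_tendstoD) simp
    then obtain r0 where r0: "\<And>r. r0 \<le> r \<Longrightarrow> (1 + r) ^ N * exp (- (\<epsilon> * r)) < 1"
      by (auto simp: eventually_at_top_linorder)
    define B where "B = 1 + (1 + \<bar>r0\<bar>) ^ N"
    have pb: "(1 + r) ^ N \<le> B * exp (\<epsilon> * r)" if "0 \<le> r" for r
    proof (cases "r0 \<le> r")
      case True
      have "(1 + r) ^ N \<le> 1 * exp (\<epsilon> * r)"
        using r0[OF True] by (simp add: exp_minus field_simps)
      also have "\<dots> \<le> B * exp (\<epsilon> * r)" unfolding B_def by (intro mult_right_mono) auto
      finally show ?thesis .
    next
      case False
      have "(1 + r) ^ N \<le> (1 + \<bar>r0\<bar>) ^ N" using False that by (intro power_mono) auto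
      also have "\<dots> \<le> B * 1" unfolding B_def by simp
      also have "\<dots> \<le> B * exp (\<epsilon> * r)"
        unfolding B_def using that \<open>0 < \<epsilon>\<close> by (intro mult_left_mono) (auto intro: add_nonneg_nonneg)
      finally show ?thesis .
    qed
    have "cmod (g z) \<le> (A * B * J) * exp ((\<sigma> + \<epsilon>) * cmod z)" for z
    proof -
      have "A * exp (\<sigma> * cmod z) * (1 + cmod z) ^ N * J \<le> A * exp (\<sigma> * cmod z) * (B * exp (\<epsilon> * cmod z)) * J"
        using A J pb[of "cmod z"] by (intro mult_right_mono mult_left_mono) auto
      also have "\<dots> = (A * B * J) * exp ((\<sigma> + \<epsilon>) * cmod z)"
      proof -
        have "exp ((\<sigma> + \<epsilon>) * cmod z) = exp (\<sigma> * cmod z) * exp (\<epsilon> * cmod z)"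
          by (simp add: distrib_right exp_add)
        then show ?thesis by (simp only: mult_ac)
      qed
      finally show ?thesis using gb[of z] by linarith
    qed
    then show "\<exists>A. \<forall>z. cmod (g z) \<le> A * exp ((\<sigma> + \<epsilon>) * cmod z)" by blast
  qed
  moreover have "g (of_real x) = dconv (1 / \<sigma>) V f x" for x
  proof -
    have "g (of_real x) = (LINT y|lborel. of_real \<sigma> * (of_real (V (\<sigma> * (y - x))) * f y))"
      unfolding g_def F_def VV[symmetric] by (simp add: mult.assoc)
    also have "\<dots> = of_real \<sigma> * (LINT y|lborel. of_real (V (\<sigma> * (y - x))) * f y)"
      by (rule integral_mult_right_zero)
    also have "(LINT y|lborel. of_real (V (\<sigma> * (y - x))) * f y)
        = (1 / \<sigma>) *\<^sub>R (LINT t|lborel. of_real (V t) * f (x + (1 / \<sigma>) * t))"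
      by (subst lborel_integral_real_affine[where c = "1 / \<sigma>" and t = x]) (use \<open>0 < \<sigma>\<close> in auto)
    finally show ?thesis using \<open>0 < \<sigma>\<close> unfolding dconv_def by (simp add: scaleR_conv_of_real)
  qed
  ultimately show ?thesis by blast
qed

section \<open>Absolutely continuous functions are indefinite integrals\<close>

text \<open>The condition of \<^const>\<open>abs_cont_on\<close> for the whole line with one \<open>\<delta>\<close>. On compact intervals it is
  enforced below by making the function constant outside of the interval.\<close>

definition line_AC :: "(real \<Rightarrow> real) \<Rightarrow> bool" where
  "line_AC F \<longleftrightarrow> (\<forall>\<epsilon>>0. \<exists>\<delta>>0. \<forall>(n::nat) u v. (\<forall>i<n. u i \<le> v i) \<longrightarrow>
     disjoint_family_on (\<lambda>i. {u i <..< v i}) {..<n} \<longrightarrow>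
     (\<Sum>i<n. v i - u i) < \<delta> \<longrightarrow> (\<Sum>i<n. \<bar>F (v i) - F (u i)\<bar>) < \<epsilon>)"

text \<open>Families indexed by an arbitrary finite set spare the renumbering when families of families or
  divisions of an interval occur.\<close>

lemma line_AC_finite_family:
  assumes "line_AC F" "0 < \<epsilon>"
  shows "\<exists>\<delta>>0. \<forall>(A :: 'i set) u v. finite A \<longrightarrow> (\<forall>i\<in>A. u i \<le> v i) \<longrightarrow>
     disjoint_family_on (\<lambda>i. {u i <..< v i}) A \<longrightarrow>
     (\<Sum>i\<in>A. v i - u i) < \<delta> \<longrightarrow> (\<Sum>i\<in>A. \<bar>F (v i) - F (u i)\<bar>) < \<epsilon>"
proof -
  from assms obtain \<delta> where \<delta>: "0 < \<delta>" and H: "\<And>n u v. (\<forall>i<n. u i \<le> v i) \<Longrightarrow>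
     disjoint_family_on (\<lambda>i. {u i <..< v i}) {..<n::nat} \<Longrightarrow>
     (\<Sum>i<n. v i - u i) < \<delta> \<Longrightarrow> (\<Sum>i<n. \<bar>F (v i) - F (u i)\<bar>) < \<epsilon>"
    unfolding line_AC_def by meson
  have "(\<Sum>i\<in>A. \<bar>F (v i) - F (u i)\<bar>) < \<epsilon>"
    if A: "finite A" "\<forall>i\<in>A. u i \<le> v i" "disjoint_family_on (\<lambda>i. {u i <..< v i}) A" "(\<Sum>i\<in>A. v i - u i) < \<delta>"
    for A :: "'i set" and u v
  proof -
    obtain h where h: "bij_betw h {..<card A} A"
      using ex_bij_betw_nat_finite[OF A(1)] by (auto simp: atLeast0LessThan)
    have hA: "h i \<in> A" if "i < card A" for i using h that by (auto simp: bij_betw_def)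
    have "(\<Sum>i<card A. \<bar>F (v (h i)) - F (u (h i))\<bar>) < \<epsilon>"
    proof (rule H)
      show "\<forall>i<card A. u (h i) \<le> v (h i)" using A(2) hA by blast
      show "disjoint_family_on (\<lambda>i. {u (h i)<..<v (h i)}) {..<card A}"
        unfolding disjoint_family_on_def
      proof (intro ballI impI)
        fix i j assume ij: "i \<in> {..<card A}" "j \<in> {..<card A}" "i \<noteq> j"
        then have "h i \<noteq> h j" using h by (auto simp: bij_betw_def inj_on_def)
        then show "{u (h i)<..<v (h i)} \<inter> {u (h j)<..<v (h j)} = {}"
          using A(3) hA ij unfolding disjoint_family_on_def by blast
      qed
      show "(\<Sum>i<card A. v (h i) - u (h i)) < \<delta>"
        using A(4) sum.reindex_bij_betw[OF h, of "\<lambda>i. v i - u i"] by simp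
    qed
    then show ?thesis using sum.reindex_bij_betw[OF h, of "\<lambda>i. \<bar>F (v i) - F (u i)\<bar>"] by simp
  qed
  then show ?thesis using \<delta> by blast
qed

lemma disjoint_family_on_shrink:
  assumes "disjoint_family_on B A" "\<And>i. i \<in> A \<Longrightarrow> C i \<subseteq> B i"
  shows "disjoint_family_on C A"
  unfolding disjoint_family_on_def
proof (intro ballI impI)
  fix i j assume ij: "i \<in> A" "j \<in> A" "i \<noteq> j"
  then have "B i \<inter> B j = {}" using assms(1) unfolding disjoint_family_on_def by blast
  then show "C i \<inter> C j = {}" using assms(2)[OF ij(1)] assms(2)[OF ij(2)] by blast
qed

lemma disjoint_length_measure:
  fixes u v :: "'i \<Rightarrow> real"
  assumes "finite A" "\<forall>i\<in>A. u i \<le> v i" "disjoint_family_on (\<lambda>i. {u i <..< v i}) A"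
  shows "ennreal (\<Sum>i\<in>A. v i - u i) = emeasure lborel (\<Union>i\<in>A. {u i <..< v i})"
proof -
  have "emeasure lborel (\<Union>i\<in>A. {u i <..< v i}) = (\<Sum>i\<in>A. emeasure lborel {u i <..< v i})"
    by (rule sum_emeasure[symmetric]) (use assms in auto)
  also have "\<dots> = (\<Sum>i\<in>A. ennreal (v i - u i))"
    using assms by (intro sum.cong) auto
  also have "\<dots> = ennreal (\<Sum>i\<in>A. v i - u i)"
    using assms by (intro sum_ennreal) auto
  finally show ?thesis by simp
qed

lemma disjoint_length_le:
  fixes u v :: "'i \<Rightarrow> real"
  assumes "finite A" "\<forall>i\<in>A. u i \<le> v i" "disjoint_family_on (\<lambda>i. {u i <..< v i}) A"
    and "\<forall>i\<in>A. c \<le> u i \<and> v i \<le> d" "c \<le> d"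
  shows "(\<Sum>i\<in>A. v i - u i) \<le> d - c"
proof -
  have "ennreal (\<Sum>i\<in>A. v i - u i) \<le> emeasure lborel {c..d}"
    unfolding disjoint_length_measure[OF assms(1-3)] using assms(4) by (intro emeasure_mono) force+
  also have "\<dots> = ennreal (d - c)" using \<open>c \<le> d\<close> by simp
  finally show ?thesis using \<open>c \<le> d\<close> by (subst (asm) ennreal_le_iff) auto
qed

lemma line_AC_diff:
  assumes "line_AC F" "line_AC G"
  shows "line_AC (\<lambda>x. F x - G x)"
  unfolding line_AC_def
proof (intro allI impI)
  fix \<epsilon> :: real assume "0 < \<epsilon>"
  then have "0 < \<epsilon> / 2" by simp
  obtain d1 where d1: "0 < d1" "\<And>n u v. (\<forall>i<n. u i \<le> v i) \<Longrightarrow>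
     disjoint_family_on (\<lambda>i. {u i <..< v i}) {..<n::nat} \<Longrightarrow>
     (\<Sum>i<n. v i - u i) < d1 \<Longrightarrow> (\<Sum>i<n. \<bar>F (v i) - F (u i)\<bar>) < \<epsilon> / 2"
    using assms(1) \<open>0 < \<epsilon> / 2\<close> unfolding line_AC_def by meson
  obtain d2 where d2: "0 < d2" "\<And>n u v. (\<forall>i<n. u i \<le> v i) \<Longrightarrow>
     disjoint_family_on (\<lambda>i. {u i <..< v i}) {..<n::nat} \<Longrightarrow>
     (\<Sum>i<n. v i - u i) < d2 \<Longrightarrow> (\<Sum>i<n. \<bar>G (v i) - G (u i)\<bar>) < \<epsilon> / 2"
    using assms(2) \<open>0 < \<epsilon> / 2\<close> unfolding line_AC_def by meson
  show "\<exists>\<delta>>0. \<forall>(n::nat) u v. (\<forall>i<n. u i \<le> v i) \<longrightarrow> disjoint_family_on (\<lambda>i. {u i<..<v i}) {..<n} \<longrightarrow>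
      (\<Sum>i<n. v i - u i) < \<delta> \<longrightarrow> (\<Sum>i<n. \<bar>F (v i) - G (v i) - (F (u i) - G (u i))\<bar>) < \<epsilon>"
  proof (intro exI[of _ "min d1 d2"] conjI allI impI)
    fix n :: nat and u v :: "nat \<Rightarrow> real"
    assume a: "\<forall>i<n. u i \<le> v i" "disjoint_family_on (\<lambda>i. {u i<..<v i}) {..<n}" "(\<Sum>i<n. v i - u i) < min d1 d2"
    have "(\<Sum>i<n. \<bar>F (v i) - G (v i) - (F (u i) - G (u i))\<bar>) \<le> (\<Sum>i<n. \<bar>F (v i) - F (u i)\<bar> + \<bar>G (v i) - G (u i)\<bar>)"
      by (intro sum_mono) linarith
    also have "\<dots> = (\<Sum>i<n. \<bar>F (v i) - F (u i)\<bar>) + (\<Sum>i<n. \<bar>G (v i) - G (u i)\<bar>)" by (rule sum.distrib)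
    also have "\<dots> < \<epsilon> / 2 + \<epsilon> / 2"
      using d1(2)[OF a(1,2)] d2(2)[OF a(1,2)] a(3) by (intro add_strict_mono) auto
    finally show "(\<Sum>i<n. \<bar>F (v i) - G (v i) - (F (u i) - G (u i))\<bar>) < \<epsilon>" by simp
  qed (use d1 d2 in auto)
qed

lemma line_AC_continuous:
  assumes "line_AC F"
  shows "isCont F x"
  unfolding continuous_at_eps_delta
proof (intro allI impI)
  fix \<epsilon> :: real assume "0 < \<epsilon>"
  from line_AC_finite_family[OF assms this, where 'i = unit] obtain \<delta> where \<delta>: "0 < \<delta>"
    and H0: "\<forall>(A :: unit set) u v. finite A \<longrightarrow> (\<forall>i\<in>A. u i \<le> v i) \<longrightarrow>
     disjoint_family_on (\<lambda>i. {u i <..< v i}) A \<longrightarrow>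
     (\<Sum>i\<in>A. v i - u i) < \<delta> \<longrightarrow> (\<Sum>i\<in>A. \<bar>F (v i) - F (u i)\<bar>) < \<epsilon>"
    by (elim exE conjE) (rule that)
  note H = H0[THEN spec, THEN spec, THEN spec, THEN mp, THEN mp, THEN mp, THEN mp]
  have "\<bar>F y - F x\<bar> < \<epsilon>" if "\<bar>y - x\<bar> < \<delta>" for y
  proof -
    have "disjoint_family_on (\<lambda>i. {min x y<..<max x y}) {()}" by (simp add: disjoint_family_on_def)
    moreover have "max x y - min x y < \<delta>" using that by (auto simp: max_def min_def abs_if split: if_splits)
    ultimately have "\<bar>F (max x y) - F (min x y)\<bar> < \<epsilon>"
      using H[of "{()}" "\<lambda>_. min x y" "\<lambda>_. max x y"] by simp
    then show ?thesis by (cases "x \<le> y") (auto simp: max_def min_def abs_minus_commute)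
  qed
  then show "\<exists>\<delta>>0. \<forall>y. dist y x < \<delta> \<longrightarrow> dist (F y) (F x) < \<epsilon>"
    using \<delta> by (auto simp: dist_real_def)
qed

definition pos_variation_sums :: "(real \<Rightarrow> real) \<Rightarrow> real \<Rightarrow> real set" where
  "pos_variation_sums F x = {(\<Sum>i<n. F (v i) - F (u i)) | (n::nat) u v.
     (\<forall>i<n. u i \<le> v i \<and> v i \<le> x) \<and> disjoint_family_on (\<lambda>i. {u i <..< v i}) {..<n}}"

text \<open>Both this function and its difference with \<open>F\<close> are monotone; no lower end of the line is needed
  because \<open>F\<close> will be constant near \<open>-\<infinity>\<close>.\<close>

definition pos_variation :: "(real \<Rightarrow> real) \<Rightarrow> real \<Rightarrow> real" where
  "pos_variation F x = Sup (pos_variation_sums F x)"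

lemma pos_variation_sumsI:
  "(\<And>i. i < n \<Longrightarrow> u i \<le> v i \<and> v i \<le> x) \<Longrightarrow> disjoint_family_on (\<lambda>i. {u i <..< v i}) {..<n::nat} \<Longrightarrow>
   (\<Sum>i<n. F (v i) - F (u i)) \<in> pos_variation_sums F x"
  unfolding pos_variation_sums_def by blast

locale bounded_pos_variation =
  fixes F :: "real \<Rightarrow> real" and B :: real
  assumes bdd: "\<And>x s. s \<in> pos_variation_sums F x \<Longrightarrow> s \<le> B" and line_AC_F: "line_AC F"
begin

lemma pos_variation_sums_le: "s \<in> pos_variation_sums F x \<Longrightarrow> s \<le> pos_variation F x"
  unfolding pos_variation_def by (intro cSup_upper bdd_aboveI[of _ B] bdd)

lemma pos_variation_sums_nonempty: "pos_variation_sums F x \<noteq> {}"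
  using pos_variation_sumsI[of 0 "\<lambda>_. 0" "\<lambda>_. 0" x F] by (auto simp: disjoint_family_on_def)

text \<open>The single interval \<open>(x, y)\<close> can be appended to any family below \<open>x\<close>.\<close>

lemma pos_variation_step:
  assumes "x \<le> y"
  shows "pos_variation F x + (F y - F x) \<le> pos_variation F y" "pos_variation F x \<le> pos_variation F y"
proof -
  have "s + (F y - F x) \<le> pos_variation F y \<and> s \<le> pos_variation F y" if "s \<in> pos_variation_sums F x" for s
  proof -
    from that obtain n :: nat and u v where s: "s = (\<Sum>i<n. F (v i) - F (u i))"
      and uv: "\<And>i. i < n \<Longrightarrow> u i \<le> v i \<and> v i \<le> x" and dis: "disjoint_family_on (\<lambda>i. {u i <..< v i}) {..<n}"
      unfolding pos_variation_sums_def by blast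
    have "(\<Sum>i<Suc n. F ((v(n := y)) i) - F ((u(n := x)) i)) \<in> pos_variation_sums F y"
    proof (rule pos_variation_sumsI)
      show "(u(n := x)) i \<le> (v(n := y)) i \<and> (v(n := y)) i \<le> y" if "i < Suc n" for i
        using uv[of i] that \<open>x \<le> y\<close> by (cases "i = n") auto
      show "disjoint_family_on (\<lambda>i. {(u(n := x)) i<..<(v(n := y)) i}) {..<Suc n}"
        unfolding disjoint_family_on_def
      proof (intro ballI impI)
        fix i j assume ij: "i \<in> {..<Suc n}" "j \<in> {..<Suc n}" "i \<noteq> j"
        have disj: "{u i <..< v i} \<inter> {x<..<y} = {}" if "i < n" for i using uv[OF that] by auto
        consider "i < n" "j < n" | "i = n" "j < n" | "i < n" "j = n" using ij by fastforce
        then show "{(u(n := x)) i<..<(v(n := y)) i} \<inter> {(u(n := x)) j<..<(v(n := y)) j} = {}"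
        proof cases
          case 1
          then show ?thesis using dis ij(3) unfolding disjoint_family_on_def by auto
        next
          case 2
          then show ?thesis using disj[of j] by (simp add: Int_commute)
        next
          case 3
          then show ?thesis using disj[of i] by simp
        qed
      qed
    qed
    moreover have "(\<Sum>i<Suc n. F ((v(n := y)) i) - F ((u(n := x)) i)) = s + (F y - F x)"
      unfolding s by simp
    ultimately have "s + (F y - F x) \<le> pos_variation F y" using pos_variation_sums_le by metis
    moreover have "s \<in> pos_variation_sums F y"
      unfolding s by (rule pos_variation_sumsI) (use uv \<open>x \<le> y\<close> dis in \<open>force+\<close>)
    ultimately show ?thesis using pos_variation_sums_le by blast
  qed
  then have *: "\<And>s. s \<in> pos_variation_sums F x \<Longrightarrow> s \<le> pos_variation F y - (F y - F x)" "\<And>s. s \<in> pos_variation_sums F x \<Longrightarrow> s \<le> pos_variation F y"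
    by (auto simp: algebra_simps)
  have "pos_variation F x \<le> pos_variation F y - (F y - F x)" "pos_variation F x \<le> pos_variation F y"
    unfolding pos_variation_def[of F x] using cSup_least[OF pos_variation_sums_nonempty *(1)] cSup_least[OF pos_variation_sums_nonempty *(2)] by auto
  then show "pos_variation F x + (F y - F x) \<le> pos_variation F y" "pos_variation F x \<le> pos_variation F y" by auto
qed

text \<open>A nearly optimal family below \<open>y\<close> is cut at \<open>x\<close>; the pieces below \<open>x\<close> contribute at most the
  positive variation at \<open>x\<close>. Cutting by \<open>min\<close> and \<open>max\<close> keeps the index set.\<close>

lemma pos_variation_increment:
  assumes "x \<le> y" "0 < \<eta>"
  shows "\<exists>(n::nat) u v. (\<forall>i<n. x \<le> u i \<and> u i \<le> v i \<and> v i \<le> y) \<and>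
    disjoint_family_on (\<lambda>i. {u i <..< v i}) {..<n} \<and>
    pos_variation F y - pos_variation F x \<le> (\<Sum>i<n. F (v i) - F (u i)) + \<eta>"
proof -
  have "pos_variation F y - \<eta> < Sup (pos_variation_sums F y)" unfolding pos_variation_def using \<open>0 < \<eta>\<close> by simp
  then obtain s where "s \<in> pos_variation_sums F y" "pos_variation F y - \<eta> < s"
    by (meson less_cSupD pos_variation_sums_nonempty)
  then obtain n :: nat and u v where s: "pos_variation F y - \<eta> < (\<Sum>i<n. F (v i) - F (u i))"
      and uv: "\<And>i. i < n \<Longrightarrow> u i \<le> v i \<and> v i \<le> y" and dis: "disjoint_family_on (\<lambda>i. {u i <..< v i}) {..<n}"
      unfolding pos_variation_sums_def by blast
  have sub: "disjoint_family_on (\<lambda>i. {u' i <..< v' i}) {..<n}"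
    if "\<And>i. {u' i <..< v' i} \<subseteq> {u i <..< v i}" for u' v' :: "nat \<Rightarrow> real"
    by (rule disjoint_family_on_shrink[OF dis that])
  have "(\<Sum>i<n. F (min (v i) x) - F (min (u i) x)) \<in> pos_variation_sums F x"
  proof (rule pos_variation_sumsI[OF _ sub])
    fix i assume "i < n"
    then show "min (u i) x \<le> min (v i) x \<and> min (v i) x \<le> x" using uv[of i] by (auto simp: min_def)
  next
    fix i
    show "{min (u i) x<..<min (v i) x} \<subseteq> {u i<..<v i}" by (auto simp: min_def split: if_splits)
  qed
  then have 1: "(\<Sum>i<n. F (min (v i) x) - F (min (u i) x)) \<le> pos_variation F x" by (rule pos_variation_sums_le)
  have "(\<Sum>i<n. F (v i) - F (u i)) = (\<Sum>i<n. (F (min (v i) x) - F (min (u i) x)) + (F (max (v i) x) - F (max (u i) x)))"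
    by (intro sum.cong refl) (auto simp: min_def max_def)
  also have "\<dots> = (\<Sum>i<n. F (min (v i) x) - F (min (u i) x)) + (\<Sum>i<n. F (max (v i) x) - F (max (u i) x))"
    by (rule sum.distrib)
  finally have "pos_variation F y - pos_variation F x \<le> (\<Sum>i<n. F (max (v i) x) - F (max (u i) x)) + \<eta>"
    using 1 s by linarith
  moreover have "disjoint_family_on (\<lambda>i. {max (u i) x <..< max (v i) x}) {..<n}"
    by (rule sub) (auto simp: max_def)
  moreover have "\<forall>i<n. x \<le> max (u i) x \<and> max (u i) x \<le> max (v i) x \<and> max (v i) x \<le> y"
  proof (intro allI impI)
    fix i assume "i < n"
    then show "x \<le> max (u i) x \<and> max (u i) x \<le> max (v i) x \<and> max (v i) x \<le> y"
      using uv[of i] \<open>x \<le> y\<close> by (auto simp: max_def)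
  qed
  ultimately show ?thesis
    by (intro exI[of _ n] exI[of _ "\<lambda>i. max (u i) x"] exI[of _ "\<lambda>i. max (v i) x"]) auto
qed

text \<open>Each interval of the given family is replaced by a family inside it that almost realises the
  increment of the variation; the union of these families is again disjoint and not longer.\<close>

lemma line_AC_pos_variation: "line_AC (pos_variation F)"
  unfolding line_AC_def
proof (intro allI impI)
  fix \<epsilon> :: real assume "0 < \<epsilon>"
  then have "0 < \<epsilon> / 2" by simp
  from line_AC_finite_family[OF line_AC_F this, where 'i = "nat \<times> nat"] obtain \<delta> where \<delta>: "0 < \<delta>"
    and H0: "\<forall>(A :: (nat \<times> nat) set) u v. finite A \<longrightarrow> (\<forall>i\<in>A. u i \<le> v i) \<longrightarrow>
     disjoint_family_on (\<lambda>i. {u i <..< v i}) A \<longrightarrow>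
     (\<Sum>i\<in>A. v i - u i) < \<delta> \<longrightarrow> (\<Sum>i\<in>A. \<bar>F (v i) - F (u i)\<bar>) < \<epsilon> / 2"
    by (elim exE conjE) (rule that)
  note H = H0[THEN spec, THEN spec, THEN spec, THEN mp, THEN mp, THEN mp, THEN mp]
  have "(\<Sum>i<n. \<bar>pos_variation F (v i) - pos_variation F (u i)\<bar>) < \<epsilon>"
    if a: "\<forall>i<n. u i \<le> v i" "disjoint_family_on (\<lambda>i. {u i<..<v i}) {..<n}" "(\<Sum>i<n. v i - u i) < \<delta>"
    for n :: nat and u v
  proof -
    define \<eta> where "\<eta> = \<epsilon> / (2 * (real n + 1))"
    have \<eta>: "0 < \<eta>" unfolding \<eta>_def using \<open>0 < \<epsilon>\<close> by simp
    define Q where "Q = (\<lambda>i (m::nat) U V. (\<forall>j<m. u i \<le> U j \<and> U j \<le> V j \<and> V j \<le> v i) \<and>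
        disjoint_family_on (\<lambda>j. {U j <..< V j}) {..<m} \<and>
        pos_variation F (v i) - pos_variation F (u i) \<le> (\<Sum>j<m. F (V j) - F (U j)) + \<eta>)"
    have "\<exists>m U V. Q i m U V" if "i < n" for i
      unfolding Q_def by (rule pos_variation_increment[OF _ \<eta>]) (use a(1) that in simp)
    then obtain m U V where "\<And>i. i < n \<Longrightarrow> Q i (m i) (U i) (V i)" by metis
    then have mUV: "(\<forall>j<m i. u i \<le> U i j \<and> U i j \<le> V i j \<and> V i j \<le> v i) \<and>
        disjoint_family_on (\<lambda>j. {U i j <..< V i j}) {..<m i} \<and>
        pos_variation F (v i) - pos_variation F (u i) \<le> (\<Sum>j<m i. F (V i j) - F (U i j)) + \<eta>" if "i < n" for i
      using that unfolding Q_def by blast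
    define A where "A = Sigma {..<n} (\<lambda>i. {..<m i})"
    have Afin: "finite A" unfolding A_def by auto
    have le: "\<forall>q\<in>A. U (fst q) (snd q) \<le> V (fst q) (snd q)" unfolding A_def using mUV by auto
    have disA: "disjoint_family_on (\<lambda>q. {U (fst q) (snd q) <..< V (fst q) (snd q)}) A"
      unfolding disjoint_family_on_def
    proof (intro ballI impI)
      fix q r assume q: "q \<in> A" "r \<in> A" "q \<noteq> r"
      obtain i j i' j' where qr: "q = (i, j)" "r = (i', j')" by (cases q; cases r) auto
      have lt: "i < n" "i' < n" "j < m i" "j' < m i'" using q qr unfolding A_def by auto
      show "{U (fst q) (snd q) <..< V (fst q) (snd q)} \<inter> {U (fst r) (snd r) <..< V (fst r) (snd r)} = {}"
      proof (cases "i = i'")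
        case True
        then have "j \<noteq> j'" using q qr by auto
        then show ?thesis using mUV[OF lt(1)] lt True unfolding qr disjoint_family_on_def by auto
      next
        case False
        have "{U i j <..< V i j} \<subseteq> {u i<..<v i}" "{U i' j' <..< V i' j'} \<subseteq> {u i'<..<v i'}"
          using mUV[OF lt(1)] mUV[OF lt(2)] lt by force+
        moreover have "{u i<..<v i} \<inter> {u i'<..<v i'} = {}"
          using a(2) False lt unfolding disjoint_family_on_def by auto
        ultimately show ?thesis by (simp only: qr fst_conv snd_conv) blast
      qed
    qed
    have "(\<Sum>q\<in>A. V (fst q) (snd q) - U (fst q) (snd q)) = (\<Sum>i<n. \<Sum>j<m i. V i j - U i j)"
      unfolding A_def by (subst sum.Sigma) (auto simp: case_prod_beta')
    also have "\<dots> \<le> (\<Sum>i<n. v i - u i)"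
    proof (intro sum_mono)
      fix i assume "i \<in> {..<n}"
      then show "(\<Sum>j<m i. V i j - U i j) \<le> v i - u i"
        using mUV[of i] a(1) by (intro disjoint_length_le) auto
    qed
    finally have "(\<Sum>q\<in>A. V (fst q) (snd q) - U (fst q) (snd q)) < \<delta>" using a(3) by linarith
    from H[OF Afin le disA this]
    have S: "(\<Sum>q\<in>A. \<bar>F (V (fst q) (snd q)) - F (U (fst q) (snd q))\<bar>) < \<epsilon> / 2" .
    have "(\<Sum>i<n. \<bar>pos_variation F (v i) - pos_variation F (u i)\<bar>) \<le> (\<Sum>i<n. (\<Sum>j<m i. \<bar>F (V i j) - F (U i j)\<bar>) + \<eta>)"
    proof (intro sum_mono)
      fix i assume "i \<in> {..<n}"
      then have i: "i < n" by simp
      have "\<bar>pos_variation F (v i) - pos_variation F (u i)\<bar> = pos_variation F (v i) - pos_variation F (u i)"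
        using pos_variation_step(2)[of "u i" "v i"] a(1) i by simp
      also have "\<dots> \<le> (\<Sum>j<m i. F (V i j) - F (U i j)) + \<eta>" using mUV[OF i] by blast
      also have "\<dots> \<le> (\<Sum>j<m i. \<bar>F (V i j) - F (U i j)\<bar>) + \<eta>" by (intro add_right_mono sum_mono) simp
      finally show "\<bar>pos_variation F (v i) - pos_variation F (u i)\<bar> \<le> (\<Sum>j<m i. \<bar>F (V i j) - F (U i j)\<bar>) + \<eta>" .
    qed
    also have "\<dots> = (\<Sum>i<n. \<Sum>j<m i. \<bar>F (V i j) - F (U i j)\<bar>) + real n * \<eta>" by (simp add: sum.distrib)
    also have "(\<Sum>i<n. \<Sum>j<m i. \<bar>F (V i j) - F (U i j)\<bar>) = (\<Sum>q\<in>A. \<bar>F (V (fst q) (snd q)) - F (U (fst q) (snd q))\<bar>)"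
      unfolding A_def by (subst sum.Sigma) (auto simp: case_prod_beta')
    also have "\<dots> + real n * \<eta> < \<epsilon> / 2 + \<epsilon> / 2"
    proof (rule add_less_le_mono[OF S])
      have "real n * \<eta> \<le> (real n + 1) * \<eta>" using \<eta> by (intro mult_right_mono) auto
      also have "\<dots> = \<epsilon> / 2" unfolding \<eta>_def by (simp add: field_simps)
      finally show "real n * \<eta> \<le> \<epsilon> / 2" .
    qed
    finally show ?thesis by simp
  qed
  then show "\<exists>\<delta>>0. \<forall>(n::nat) u v. (\<forall>i<n. u i \<le> v i) \<longrightarrow> disjoint_family_on (\<lambda>i. {u i<..<v i}) {..<n} \<longrightarrow>
      (\<Sum>i<n. v i - u i) < \<delta> \<longrightarrow> (\<Sum>i<n. \<bar>pos_variation F (v i) - pos_variation F (u i)\<bar>) < \<epsilon>"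
    using \<delta> by blast
qed

end

text \<open>A null set is covered by an open set of small length. The open set is exhausted by finite unions
  of compact intervals, hence by finite unions of nonoverlapping ones, and on these the measure is
  a sum of increments that absolute continuity makes small.\<close>

lemma mono_line_AC_null:
  assumes mono: "\<And>x y. x \<le> y \<Longrightarrow> H x \<le> H y" and ac: "line_AC H"
    and N: "N \<in> null_sets lborel"
  shows "emeasure (interval_measure H) N = 0"
proof -
  let ?\<mu> = "interval_measure H"
  have cont: "continuous (at_right a) H" for a
    using line_AC_continuous[OF ac, of a] continuous_at_imp_continuous_at_within by blast
  have le_eps: "emeasure ?\<mu> N \<le> ennreal \<epsilon>" if "0 < \<epsilon>" for \<epsilon>
  proof -
    from line_AC_finite_family[OF ac that, where 'i = "real set"] obtain \<delta> where \<delta>: "0 < \<delta>"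
      and H0: "\<forall>(A :: real set set) u v. finite A \<longrightarrow> (\<forall>i\<in>A. u i \<le> v i) \<longrightarrow>
     disjoint_family_on (\<lambda>i. {u i <..< v i}) A \<longrightarrow>
     (\<Sum>i\<in>A. v i - u i) < \<delta> \<longrightarrow> (\<Sum>i\<in>A. \<bar>H (v i) - H (u i)\<bar>) < \<epsilon>"
    by (elim exE conjE) (rule that)
  note H = H0[THEN spec, THEN spec, THEN spec, THEN mp, THEN mp, THEN mp, THEN mp]
    have Nb: "N \<in> sets borel" "emeasure lborel N = 0" using N by (auto simp: null_sets_def)
    obtain U where U: "open U" "N \<subseteq> U" "emeasure lborel (U - N) < ennreal \<delta>"
      using outer_regular_lborel[OF Nb(1) \<delta>] by blast
    have Ub: "U \<in> sets borel" using U by simp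
    have "emeasure lborel U \<le> emeasure lborel N + emeasure lborel (U - N)"
    proof -
      have "emeasure lborel U = emeasure lborel (N \<union> (U - N))" using U(2) by (intro arg_cong[where f = "emeasure lborel"]) auto
      also have "\<dots> \<le> emeasure lborel N + emeasure lborel (U - N)"
        by (rule emeasure_subadditive) (use Nb Ub in auto)
      finally show ?thesis .
    qed
    then have U\<delta>: "emeasure lborel U < ennreal \<delta>" using U(3) Nb(2) by simp
    obtain D where D: "countable D" "D \<subseteq> Pow U" "\<And>X. X \<in> D \<Longrightarrow> \<exists>a b. X = cbox a b" "\<Union>D = U"
      using open_countable_Union_open_cbox[OF U(1)] by metis
    have fin: "emeasure ?\<mu> (\<Union>E) \<le> ennreal \<epsilon>" if E: "finite E" "E \<subseteq> D" for E
    proof -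
      obtain d where d: "d division_of (\<Union>E)"
        using elementary_unions_intervals[OF E(1)] D(3) E(2) by blast
      note dd = division_ofD[OF d]
      define u where "u = (Inf :: real set \<Rightarrow> real)"
      define v where "v = (Sup :: real set \<Rightarrow> real)"
      have K: "K = {u K .. v K}" "u K \<le> v K" if KD: "K \<in> d" for K
      proof -
        obtain a b where ab: "K = cbox a b" using dd(4)[OF KD] by blast
        moreover have "K \<noteq> {}" using dd(3)[OF KD] .
        ultimately have "a \<le> b" "K = {a..b}" by auto
        then show "K = {u K .. v K}" "u K \<le> v K" unfolding u_def v_def by auto
      qed
      have ip: "{u K<..<v K} = interior K" if "K \<in> d" for K
      proof -
        have "interior K = interior {u K..v K}" by (rule arg_cong[OF K(1)[OF that]])
        then show ?thesis by simp
      qed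
      have dis: "disjoint_family_on (\<lambda>K. {u K<..<v K}) d"
        unfolding disjoint_family_on_def using ip dd(5) by simp
      have Kle: "\<forall>K\<in>d. u K \<le> v K" using K(2) by blast
      have "ennreal (\<Sum>K\<in>d. v K - u K) = emeasure lborel (\<Union>K\<in>d. {u K<..<v K})"
        by (rule disjoint_length_measure[OF dd(1) Kle dis])
      also have "\<dots> \<le> emeasure lborel U"
      proof (rule emeasure_mono)
        have "{u K<..<v K} \<subseteq> U" if "K \<in> d" for K
          using ip[OF that] interior_subset[of K] dd(2)[OF that] E(2) D(2) by blast
        then show "(\<Union>K\<in>d. {u K<..<v K}) \<subseteq> U" by blast
      qed (use Ub in simp)
      finally have "ennreal (\<Sum>K\<in>d. v K - u K) < ennreal \<delta>" using U\<delta> by (rule le_less_trans)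
      then have len: "(\<Sum>K\<in>d. v K - u K) < \<delta>"
        using K(2) by (subst (asm) ennreal_less_iff) (auto intro!: sum_nonneg)
      have "emeasure ?\<mu> (\<Union>E) = emeasure ?\<mu> (\<Union>K\<in>d. {u K..v K})"
      proof -
        have "(\<Union>K\<in>d. {u K..v K}) = (\<Union>K\<in>d. K)" by (rule SUP_cong[OF refl]) (rule K(1)[symmetric])
        then show ?thesis using dd(6) by simp
      qed
      also have "\<dots> \<le> (\<Sum>K\<in>d. emeasure ?\<mu> {u K..v K})"
        by (rule emeasure_subadditive_finite) (use dd(1) in auto)
      also have "\<dots> = (\<Sum>K\<in>d. ennreal (H (v K) - H (u K)))"
      proof (intro sum.cong refl)
        fix K assume "K \<in> d"
        show "emeasure ?\<mu> {u K..v K} = ennreal (H (v K) - H (u K))"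
          by (rule emeasure_interval_measure_Icc)
             (use K(2)[OF \<open>K \<in> d\<close>] mono line_AC_continuous[OF ac] in \<open>auto intro: continuous_at_imp_continuous_on\<close>)
      qed
      also have "\<dots> = ennreal (\<Sum>K\<in>d. H (v K) - H (u K))"
        by (rule sum_ennreal) (use K(2) mono in auto)
      also have "\<dots> \<le> ennreal (\<Sum>K\<in>d. \<bar>H (v K) - H (u K)\<bar>)"
        by (intro ennreal_leI sum_mono) auto
      also have "\<dots> \<le> ennreal \<epsilon>" using H[OF dd(1) Kle dis len] by (intro ennreal_leI) simp
      finally show ?thesis .
    qed
    have "emeasure ?\<mu> U \<le> ennreal \<epsilon>"
    proof (cases "D = {}")
      case True
      then show ?thesis using D(4) by auto
    next
      case False
      define T where "T = (\<lambda>m::nat. \<Union>(from_nat_into D ` {..m}))"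
      have "range (from_nat_into D) = D" using D(1) False by (rule range_from_nat_into[rotated])
      have "(\<Union>m. T m) = \<Union>(range (from_nat_into D))" unfolding T_def by auto
      then have TU: "(\<Union>m. T m) = U" unfolding \<open>range (from_nat_into D) = D\<close> D(4) .
      have Ts: "range T \<subseteq> sets ?\<mu>"
      proof -
        have "from_nat_into D i \<in> sets borel" for i
        proof -
          obtain a b where "from_nat_into D i = cbox a b" using D(3)[OF from_nat_into[OF False, of i]] by blast
          then show ?thesis by simp
        qed
        then show ?thesis unfolding T_def by auto
      qed
      have "incseq T" unfolding T_def incseq_def by (auto intro: order_trans)
      then have "emeasure ?\<mu> U = (SUP m. emeasure ?\<mu> (T m))"
        using SUP_emeasure_incseq[OF Ts] TU by simp
      also have "\<dots> \<le> ennreal \<epsilon>"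
        unfolding T_def by (intro SUP_least fin) (use from_nat_into[OF False] in auto)
      finally show ?thesis .
    qed
    then show ?thesis using emeasure_mono[OF U(2), of ?\<mu>] Ub by simp
  qed
  have "emeasure ?\<mu> N \<le> 0"
    by (rule ennreal_le_epsilon) (use le_eps in simp)
  then show ?thesis by simp
qed

definition has_density :: "(real \<Rightarrow> 'a::{banach, second_countable_topology}) \<Rightarrow> (real \<Rightarrow> 'a) \<Rightarrow> bool" where
  "has_density F g \<longleftrightarrow> g \<in> borel_measurable borel \<and>
     (\<forall>s t. s \<le> t \<longrightarrow> set_integrable lborel {s..t} g \<and> (LINT x:{s..t}|lborel. g x) = F t - F s)"

lemma mono_line_AC_density:
  assumes mono: "\<And>x y. x \<le> y \<Longrightarrow> H x \<le> H y" and ac: "line_AC H"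
  shows "\<exists>g. has_density H (g :: real \<Rightarrow> real)"
proof -
  let ?\<mu> = "interval_measure H"
  have "absolutely_continuous lborel ?\<mu>"
    unfolding absolutely_continuous_def using mono_line_AC_null[OF mono ac]
    by (auto simp: null_sets_def)
  then obtain h where h: "h \<in> borel_measurable lborel" "density lborel h = ?\<mu>"
    using sigma_finite_measure.Radon_Nikodym[OF lborel.sigma_finite_measure_axioms, of ?\<mu>] by auto
  have [measurable]: "h \<in> borel_measurable borel" using h(1) by simp
  define g where "g = (\<lambda>x. enn2real (h x))"
  have [measurable]: "g \<in> borel_measurable borel" unfolding g_def by measurable
  have "set_integrable lborel {s..t} g \<and> (LINT x:{s..t}|lborel. g x) = H t - H s" if "s \<le> t" for s t
  proof -
    have "emeasure ?\<mu> {s..t} = ennreal (H t - H s)"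
      by (rule emeasure_interval_measure_Icc)
         (use that mono line_AC_continuous[OF ac] in \<open>auto intro: continuous_at_imp_continuous_on\<close>)
    moreover have "emeasure ?\<mu> {s..t} = (\<integral>\<^sup>+x. h x * indicator {s..t} x \<partial>lborel)"
      unfolding h(2)[symmetric] by (rule emeasure_density) (use h(1) in auto)
    ultimately have I: "(\<integral>\<^sup>+x. h x * indicator {s..t} x \<partial>lborel) = ennreal (H t - H s)" by simp
    then have "AE x in lborel. h x * indicator {s..t} x \<noteq> \<infinity>"
      by (intro nn_integral_PInf_AE) auto
    then have "AE x in lborel. h x * indicator {s..t} x = ennreal (indicator {s..t} x * g x)"
      by eventually_elim (auto simp: g_def indicator_def less_top split: if_splits)
    then have I2: "(\<integral>\<^sup>+x. ennreal (indicator {s..t} x * g x) \<partial>lborel) = ennreal (H t - H s)"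
      unfolding I[symmetric] by (intro nn_integral_cong_AE) auto
    have nn: "AE x in lborel. 0 \<le> indicator {s..t} x * g x" unfolding g_def by simp
    have "has_bochner_integral lborel (\<lambda>x. indicator {s..t} x * g x) (H t - H s)"
      by (rule has_bochner_integral_nn_integral[OF _ nn _ I2]) (use mono[OF that] in auto)
    then show ?thesis
      unfolding set_integrable_def set_lebesgue_integral_def by (simp add: has_bochner_integral_iff)
  qed
  then show ?thesis unfolding has_density_def using \<open>g \<in> borel_measurable borel\<close> by blast
qed

lemma has_density_diff:
  "has_density F f \<Longrightarrow> has_density G g \<Longrightarrow> has_density (\<lambda>x. F x - G x) (\<lambda>x. f x - g x)"
  unfolding has_density_def by (auto simp: set_integral_diff)

text \<open>The difference of the two monotone functions \<open>pos_variation F\<close> and \<open>pos_variation F - F\<close>.\<close>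

lemma bounded_pos_variation_density:
  assumes "bounded_pos_variation F B"
  shows "\<exists>g. has_density F (g :: real \<Rightarrow> real)"
proof -
  interpret bounded_pos_variation F B by fact
  obtain g1 :: "real \<Rightarrow> real" where g1: "has_density (pos_variation F) g1"
    using mono_line_AC_density[OF pos_variation_step(2) line_AC_pos_variation] by blast
  obtain g2 :: "real \<Rightarrow> real" where g2: "has_density (\<lambda>x. pos_variation F x - F x) g2"
    using mono_line_AC_density[of "\<lambda>x. pos_variation F x - F x", OF _ line_AC_diff[OF line_AC_pos_variation line_AC_F]] pos_variation_step(1)
    by (force simp: algebra_simps)
  show ?thesis using has_density_diff[OF g1 g2] by auto
qed

lemma density_right_difference:
  fixes F g :: "real \<Rightarrow> complex"
  assumes "has_density F g"
  obtains N where "N \<in> null_sets lebesgue"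
    "\<And>x e. x \<notin> N \<Longrightarrow> 0 < e \<Longrightarrow> \<exists>d>0. \<forall>h. 0 < h \<and> h < d \<longrightarrow> cmod (F (x + h) - F x - of_real h * g x) \<le> e * h"
proof -
  have gi: "g integrable_on {s..t}" "integral {s..t} g = F t - F s" if "s \<le> t" for s t
  proof -
    have *: "set_integrable lborel {s..t} g" "(LINT x:{s..t}|lborel. g x) = F t - F s"
      using assms that unfolding has_density_def by auto
    from set_borel_integral_eq_integral[OF *(1)] *(2)
    show "g integrable_on {s..t}" "integral {s..t} g = F t - F s" by auto
  qed
  have "g integrable_on cbox a b" for a b
    using gi(1)[of a b] by (cases "a \<le> b") auto
  then obtain N where N: "negligible N" "\<And>x e. \<lbrakk>x \<notin> N; 0 < e\<rbrakk> \<Longrightarrow>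
      \<exists>d>0. \<forall>h. 0 < h \<and> h < d \<longrightarrow> norm (integral (cbox x (x + h *\<^sub>R One)) g /\<^sub>R h ^ DIM(real) - g x) < e"
    using integrable_ccontinuous_explicit[of g] by metis
  show thesis
  proof (rule that[of N])
    show "N \<in> null_sets lebesgue" using N(1) negligible_iff_null_sets by blast
    fix x e :: real assume x: "x \<notin> N" "0 < e"
    from N(2)[OF this] obtain d where d: "0 < d" "\<And>h. 0 < h \<and> h < d \<Longrightarrow>
      norm (integral (cbox x (x + h *\<^sub>R One)) g /\<^sub>R h ^ DIM(real) - g x) < e" by blast
    have "cmod (F (x + h) - F x - of_real h * g x) \<le> e * h" if h: "0 < h" "h < d" for h
    proof -
      have "norm ((F (x + h) - F x) /\<^sub>R h - g x) < e"
        using d(2)[of h] h gi(2)[of x "x + h"] by simp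
      moreover have "F (x + h) - F x - of_real h * g x = h *\<^sub>R ((F (x + h) - F x) /\<^sub>R h - g x)"
      proof -
        have "h *\<^sub>R ((F (x + h) - F x) /\<^sub>R h - g x) = (F (x + h) - F x) - h *\<^sub>R g x"
          using h by (simp only: scaleR_right_diff_distrib scaleR_scaleR) simp
        then show ?thesis by (simp add: scaleR_conv_of_real)
      qed
      ultimately show ?thesis using h by (simp add: mult.commute less_imp_le)
    qed
    then show "\<exists>d>0. \<forall>h. 0 < h \<and> h < d \<longrightarrow> cmod (F (x + h) - F x - of_real h * g x) \<le> e * h"
      using d(1) by blast
  qed
qed

text \<open>The left difference quotients of a function are the right ones of its reflection, so
  \<open>density_right_difference\<close> controls both.\<close>

lemma density_vector_derivative:
  fixes F g :: "real \<Rightarrow> complex"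
  assumes Fg: "has_density F g"
  shows "AE x in lebesgue. (F has_vector_derivative g x) (at x)"
proof -
  obtain N1 where N1: "N1 \<in> null_sets lebesgue"
    "\<And>x e. x \<notin> N1 \<Longrightarrow> 0 < e \<Longrightarrow> \<exists>d>0. \<forall>h. 0 < h \<and> h < d \<longrightarrow> cmod (F (x + h) - F x - of_real h * g x) \<le> e * h"
    using density_right_difference[OF Fg] by metis
  have "has_density (\<lambda>x. - F (- x)) (\<lambda>x. g (- x))"
    unfolding has_density_def
  proof (intro conjI allI impI)
    have [measurable]: "g \<in> borel_measurable borel" using Fg by (simp add: has_density_def)
    show "(\<lambda>x. g (- x)) \<in> borel_measurable borel" by measurable
    fix s t :: real assume "s \<le> t"
    then have *: "set_integrable lborel {-t..-s} g" "(LINT x:{-t..-s}|lborel. g x) = F (-s) - F (-t)"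
      using Fg unfolding has_density_def by auto
    have ind: "indicator {-t..-s} (0 + -1 * x) = (indicator {s..t} x :: real)" for x by (auto simp: indicator_def)
    show "set_integrable lborel {s..t} (\<lambda>x. g (- x))"
      using lborel_integrable_real_affine[OF *(1)[unfolded set_integrable_def], of "-1" 0]
      unfolding set_integrable_def ind by simp
    have "(LINT x:{-t..-s}|lborel. g x) = (LINT x:{s..t}|lborel. g (- x))"
      unfolding set_lebesgue_integral_def
      by (subst lborel_integral_real_affine[of "-1" _ 0]) (simp_all add: ind[simplified])
    then show "(LINT x:{s..t}|lborel. g (- x)) = - F (- t) - - F (- s)" using *(2) by simp
  qed
  then obtain N2 where N2: "N2 \<in> null_sets lebesgue"
    "\<And>x e. x \<notin> N2 \<Longrightarrow> 0 < e \<Longrightarrow> \<exists>d>0. \<forall>h. 0 < h \<and> h < d \<longrightarrow> cmod (- F (- (x + h)) - - F (- x) - of_real h * g (- x)) \<le> e * h"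
    using density_right_difference by metis
  have N2': "uminus ` N2 \<in> null_sets lebesgue"
  proof -
    have "negligible (uminus ` N2)"
    proof (rule negligible_locally_Lipschitz_image)
      show "negligible N2" using N2(1) negligible_iff_null_sets by blast
      show "\<exists>T B. open T \<and> x \<in> T \<and> (\<forall>y\<in>N2 \<inter> T. norm (- y - - x) \<le> B * norm (y - x))" for x
        by (rule exI[of _ UNIV], rule exI[of _ 1]) auto
    qed simp
    then show ?thesis using negligible_iff_null_sets by blast
  qed
  have "(F has_vector_derivative g x) (at x)" if x: "x \<notin> N1" "x \<notin> uminus ` N2" for x
    unfolding has_vector_derivative_def has_derivative_at_alt
  proof (intro conjI allI impI)
    fix e :: real assume "0 < e"
    obtain d1 where d1: "0 < d1" "\<And>h. 0 < h \<Longrightarrow> h < d1 \<Longrightarrow> cmod (F (x + h) - F x - of_real h * g x) \<le> e * h"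
      using N1(2)[OF x(1) \<open>0 < e\<close>] by blast
    have "- x \<notin> N2" using x(2) by force
    then obtain d2 where d2: "0 < d2" "\<And>h. 0 < h \<Longrightarrow> h < d2 \<Longrightarrow> cmod (- F (- (- x + h)) - - F (- (- x)) - of_real h * g (- (- x))) \<le> e * h"
      using N2(2)[OF _ \<open>0 < e\<close>] by blast
    show "\<exists>d>0. \<forall>y. norm (y - x) < d \<longrightarrow> norm (F y - F x - (y - x) *\<^sub>R g x) \<le> e * norm (y - x)"
    proof (intro exI[of _ "min d1 d2"] conjI allI impI)
      fix y assume y: "norm (y - x) < min d1 d2"
      consider "y = x" | "x < y" | "y < x" by linarith
      then show "norm (F y - F x - (y - x) *\<^sub>R g x) \<le> e * norm (y - x)"
      proof cases
        case 2
        then show ?thesis using d1(2)[of "y - x"] y by (simp add: scaleR_conv_of_real)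
      next
        case 3
        have "cmod (- F y + F x - of_real (x - y) * g x) \<le> e * (x - y)"
          using d2(2)[of "x - y"] y 3 by simp
        moreover have "- F y + F x - of_real (x - y) * g x = - (F y - F x - (y - x) *\<^sub>R g x)"
          by (simp add: scaleR_conv_of_real algebra_simps)
        ultimately show ?thesis using 3 by (simp only: norm_minus_cancel) simp
      qed simp
    qed (use d1 d2 in auto)
  qed (rule bounded_linear_scaleR_left)
  then have "x \<notin> N1 \<Longrightarrow> x \<notin> uminus ` N2 \<Longrightarrow> (F has_vector_derivative g x) (at x)" for x .
  with AE_not_in[OF N1(1)] AE_not_in[OF N2'] show ?thesis
    by (auto elim!: AE_mp)
qed

text \<open>Intervals shorter than the \<open>\<delta>\<close> that belongs to \<open>\<epsilon> = 1\<close> have variation at most one. This makes the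
  positive variation finite without first cutting the interval into pieces.\<close>

lemma abs_cont_local:
  assumes ac: "abs_cont_on a b f" and "a \<le> b"
  shows "\<exists>\<delta>>0. \<forall>s t. a \<le> s \<and> s \<le> t \<and> t \<le> b \<and> t - s < \<delta> \<longrightarrow>
     (\<exists>g. g \<in> borel_measurable borel \<and> set_integrable lborel {s..t} g \<and>
        (LINT x:{s..t}|lborel. g x) = f t - f s \<and>
        (AE x in lebesgue. s < x \<and> x < t \<longrightarrow> (f has_vector_derivative g x) (at x)))"
proof -
  obtain \<delta> where \<delta>: "0 < \<delta>" and H: "\<And>n u v. (\<forall>i<n. a \<le> u i \<and> u i \<le> v i \<and> v i \<le> b) \<Longrightarrow>
     disjoint_family_on (\<lambda>i. {u i <..< v i}) {..<n::nat} \<Longrightarrow>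
     (\<Sum>i<n. v i - u i) < \<delta> \<Longrightarrow> (\<Sum>i<n. cmod (f (v i) - f (u i))) < 1"
    using ac unfolding abs_cont_on_def by (meson zero_less_one)
  have "\<exists>g. g \<in> borel_measurable borel \<and> set_integrable lborel {s..t} g \<and>
        (LINT x:{s..t}|lborel. g x) = f t - f s \<and>
        (AE x in lebesgue. s < x \<and> x < t \<longrightarrow> (f has_vector_derivative g x) (at x))"
    if st: "a \<le> s" "s \<le> t" "t \<le> b" "t - s < \<delta>" for s t
  proof -
    (* Freezing f outside of [s, t] gives a function that is absolutely continuous on the line. *)
    define cl where "cl = (\<lambda>x. max s (min t x))"
    have cl: "s \<le> cl x" "cl x \<le> t" "x \<le> y \<Longrightarrow> cl x \<le> cl y" "{cl x<..<cl y} \<subseteq> {x<..<y}"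
      "x \<le> y \<Longrightarrow> cl y - cl x \<le> y - x" for x y
      using st(2) unfolding cl_def by (auto simp: min_def max_def)
    have fam: "disjoint_family_on (\<lambda>i. {cl (u i)<..<cl (v i)}) {..<n}"
      if "disjoint_family_on (\<lambda>i. {u i <..< v i}) {..<n::nat}" for n u v
      by (rule disjoint_family_on_shrink[OF that cl(4)])
    have pv: "\<exists>g. has_density (\<lambda>x. R (f (cl x))) (g :: real \<Rightarrow> real)"
      if R: "\<And>z w. R z - R w \<le> cmod (z - w)" for R :: "complex \<Rightarrow> real"
    proof -
      let ?F = "\<lambda>x. R (f (cl x))"
      have R': "\<bar>R z - R w\<bar> \<le> cmod (z - w)" for z w
        using R[of z w] R[of w z] by (simp add: norm_minus_commute abs_le_iff)
      have "bounded_pos_variation ?F 1"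
      proof
        fix x r assume "r \<in> pos_variation_sums ?F x"
        then obtain n :: nat and u v where r: "r = (\<Sum>i<n. ?F (v i) - ?F (u i))"
          and uv: "\<forall>i<n. u i \<le> v i" and dis: "disjoint_family_on (\<lambda>i. {u i <..< v i}) {..<n}"
          unfolding pos_variation_sums_def by blast
        have "r \<le> (\<Sum>i<n. cmod (f (cl (v i)) - f (cl (u i))))"
          unfolding r by (intro sum_mono R)
        also have "\<dots> < 1"
        proof (rule H[OF _ fam[OF dis]])
          show "\<forall>i<n. a \<le> cl (u i) \<and> cl (u i) \<le> cl (v i) \<and> cl (v i) \<le> b"
            using uv cl(1-3) st by (meson order_trans)
          have "(\<Sum>i<n. cl (v i) - cl (u i)) \<le> t - s"
            by (rule disjoint_length_le[OF _ _ fam[OF dis]]) (use uv cl(1-3) st in auto)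
          then show "(\<Sum>i<n. cl (v i) - cl (u i)) < \<delta>" using st by linarith
        qed
        finally show "r \<le> 1" by simp
      next
        show "line_AC ?F"
          unfolding line_AC_def
        proof (intro allI impI)
          fix \<epsilon> :: real assume "0 < \<epsilon>"
          then obtain d where d: "0 < d" and Hd: "\<And>n u v. (\<forall>i<n. a \<le> u i \<and> u i \<le> v i \<and> v i \<le> b) \<Longrightarrow>
             disjoint_family_on (\<lambda>i. {u i <..< v i}) {..<n::nat} \<Longrightarrow>
             (\<Sum>i<n. v i - u i) < d \<Longrightarrow> (\<Sum>i<n. cmod (f (v i) - f (u i))) < \<epsilon>"
            using ac unfolding abs_cont_on_def by meson
          have "(\<Sum>i<n. \<bar>?F (v i) - ?F (u i)\<bar>) < \<epsilon>"
            if uv: "\<forall>i<n. u i \<le> v i" and dis: "disjoint_family_on (\<lambda>i. {u i<..<v i}) {..<n}"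
              and len: "(\<Sum>i<n. v i - u i) < d" for n :: nat and u v
          proof -
            have "(\<Sum>i<n. \<bar>?F (v i) - ?F (u i)\<bar>) \<le> (\<Sum>i<n. cmod (f (cl (v i)) - f (cl (u i))))"
              by (intro sum_mono R')
            also have "\<dots> < \<epsilon>"
            proof (rule Hd[OF _ fam[OF dis]])
              show "\<forall>i<n. a \<le> cl (u i) \<and> cl (u i) \<le> cl (v i) \<and> cl (v i) \<le> b"
                using uv cl(1-3) st by (meson order_trans)
              have "(\<Sum>i<n. cl (v i) - cl (u i)) \<le> (\<Sum>i<n. v i - u i)"
                using uv by (intro sum_mono cl(5)) auto
              then show "(\<Sum>i<n. cl (v i) - cl (u i)) < d" using len by linarith
            qed
            finally show ?thesis .
          qed
          then show "\<exists>\<delta>>0. \<forall>(n::nat) u v. (\<forall>i<n. u i \<le> v i) \<longrightarrow> disjoint_family_on (\<lambda>i. {u i<..<v i}) {..<n} \<longrightarrow>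
            (\<Sum>i<n. v i - u i) < \<delta> \<longrightarrow> (\<Sum>i<n. \<bar>?F (v i) - ?F (u i)\<bar>) < \<epsilon>"
            using d by blast
        qed
      qed
      then show ?thesis by (rule bounded_pos_variation_density)
    qed
    obtain g1 where g1: "has_density (\<lambda>x. Re (f (cl x))) g1"
      using pv[of Re] abs_Re_le_cmod by (metis abs_le_D1 minus_complex.simps(1))
    obtain g2 where g2: "has_density (\<lambda>x. Im (f (cl x))) g2"
      using pv[of Im] abs_Im_le_cmod by (metis abs_le_D1 minus_complex.simps(2))
    define g where "g = (\<lambda>x. Complex (g1 x) (g2 x))"
    have gd: "has_density (\<lambda>x. f (cl x)) g"
      unfolding has_density_def
    proof (intro conjI allI impI)
      have [measurable]: "g1 \<in> borel_measurable borel" "g2 \<in> borel_measurable borel"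
        using g1 g2 by (auto simp: has_density_def)
      have geq: "g = (\<lambda>x. of_real (g1 x) + \<i> * of_real (g2 x))" unfolding g_def by (simp add: complex_eq_iff fun_eq_iff)
      show "g \<in> borel_measurable borel" unfolding geq by measurable
      fix x y :: real assume "x \<le> y"
      then have 1: "set_integrable lborel {x..y} g1" "(LINT x:{x..y}|lborel. g1 x) = Re (f (cl y)) - Re (f (cl x))"
        and 2: "set_integrable lborel {x..y} g2" "(LINT x:{x..y}|lborel. g2 x) = Im (f (cl y)) - Im (f (cl x))"
        using g1 g2 unfolding has_density_def by auto
      have i1: "set_integrable lborel {x..y} (\<lambda>x. complex_of_real (g1 x))"
        and i2: "set_integrable lborel {x..y} (\<lambda>x. \<i> * complex_of_real (g2 x))"
      proof -
        have c: "set_integrable lborel {x..y} (\<lambda>x. complex_of_real (h x))"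
          if "set_integrable lborel {x..y} h" for h :: "real \<Rightarrow> real"
        proof -
          have "integrable lborel (\<lambda>t. complex_of_real (indicator {x..y} t *\<^sub>R h t))"
            using that unfolding set_integrable_def by (rule integrable_of_real)
          then show ?thesis unfolding set_integrable_def by (simp add: scaleR_conv_of_real)
        qed
        show "set_integrable lborel {x..y} (\<lambda>x. complex_of_real (g1 x))" by (rule c[OF 1(1)])
        show "set_integrable lborel {x..y} (\<lambda>x. \<i> * complex_of_real (g2 x))"
          using c[OF 2(1)] by (intro set_integrable_mult_right) auto
      qed
      show "set_integrable lborel {x..y} g" unfolding geq using i1 i2 by (rule set_integral_add)
      have "(LINT x:{x..y}|lborel. g x) = (LINT x:{x..y}|lborel. complex_of_real (g1 x)) + (LINT x:{x..y}|lborel. \<i> * complex_of_real (g2 x))"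
        unfolding geq using i1 i2 by (rule set_integral_add)
      also have "\<dots> = f (cl y) - f (cl x)"
        using 1 2 by (simp add: set_integral_complex_of_real complex_eq_iff)
      finally show "(LINT x:{x..y}|lborel. g x) = f (cl y) - f (cl x)" .
    qed
    have ends: "cl s = s" "cl t = t" using st unfolding cl_def by auto
    have "AE x in lebesgue. s < x \<and> x < t \<longrightarrow> (f has_vector_derivative g x) (at x)"
      using density_vector_derivative[OF gd]
    proof eventually_elim
      case (elim x)
      show ?case
      proof
        assume x: "s < x \<and> x < t"
        show "(f has_vector_derivative g x) (at x)"
        proof (rule has_vector_derivative_transform_within_open[OF elim])
          show "open {s<..<t}" "x \<in> {s<..<t}" using x by auto
          show "f (cl y) = f y" if "y \<in> {s<..<t}" for y using that by (auto simp: cl_def)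
        qed
      qed
    qed
    moreover have "g \<in> borel_measurable borel" "set_integrable lborel {s..t} g"
      using gd st(2) unfolding has_density_def by simp_all
    moreover have "(LINT x:{s..t}|lborel. g x) = f t - f s"
    proof -
      have "(LINT x:{s..t}|lborel. g x) = f (cl t) - f (cl s)"
        using gd st(2) unfolding has_density_def by simp
      then show ?thesis by (simp only: ends)
    qed
    ultimately show ?thesis by (intro exI[of _ g] conjI)
  qed
  then show ?thesis using \<delta> by blast
qed

text \<open>The local statement \<open>abs_cont_local\<close> is additive in the interval, so a compactness argument
  extends it.\<close>

proposition abs_cont_FTC:
  assumes ac: "abs_cont f" and "a \<le> b"
  shows "(\<lambda>x. vector_derivative f (at x)) absolutely_integrable_on {a..b} \<and>
    integral {a..b} (\<lambda>x. vector_derivative f (at x)) = f b - f a"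
  using \<open>a \<le> b\<close>
proof (induction rule: Bolzano)
  case (trans a b c)
  let ?f = "\<lambda>x. vector_derivative f (at x)"
  have ab: "?f integrable_on {a..b}" "(\<lambda>x. cmod (?f x)) integrable_on {a..b}"
    and bc: "?f integrable_on {b..c}" "(\<lambda>x. cmod (?f x)) integrable_on {b..c}"
    using trans unfolding absolutely_integrable_on_def by auto
  have ac: "?f integrable_on {a..c}" "(\<lambda>x. cmod (?f x)) integrable_on {a..c}"
    using Henstock_Kurzweil_Integration.integrable_combine[OF trans(3,4) ab(1) bc(1)]
      Henstock_Kurzweil_Integration.integrable_combine[OF trans(3,4) ab(2) bc(2)] by auto
  moreover have "integral {a..c} ?f = f c - f a"
    using Henstock_Kurzweil_Integration.integral_combine[OF trans(3,4) ac(1)] trans by simp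
  ultimately show ?case unfolding absolutely_integrable_on_def by auto
next
  case (local x)
  have "abs_cont_on (x - 1) (x + 1) f" using ac unfolding abs_cont_def by auto
  from abs_cont_local[OF this] obtain \<delta> where \<delta>: "0 < \<delta>"
    and H: "\<And>s t. x - 1 \<le> s \<and> s \<le> t \<and> t \<le> x + 1 \<and> t - s < \<delta> \<Longrightarrow>
     \<exists>g. g \<in> borel_measurable borel \<and> set_integrable lborel {s..t} g \<and>
        (LINT x:{s..t}|lborel. g x) = f t - f s \<and>
        (AE x in lebesgue. s < x \<and> x < t \<longrightarrow> (f has_vector_derivative g x) (at x))" by auto
  have "\<forall>s t. s \<le> x \<and> x \<le> t \<and> t - s < min 1 \<delta> \<longrightarrow>
      (\<lambda>x. vector_derivative f (at x)) absolutely_integrable_on {s..t} \<and>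
      integral {s..t} (\<lambda>x. vector_derivative f (at x)) = f t - f s"
  proof (intro allI impI)
    fix s t assume st: "s \<le> x \<and> x \<le> t \<and> t - s < min 1 \<delta>"
    obtain g where g: "g \<in> borel_measurable borel" "set_integrable lborel {s..t} g"
        "(LINT x:{s..t}|lborel. g x) = f t - f s"
        "AE x in lebesgue. s < x \<and> x < t \<longrightarrow> (f has_vector_derivative g x) (at x)"
      using H[of s t] st by auto
    from g(4) obtain N where N: "N \<in> null_sets lebesgue"
      "\<And>x. x \<notin> N \<Longrightarrow> s < x \<and> x < t \<longrightarrow> (f has_vector_derivative g x) (at x)"
      by (auto elim!: AE_E3)
    have neg: "negligible (N \<union> {s, t})"
      using N(1) negligible_iff_null_sets by (intro negligible_Un) auto
    have eq: "vector_derivative f (at x) = g x" if "x \<in> {s..t} - (N \<union> {s, t})" for x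
      using N(2)[of x] that by (intro vector_derivative_at) auto
    have gi: "g absolutely_integrable_on {s..t}"
      using g(2) unfolding set_integrable_def by (rule integrable_completion[THEN iffD2, rotated]) (use g(1) in measurable)
    have "(\<lambda>x. vector_derivative f (at x)) absolutely_integrable_on {s..t}"
      using absolutely_integrable_spike[OF gi neg] eq by simp
    moreover have "integral {s..t} (\<lambda>x. vector_derivative f (at x)) = integral {s..t} g"
      by (rule integral_spike[OF neg]) (use eq in auto)
    moreover have "integral {s..t} g = f t - f s"
      using set_borel_integral_eq_integral(2)[OF g(2)] g(3) by simp
    ultimately show "(\<lambda>x. vector_derivative f (at x)) absolutely_integrable_on {s..t} \<and>
      integral {s..t} (\<lambda>x. vector_derivative f (at x)) = f t - f s" by simp
  qed
  moreover have "0 < min 1 \<delta>" using \<delta> by simp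
  ultimately show ?case by blast
qed

section \<open>Factorizations and the direct inequality\<close>

text \<open>As \<open>V\<close> has integral one, the left-hand side is the integral of \<open>V s * (F x - F (x + d * s))\<close>. The increment
  is an integral of \<open>g\<close> between the two points, and exchanging the integrals collects the tails of
  \<open>V\<close>.\<close>

lemma density_tail_identity:
  fixes F g :: "real \<Rightarrow> complex"
  assumes V: "decays (M + 2) V" and V1: "(LINT t|lborel. V t) = 1"
    and Fg: "has_density F g" and F: "F \<in> wL1 N" and g: "g \<in> wL1 N" and "N \<le> M" and d: "0 < d"
  shows "F x - dconv d V F x = of_real d * dconv d (tail_kernel V) g x"
proof -
  note [measurable] = decays_measurable[OF V] wL1_measurable[OF F] wL1_measurable[OF g]
  let ?\<phi> = "\<lambda>s t. indicator {s. s < t \<and> t < 0} s - indicator {s. 0 < t \<and> t < s} s :: real"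
  have iV: "integrable lborel V" by (rule decays_integrable[OF V]) simp
  obtain C where C: "0 \<le> C" "\<And>t. (LINT s|lborel. \<bar>V s * ?\<phi> s t\<bar>) \<le> C * weight M t"
    using tail_abs_bound[OF V] by blast
  have diff: "F x - F (x + d * s) = of_real d * (LINT t|lborel. of_real (?\<phi> s t) * g (x + d * t))" for s
  proof (cases "0 \<le> s")
    case True
    then have "x \<le> x + d * s" using d by simp
    then have "(LINT y:{x..x + d * s}|lborel. g y) = F (x + d * s) - F x"
      using Fg unfolding has_density_def by blast
    moreover have "(LINT y:{x..x + d * s}|lborel. g y) = d *\<^sub>R (LINT t|lborel. indicator {x..x + d * s} (x + d * t) *\<^sub>R g (x + d * t))"
      unfolding set_lebesgue_integral_def using d
      by (subst lborel_integral_real_affine[where c = d and t = x]) auto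
    moreover have "(LINT t|lborel. indicator {x..x + d * s} (x + d * t) *\<^sub>R g (x + d * t))
        = (LINT t|lborel. - (of_real (?\<phi> s t) * g (x + d * t)))"
    proof (rule integral_cong_AE)
      show "AE t in lborel. indicator {x..x + d * s} (x + d * t) *\<^sub>R g (x + d * t) = - (of_real (?\<phi> s t) * g (x + d * t))"
        using AE_lborel_singleton[of 0] AE_lborel_singleton[of s]
        by eventually_elim (use True d in \<open>auto simp: indicator_def zero_le_mult_iff mult_le_cancel_left_pos\<close>)
    qed measurable
    ultimately have "F (x + d * s) - F x = - (of_real d * (LINT t|lborel. of_real (?\<phi> s t) * g (x + d * t)))"
      by (simp add: scaleR_conv_of_real)
    then show ?thesis by (simp add: algebra_simps)
  next
    case False
    then have "x + d * s \<le> x" using d by (simp add: mult_le_0_iff)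
    then have "(LINT y:{x + d * s..x}|lborel. g y) = F x - F (x + d * s)"
      using Fg unfolding has_density_def by blast
    moreover have "(LINT y:{x + d * s..x}|lborel. g y) = d *\<^sub>R (LINT t|lborel. indicator {x + d * s..x} (x + d * t) *\<^sub>R g (x + d * t))"
      unfolding set_lebesgue_integral_def using d
      by (subst lborel_integral_real_affine[where c = d and t = x]) auto
    moreover have "(LINT t|lborel. indicator {x + d * s..x} (x + d * t) *\<^sub>R g (x + d * t))
        = (LINT t|lborel. of_real (?\<phi> s t) * g (x + d * t))"
    proof (rule integral_cong_AE)
      show "AE t in lborel. indicator {x + d * s..x} (x + d * t) *\<^sub>R g (x + d * t) = of_real (?\<phi> s t) * g (x + d * t)"
        using AE_lborel_singleton[of 0] AE_lborel_singleton[of s]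
        by eventually_elim (use False d in \<open>auto simp: indicator_def mult_le_0_iff mult_le_cancel_left_pos\<close>)
    qed measurable
    ultimately show ?thesis by (simp add: scaleR_conv_of_real)
  qed
  have int: "integrable (lborel \<Otimes>\<^sub>M lborel) (\<lambda>(t, s). of_real (V s * ?\<phi> s t) * g (x + d * t))"
  proof (rule lborel_pair.Fubini_integrable)
    show "(\<lambda>(t, s). of_real (V s * ?\<phi> s t) * g (x + d * t)) \<in> borel_measurable (lborel \<Otimes>\<^sub>M lborel)" by measurable
    have iS: "integrable lborel (\<lambda>s. V s * ?\<phi> s t)" for t
      by (rule Bochner_Integration.integrable_bound[OF iV]) (auto simp: indicator_def)
    have "integrable lborel (\<lambda>s. complex_of_real (V s * ?\<phi> s t) * g (x + d * t))" for t
      by (intro integrable_mult_left integrable_of_real iS)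
    then show "AE t in lborel. integrable lborel (\<lambda>s. case (t, s) of (t, s) \<Rightarrow> complex_of_real (V s * ?\<phi> s t) * g (x + d * t))"
      by simp
    have nrm: "(LINT s|lborel. norm (case (t, s) of (t, s) \<Rightarrow> complex_of_real (V s * ?\<phi> s t) * g (x + d * t)))
        = (LINT s|lborel. \<bar>V s * ?\<phi> s t\<bar>) * cmod (g (x + d * t))" for t
      unfolding prod.case norm_mult norm_of_real by (rule integral_mult_left_zero)
    show "integrable lborel (\<lambda>t. LINT s|lborel. norm (case (t, s) of (t, s) \<Rightarrow> complex_of_real (V s * ?\<phi> s t) * g (x + d * t)))"
      unfolding nrm
    proof (rule Bochner_Integration.integrable_bound)
      show "integrable lborel (\<lambda>t. C * (weight N t * cmod (g (x + d * t))))"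
        using wL1_affine_integrable[OF g d] by simp
      show "AE t in lborel. norm ((LINT s|lborel. \<bar>V s * ?\<phi> s t\<bar>) * cmod (g (x + d * t)))
          \<le> norm (C * (weight N t * cmod (g (x + d * t))))"
      proof (rule AE_I2)
        fix t
        have nn: "0 \<le> (LINT s|lborel. \<bar>V s * ?\<phi> s t\<bar>)" by (rule integral_nonneg_AE) simp
        have "(LINT s|lborel. \<bar>V s * ?\<phi> s t\<bar>) \<le> C * weight N t"
          using C(2)[of t] mult_left_mono[OF weight_antimono[OF \<open>N \<le> M\<close>] C(1), of t] by linarith
        then have "(LINT s|lborel. \<bar>V s * ?\<phi> s t\<bar>) * cmod (g (x + d * t)) \<le> (C * weight N t) * cmod (g (x + d * t))"
          by (rule mult_right_mono) simp
        then show "norm ((LINT s|lborel. \<bar>V s * ?\<phi> s t\<bar>) * cmod (g (x + d * t)))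
          \<le> norm (C * (weight N t * cmod (g (x + d * t))))"
          using nn C(1) unfolding norm_mult by simp
      qed
    qed measurable
  qed
  have iVF: "integrable lborel (\<lambda>s. of_real (V s) * F (x + d * s))"
    by (rule dconv_integrable[OF F V d]) (use \<open>N \<le> M\<close> in simp)
  have iVx: "integrable lborel (\<lambda>s. of_real (V s) * F x)"
    using iV by (intro integrable_mult_left integrable_of_real)
  have "(LINT s|lborel. of_real (V s) * F x) = F x"
    using V1 by (simp add: integral_complex_of_real)
  then have "F x - dconv d V F x = (LINT s|lborel. of_real (V s) * F x) - (LINT s|lborel. of_real (V s) * F (x + d * s))"
    unfolding dconv_def by simp
  also have "\<dots> = (LINT s|lborel. of_real (V s) * (F x - F (x + d * s)))"
    unfolding right_diff_distrib by (rule Bochner_Integration.integral_diff[OF iVx iVF, symmetric])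
  also have "\<dots> = (LINT s|lborel. of_real d * (LINT t|lborel. of_real (V s * ?\<phi> s t) * g (x + d * t)))"
  proof (rule Bochner_Integration.integral_cong[OF refl])
    fix s
    have "of_real (V s) * (F x - F (x + d * s)) = of_real d * (of_real (V s) * (LINT t|lborel. of_real (?\<phi> s t) * g (x + d * t)))"
      unfolding diff by (simp only: mult.left_commute)
    also have "of_real (V s) * (LINT t|lborel. of_real (?\<phi> s t) * g (x + d * t)) = (LINT t|lborel. of_real (V s) * (of_real (?\<phi> s t) * g (x + d * t)))"
      by (rule integral_mult_right_zero[symmetric])
    finally show "of_real (V s) * (F x - F (x + d * s)) = of_real d * (LINT t|lborel. of_real (V s * ?\<phi> s t) * g (x + d * t))"
      by (simp only: of_real_mult mult.assoc)
  qed
  also have "\<dots> = of_real d * (LINT s|lborel. LINT t|lborel. of_real (V s * ?\<phi> s t) * g (x + d * t))"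
    by (rule integral_mult_right_zero)
  also have "(LINT s|lborel. LINT t|lborel. of_real (V s * ?\<phi> s t) * g (x + d * t))
      = (LINT t|lborel. LINT s|lborel. of_real (V s * ?\<phi> s t) * g (x + d * t))"
    by (rule lborel_pair.Fubini_integral) (use int in simp)
  also have "\<dots> = dconv d (tail_kernel V) g x"
    unfolding dconv_def
  proof (rule Bochner_Integration.integral_cong[OF refl])
    fix t
    have "(LINT s|lborel. of_real (V s * ?\<phi> s t) * g (x + d * t)) = (LINT s|lborel. complex_of_real (V s * ?\<phi> s t)) * g (x + d * t)"
      by (rule integral_mult_left_zero)
    also have "(LINT s|lborel. complex_of_real (V s * ?\<phi> s t)) = of_real (tail_kernel V t)"
      unfolding tail_kernel_def by (rule integral_complex_of_real)
    finally show "(LINT s|lborel. of_real (V s * ?\<phi> s t) * g (x + d * t)) = of_real (tail_kernel V t) * g (x + d * t)" .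
  qed
  finally show ?thesis .
qed

text \<open>A primitive grows at most like \<open>(1 + \<bar>x\<bar>) ^ N\<close>; two more orders make it integrable.\<close>

lemma density_wL1:
  fixes F g :: "real \<Rightarrow> complex"
  assumes Fg: "has_density F g" and g: "g \<in> wL1 N" and [measurable]: "F \<in> borel_measurable borel"
  shows "F \<in> wL1 (N + 2)"
proof -
  define J where "J = (LINT t|lborel. weight N t * cmod (g t))"
  have gi: "integrable lborel (\<lambda>t. weight N t * cmod (g t))" using g by (simp add: wL1_def)
  have bound: "cmod (F t - F s) \<le> (1 + r) ^ N * J" if "s \<le> t" "\<And>y. s \<le> y \<Longrightarrow> y \<le> t \<Longrightarrow> \<bar>y\<bar> \<le> r" for s t r
  proof -
    have "F t - F s = (LINT y|lborel. indicator {s..t} y *\<^sub>R g y)"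
      using Fg that unfolding has_density_def set_lebesgue_integral_def by simp
    then have "cmod (F t - F s) \<le> (LINT y|lborel. cmod (indicator {s..t} y *\<^sub>R g y))"
      using integral_norm_bound[of lborel "\<lambda>y. indicator {s..t} y *\<^sub>R g y"] by simp
    also have "\<dots> \<le> (LINT y|lborel. (1 + r) ^ N * (weight N y * cmod (g y)))"
    proof (rule Bochner_Integration.integral_mono_AE')
      have r: "0 \<le> r" using that(2)[of s] that(1) by simp
      have "cmod (indicator {s..t} y *\<^sub>R g y) \<le> (1 + r) ^ N * (weight N y * cmod (g y))" for y
      proof (cases "y \<in> {s..t}")
        case True
        then have "(1 + \<bar>y\<bar>) ^ N \<le> (1 + r) ^ N" using that(2)[of y] by (intro power_mono) auto
        then have "1 \<le> (1 + r) ^ N * weight N y" unfolding weight_def by (simp add: zero_less_power)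
        then have "1 * cmod (g y) \<le> ((1 + r) ^ N * weight N y) * cmod (g y)" by (rule mult_right_mono) simp
        then show ?thesis using True by (simp add: mult.assoc)
      qed (use r in simp)
      then show "AE y in lborel. cmod (indicator {s..t} y *\<^sub>R g y) \<le> (1 + r) ^ N * (weight N y * cmod (g y))" by simp
      show "AE y in lborel. 0 \<le> (1 + r) ^ N * (weight N y * cmod (g y))" using r by simp
    qed (use gi in simp)
    also have "\<dots> = (1 + r) ^ N * J" unfolding J_def by simp
    finally show ?thesis .
  qed
  have Fb: "cmod (F x) \<le> cmod (F 0) + (1 + \<bar>x\<bar>) ^ N * J" for x
  proof -
    have "cmod (F x - F 0) \<le> (1 + \<bar>x\<bar>) ^ N * J"
    proof (cases "0 \<le> x")
      case True
      then show ?thesis by (intro bound) auto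
    next
      case False
      then have "cmod (F 0 - F x) \<le> (1 + \<bar>x\<bar>) ^ N * J" by (intro bound) auto
      then show ?thesis by (simp add: norm_minus_commute)
    qed
    then show ?thesis using norm_triangle_ineq[of "F x - F 0" "F 0"] by simp
  qed
  have "integrable lborel (\<lambda>x. (cmod (F 0) + J) * weight 2 x)" using integrable_weight[of 2] by simp
  then have "integrable lborel (\<lambda>x. weight (N + 2) x * cmod (F x))"
  proof (rule Bochner_Integration.integrable_bound)
    show "AE x in lborel. norm (weight (N + 2) x * cmod (F x)) \<le> norm ((cmod (F 0) + J) * weight 2 x)"
    proof (rule AE_I2)
      fix x
      have J0: "0 \<le> J" unfolding J_def by (rule integral_nonneg_AE) simp
      have "weight (N + 2) x * cmod (F x) \<le> weight (N + 2) x * (cmod (F 0) + (1 + \<bar>x\<bar>) ^ N * J)"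
        by (intro mult_left_mono Fb) simp
      also have "\<dots> = weight (N + 2) x * cmod (F 0) + weight (N + 2) x * (1 + \<bar>x\<bar>) ^ N * J"
        by (simp only: distrib_left mult.assoc)
      also have "weight (N + 2) x * (1 + \<bar>x\<bar>) ^ N = weight 2 x" by (rule weight_mult_power)
      also have "weight (N + 2) x * cmod (F 0) \<le> weight 2 x * cmod (F 0)"
        by (intro mult_right_mono weight_antimono) auto
      finally have "weight (N + 2) x * cmod (F x) \<le> (cmod (F 0) + J) * weight 2 x"
        by (simp only: distrib_right mult.commute)
      moreover have "0 \<le> weight (N + 2) x * cmod (F x)" "0 \<le> (cmod (F 0) + J) * weight 2 x" using J0 by auto
      ultimately show "norm (weight (N + 2) x * cmod (F x)) \<le> norm ((cmod (F 0) + J) * weight 2 x)"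
        unfolding real_norm_def by (simp only: abs_of_nonneg)
    qed
  qed measurable
  then show ?thesis unfolding wL1_def by simp
qed

text \<open>The operators \<open>I - V\<close>, \<open>I - T\<close> and \<open>I + K\<close> have \<open>a = 1\<close>; the case \<open>a = 0\<close> covers the tail operator.\<close>

definition multiplier :: "real \<Rightarrow> real \<Rightarrow> (real \<Rightarrow> real) \<Rightarrow> (real \<Rightarrow> complex) \<Rightarrow> real \<Rightarrow> complex" where
  "multiplier d a K h = (\<lambda>x. of_real a * h x + dconv d K h x)"

lemma multiplier_wL1:
  assumes "f \<in> wL1 N" "decays M K" "0 < d" "N + 2 \<le> M"
  shows "multiplier d a K f \<in> wL1 N"
  unfolding multiplier_def using assms by (intro wL1_add wL1_cmult dconv_wL1) auto

lemma multiplier_iter_wL1: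
  assumes "f \<in> wL1 N" "decays M K" "0 < d" "N + 2 \<le> M"
  shows "(multiplier d a K ^^ n) f \<in> wL1 N"
  using assms by (induction n) (auto intro: multiplier_wL1)

lemma multiplier_cmult: "multiplier d a K (\<lambda>x. c * f x) = (\<lambda>x. c * multiplier d a K f x)"
  unfolding multiplier_def dconv_cmult by (simp add: algebra_simps)

lemma multiplier_iter_cmult: "(multiplier d a K ^^ n) (\<lambda>x. c * f x) = (\<lambda>x. c * (multiplier d a K ^^ n) f x)"
  by (induction n) (simp_all add: multiplier_cmult)

lemma multiplier_commute:
  assumes f: "f \<in> wL1 N" and K: "decays M K" and L: "decays M L" and d: "0 < d" and NM: "N + 2 \<le> M"
  shows "multiplier d a K (multiplier d b L f) = multiplier d b L (multiplier d a K f)"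
proof
  fix x
  have NM': "N \<le> M" using NM by simp
  have fX: "(\<lambda>x. of_real c * f x) \<in> wL1 N" for c using f by (rule wL1_cmult)
  have KX: "dconv d K f \<in> wL1 N" "dconv d L f \<in> wL1 N" using assms by (auto intro: dconv_wL1)
  show "multiplier d a K (multiplier d b L f) x = multiplier d b L (multiplier d a K f) x"
    unfolding multiplier_def dconv_add[OF fX KX(2) K d NM'] dconv_add[OF fX KX(1) L d NM'] dconv_cmult
      dconv_commute[OF f K L d NM]
    by (simp add: algebra_simps)
qed

lemma multiplier_commute_iter:
  assumes f: "f \<in> wL1 N" and K: "decays M K" and L: "decays M L" and d: "0 < d" and NM: "N + 2 \<le> M"
  shows "multiplier d a K ((multiplier d b L ^^ n) f) = (multiplier d b L ^^ n) (multiplier d a K f)"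
proof (induction n)
  case (Suc n)
  show ?case
    using multiplier_commute[OF multiplier_iter_wL1[OF f L d NM] K L d NM] Suc by simp
qed simp

lemma decays_uminus: "decays M K \<Longrightarrow> decays M (\<lambda>t. - K t)"
  unfolding decays_def by auto

lemma dconv_uminus: "dconv d (\<lambda>t. - K t) f x = - dconv d K f x"
  unfolding dconv_def by simp

text \<open>The identity \<open>I - V = (I + K) (I - T)\<close>, read off from the kernels.\<close>

lemma renewal_factorization:
  assumes K: "decays M K" and V: "decays M V" and rel: "\<And>s. convolution unit_box K s = K s - unit_box s + V s"
    and f: "f \<in> wL1 N" and d: "0 < d" and NM: "N + 2 \<le> M"
  shows "multiplier d 1 K (multiplier d 1 (\<lambda>t. - unit_box t) f) = multiplier d 1 (\<lambda>t. - V t) f"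
proof
  fix x
  have NM': "N \<le> M" using NM by simp
  have B: "decays M unit_box" by (rule unit_box_decays)
  have BX: "dconv d unit_box f \<in> wL1 N" by (rule dconv_wL1[OF f B d NM])
  have "dconv d K (dconv d unit_box f) x = dconv d (convolution unit_box K) f x"
    using dconv_commute[OF f B K d NM] dconv_convolution[OF f K B d NM] by simp
  also have "convolution unit_box K = (\<lambda>s. K s - (unit_box s - V s))" using rel by (auto simp: fun_eq_iff)
  also have "dconv d (\<lambda>s. K s - (unit_box s - V s)) f x = dconv d K f x - (dconv d unit_box f x - dconv d V f x)"
  proof -
    have "decays M (\<lambda>s. unit_box s - V s)"
    proof -
      obtain c1 where c1: "\<And>t. \<bar>unit_box t\<bar> \<le> c1 * weight M t" using decays_bound[OF B] by blast
      obtain c2 where c2: "\<And>t. \<bar>V t\<bar> \<le> c2 * weight M t" using decays_bound[OF V] by blast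
      have "\<bar>unit_box t - V t\<bar> \<le> (c1 + c2) * weight M t" for t
        using c1[of t] c2[of t] abs_triangle_ineq4[of "unit_box t" "V t"]
        unfolding distrib_right by linarith
      moreover have "(\<lambda>s. unit_box s - V s) \<in> borel_measurable borel"
        using decays_measurable[OF V] by simp
      ultimately show ?thesis unfolding decays_def by blast
    qed
    then show ?thesis
      using dconv_kernel_diff[OF f K _ d NM'] dconv_kernel_diff[OF f B V d NM'] by simp
  qed
  finally have E: "dconv d K (dconv d unit_box f) x = dconv d K f x - (dconv d unit_box f x - dconv d V f x)" .
  have "multiplier d 1 (\<lambda>t. - unit_box t) f = (\<lambda>x. f x - dconv d unit_box f x)"
    unfolding multiplier_def dconv_uminus by simp
  then show "multiplier d 1 K (multiplier d 1 (\<lambda>t. - unit_box t) f) x = multiplier d 1 (\<lambda>t. - V t) f x"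
    unfolding multiplier_def[of d 1 K] multiplier_def[of d 1 "\<lambda>t. - V t"] dconv_uminus
    using dconv_diff[OF f BX K d NM', of x] E by simp
qed

lemma iterated_factorization:
  assumes R: "\<And>f. f \<in> wL1 N \<Longrightarrow> multiplier d 1 K (multiplier d 1 L f) = multiplier d 1 V f"
    and K: "decays M K" and L: "decays M L" and V: "decays M V"
    and f: "f \<in> wL1 N" and d: "0 < d" and NM: "N + 2 \<le> M"
  shows "(multiplier d 1 V ^^ k) f = (multiplier d 1 K ^^ k) ((multiplier d 1 L ^^ k) f)"
proof (induction k)
  case (Suc k)
  have LX: "(multiplier d 1 L ^^ k) f \<in> wL1 N" by (rule multiplier_iter_wL1[OF f L d NM])
  have "(multiplier d 1 V ^^ Suc k) f = multiplier d 1 V ((multiplier d 1 K ^^ k) ((multiplier d 1 L ^^ k) f))" using Suc by simp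
  also have "\<dots> = (multiplier d 1 K ^^ k) (multiplier d 1 V ((multiplier d 1 L ^^ k) f))"
    by (rule multiplier_commute_iter[OF LX V K d NM])
  also have "multiplier d 1 V ((multiplier d 1 L ^^ k) f) = multiplier d 1 K (multiplier d 1 L ((multiplier d 1 L ^^ k) f))"
    by (rule R[OF LX, symmetric])
  finally show ?case by (simp add: funpow_swap1)
qed simp

text \<open>If \<open>f - R f = V h\<close>, where \<open>R\<close> is the \<open>n\<close>-th power of \<open>I - V\<close>, then \<open>f - (I - V) R f = V (h + R f)\<close>.\<close>

lemma remainder_is_dconv:
  assumes V: "decays M V" and f: "f \<in> wL1 N" and d: "0 < d" and NM: "N + 2 \<le> M"
  shows "\<exists>h\<in>wL1 N. \<forall>x. f x - (multiplier d 1 (\<lambda>t. - V t) ^^ n) f x = dconv d V h x"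
proof (induction n)
  case 0
  show ?case
  proof (rule bexI[of _ "\<lambda>x. 0 * f x"])
    show "(\<lambda>x. 0 * f x) \<in> wL1 N" using f by (rule wL1_cmult)
  qed (simp add: dconv_def)
next
  case (Suc n)
  then obtain h where h: "h \<in> wL1 N" "\<And>x. f x - (multiplier d 1 (\<lambda>t. - V t) ^^ n) f x = dconv d V h x" by blast
  define u where "u = (multiplier d 1 (\<lambda>t. - V t) ^^ n) f"
  have uX: "u \<in> wL1 N" unfolding u_def by (rule multiplier_iter_wL1[OF f decays_uminus[OF V] d NM])
  have "f x - multiplier d 1 (\<lambda>t. - V t) u x = dconv d V (\<lambda>x. h x + u x) x" for x
    using h(2)[of x] dconv_add[OF h(1) uX V d, of x] NM unfolding multiplier_def dconv_uminus u_def[symmetric] by simp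
  then show ?case using wL1_add[OF h(1) uX] unfolding u_def by auto
qed

context log_hoelder begin

lemma modular_dom_uminus: "modular_dom D h f \<Longrightarrow> modular_dom D (\<lambda>x. - h x) f"
proof -
  assume D: "modular_dom D h f"
  have "modular p (\<lambda>y. - h y / of_real c) = modular p (\<lambda>y. h y / of_real c)" for c :: real
    unfolding modular_def by (simp add: norm_divide)
  note eq = this
  show ?thesis
  proof (rule modular_domI)
    show "(\<lambda>x. - h x) \<in> borel_measurable lebesgue"
      using modular_dom_measurable(1)[OF D] by (rule borel_measurable_uminus)
    show "modular p (\<lambda>y. - h y / of_real (D * \<eta>)) < 1"
      if "0 < \<eta>" "modular p (\<lambda>y. f y / of_real \<eta>) < 1" for \<eta>
      unfolding eq by (rule modular_domD[OF D that])
  qed (use modular_dom_pos[OF D] modular_dom_measurable(2)[OF D] in auto)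
qed

lemma multiplier_modular_dom:
  assumes K: "decays (P + 2) K" and a: "a = 0 \<or> a = 1"
  shows "\<exists>D>0. \<forall>d>0. \<forall>f. f \<in> borel_measurable borel \<longrightarrow> modular_dom D (multiplier d a K f) f"
proof -
  obtain D where D: "0 < D" "\<And>d f. 0 < d \<Longrightarrow> f \<in> borel_measurable borel \<Longrightarrow> modular_dom D (dconv d K f) f"
    using dconv_modular_dom[OF K] by blast
  show ?thesis
  proof (cases "a = 0")
    case True
    then show ?thesis using D unfolding multiplier_def by auto
  next
    case False
    then have "multiplier d a K f = (\<lambda>x. f x + dconv d K f x)" for d f using a unfolding multiplier_def by simp
    moreover have "modular_dom (4 * (1 + D)) (\<lambda>x. f x + dconv d K f x) f"
      if "0 < d" "f \<in> borel_measurable borel" for d f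
      by (rule modular_dom_add[OF modular_dom_refl[OF borel_imp_lebesgue[OF that(2)]] D(2)[OF that]])
    ultimately show ?thesis using D(1) by (intro exI[of _ "4 * (1 + D)"]) auto
  qed
qed

lemma multiplier_measurable:
  assumes "K \<in> borel_measurable borel" "f \<in> borel_measurable borel"
  shows "multiplier d a K f \<in> borel_measurable borel"
  unfolding multiplier_def
  by (intro borel_measurable_add borel_measurable_times borel_measurable_const dconv_measurable assms)

lemma multiplier_iter_modular_dom:
  assumes K: "decays (P + 2) K" and a: "a = 0 \<or> a = 1"
  shows "\<exists>D>0. \<forall>d>0. \<forall>f. f \<in> borel_measurable borel \<longrightarrow> modular_dom D ((multiplier d a K ^^ n) f) f"
proof -
  obtain D where D: "0 < D" "\<And>d f. 0 < d \<Longrightarrow> f \<in> borel_measurable borel \<Longrightarrow> modular_dom D (multiplier d a K f) f"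
    using multiplier_modular_dom[OF assms] by blast
  have m: "(multiplier d a K ^^ n) f \<in> borel_measurable borel" if "f \<in> borel_measurable borel" for d n f
    by (induction n) (use that decays_measurable[OF K] in \<open>auto intro: multiplier_measurable\<close>)
  have "modular_dom (D ^ n) ((multiplier d a K ^^ n) f) f" if "0 < d" "f \<in> borel_measurable borel" for d f
  proof (induction n)
    case 0
    then show ?case using modular_dom_refl[OF borel_imp_lebesgue[OF that(2)]] by simp
  next
    case (Suc n)
    then show ?case using modular_dom_trans[OF D(2)[OF that(1) m[OF that(2)]] Suc] by simp
  qed
  then show ?thesis using D(1) by (intro exI[of _ "D ^ n"]) auto
qed

lemma modular_cong_AE: "AE x in lebesgue. f x = g x \<Longrightarrow> modular p f = modular p g"
  unfolding modular_def by (intro nn_integral_cong_AE) (auto elim: eventually_mono)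

lemma norm_var_cong_AE:
  assumes "AE x in lebesgue. f x = g x"
  shows "norm_var p f = norm_var p g"
proof -
  have "modular p (\<lambda>y. f y / of_real c) = modular p (\<lambda>y. g y / of_real c)" for c
    by (rule modular_cong_AE) (use assms in \<open>auto elim: eventually_mono\<close>)
  then show ?thesis unfolding norm_var_def by simp
qed

lemma Lp_cong_AE:
  assumes "AE x in lebesgue. f x = g x" "f \<in> Lp_var p" "g \<in> borel_measurable lebesgue"
  shows "g \<in> Lp_var p"
proof -
  have "modular p (\<lambda>y. f y / of_real c) = modular p (\<lambda>y. g y / of_real c)" for c
    by (rule modular_cong_AE) (use assms in \<open>auto elim: eventually_mono\<close>)
  then show ?thesis using assms unfolding Lp_var_def by auto
qed

lemma best_approx_cong_AE:
  assumes "AE x in lebesgue. f x = g x"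
  shows "best_approx \<sigma> p f = best_approx \<sigma> p g"
proof -
  have "norm_var p (\<lambda>x. f x - G (of_real x)) = norm_var p (\<lambda>x. g x - G (of_real x))" for G
    by (rule norm_var_cong_AE) (use assms in \<open>auto elim: eventually_mono\<close>)
  then show ?thesis
    unfolding best_approx_def by (intro arg_cong[where f = Inf] image_cong refl)
qed

text \<open>The set of norms is bounded below: a norm is nonnegative or, for a function outside of the space,
  the infimum of the empty set, which is one fixed real number.\<close>

lemma best_approx_le:
  assumes "G \<in> exp_type_class \<sigma> p"
  shows "best_approx \<sigma> p f \<le> norm_var p (\<lambda>x. f x - G (of_real x))"
  unfolding best_approx_def
proof (rule cInf_lower)
  show "bdd_below ((\<lambda>g. norm_var p (\<lambda>x. f x - g (of_real x))) ` exp_type_class \<sigma> p)"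
  proof (rule bdd_belowI2)
    fix g
    define S where "S = {\<eta>::real. \<eta> > 0 \<and> modular p (\<lambda>y. (f y - g (of_real y)) / of_real \<eta>) < 1}"
    have "min 0 (Inf {}) \<le> Inf S"
    proof (cases "S = {}")
      case False
      then have "0 \<le> Inf S" unfolding S_def by (intro cInf_greatest) auto
      then show ?thesis by simp
    qed simp
    then show "min 0 (Inf {}) \<le> norm_var p (\<lambda>x. f x - g (of_real x))"
      unfolding norm_var_def S_def .
  qed
qed (use assms in auto)

end

text \<open>Steklov averages do not see the values on a null set, so they can be computed from a Borel
  version.\<close>

lemma steklov_eq_dconv:
  assumes AE: "AE x in lebesgue. h x = g x" and [measurable]: "g \<in> borel_measurable borel"
    and hm: "h \<in> borel_measurable lebesgue" and d: "0 < d"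
  shows "steklov d h x = dconv d unit_box g x"
proof -
  have "AE x in lborel. h x = g x" using AE by (simp add: AE_completion_iff)
  then obtain Z where Z: "Z \<in> null_sets lborel" "{x. h x \<noteq> g x} \<subseteq> Z"
    by (auto simp: eventually_ae_filter)
  have "AE t in lborel. x + 1 * t \<notin> Z"
  proof (rule AE_borel_affine)
    have [measurable]: "Z \<in> sets borel" using Z(1) by (auto simp: null_sets_def)
    show "Measurable.pred borel (\<lambda>y. y \<notin> Z)" by measurable
    show "AE y in lborel. y \<notin> Z" by (rule AE_not_in[OF Z(1)])
  qed simp
  then have AEx: "AE t in lebesgue. h (x + t) = g (x + t)"
    unfolding AE_completion_iff by eventually_elim (use Z(2) in auto)
  have tr: "(\<lambda>t. x + t) \<in> lebesgue \<rightarrow>\<^sub>M lebesgue"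
    using lebesgue_affine_measurable[of "\<lambda>_. 1 :: real" x] by simp
  have ind: "(\<lambda>t. indicator {0..d} t :: real) \<in> borel_measurable lebesgue"
    by (rule borel_imp_lebesgue) measurable
  have "(LINT t:{0..d}|lebesgue. h (x + t)) = (LINT t|lebesgue. indicator {0..d} t *\<^sub>R g (x + t))"
    unfolding set_lebesgue_integral_def
  proof (rule integral_cong_AE)
    show "(\<lambda>t. indicator {0..d} t *\<^sub>R h (x + t)) \<in> borel_measurable lebesgue"
      by (intro borel_measurable_scaleR ind measurable_compose[OF tr hm])
    show "(\<lambda>t. indicator {0..d} t *\<^sub>R g (x + t)) \<in> borel_measurable lebesgue"
      by (rule borel_imp_lebesgue) measurable
  qed (use AEx in \<open>auto elim: eventually_mono\<close>)
  also have "\<dots> = (LINT t|lborel. indicator {0..d} t *\<^sub>R g (x + t))"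
    by (rule integral_completion) measurable
  also have "\<dots> = d *\<^sub>R (LINT t|lborel. indicator {0..d} (0 + d * t) *\<^sub>R g (x + (0 + d * t)))"
    using d by (subst lborel_integral_real_affine[where c = d and t = 0]) auto
  also have "(LINT t|lborel. indicator {0..d} (0 + d * t) *\<^sub>R g (x + (0 + d * t))) = dconv d unit_box g x"
    unfolding dconv_def using d
    by (intro Bochner_Integration.integral_cong)
       (auto simp: indicator_def zero_le_mult_iff mult_le_cancel_left_pos)
  finally show ?thesis unfolding steklov_def using d by (simp add: scaleR_conv_of_real)
qed

lemma steklov_iter_AE:
  assumes AE: "AE x in lebesgue. f x = g x" and g: "g \<in> borel_measurable borel"
    and fm: "f \<in> borel_measurable lebesgue" and d: "0 < d"
  shows "AE x in lebesgue. ((\<lambda>h x. h x - steklov d h x) ^^ k) f x = (multiplier d 1 (\<lambda>t. - unit_box t) ^^ k) g x"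
proof -
  let ?A = "\<lambda>h x. h x - steklov d h x" and ?B = "multiplier d 1 (\<lambda>t. - unit_box t)"
  have "(?A ^^ k) f \<in> borel_measurable lebesgue \<and> (?B ^^ k) g \<in> borel_measurable borel \<and>
    (AE x in lebesgue. (?A ^^ k) f x = (?B ^^ k) g x)"
  proof (induction k)
    case 0
    then show ?case using assms by simp
  next
    case (Suc k)
    define u where "u = (?A ^^ k) f"
    define v where "v = (?B ^^ k) g"
    have uv: "u \<in> borel_measurable lebesgue" "v \<in> borel_measurable borel" "AE x in lebesgue. u x = v x"
      using Suc unfolding u_def v_def by auto
    have st: "steklov d u x = dconv d unit_box v x" for x
      by (rule steklov_eq_dconv[OF uv(3,2,1) d])
    have Bv: "?B v = (\<lambda>x. v x - dconv d unit_box v x)" unfolding multiplier_def dconv_uminus by simp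
    have cm: "dconv d unit_box v \<in> borel_measurable borel" using uv(2) by (intro dconv_measurable) auto
    have "(\<lambda>x. u x - steklov d u x) \<in> borel_measurable lebesgue"
      unfolding st using uv(1) borel_imp_lebesgue[OF cm] by (rule borel_measurable_diff)
    moreover have "?B v \<in> borel_measurable borel"
      unfolding Bv using uv(2) cm by (rule borel_measurable_diff)
    moreover have "AE x in lebesgue. u x - steklov d u x = ?B v x"
      unfolding st Bv using uv(3) by (auto elim: eventually_mono)
    ultimately show ?case unfolding u_def v_def by simp
  qed
  then show ?thesis by blast
qed

lemma nth_deriv_Suc: "nth_deriv (Suc n) f = (\<lambda>x. vector_derivative (nth_deriv n f) (at x))"
  unfolding nth_deriv_def by simp

lemma abs_cont_continuous:
  assumes ac: "abs_cont f"
  shows "continuous_on UNIV f"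
  unfolding continuous_on_iff
proof (intro ballI allI impI)
  fix x e :: real assume "0 < e"
  have "abs_cont_on (x - 1) (x + 1) f" using ac unfolding abs_cont_def by simp
  then obtain \<delta> where \<delta>: "0 < \<delta>" and H: "\<And>n u v. (\<forall>i<n. x - 1 \<le> u i \<and> u i \<le> v i \<and> v i \<le> x + 1) \<Longrightarrow>
     disjoint_family_on (\<lambda>i. {u i <..< v i}) {..<n::nat} \<Longrightarrow>
     (\<Sum>i<n. v i - u i) < \<delta> \<Longrightarrow> (\<Sum>i<n. cmod (f (v i) - f (u i))) < e"
    unfolding abs_cont_on_def using \<open>0 < e\<close> by meson
  have "dist (f y) (f x) < e" if "dist y x < min 1 \<delta>" for y
  proof -
    have "x - 1 \<le> min x y \<and> min x y \<le> max x y \<and> max x y \<le> x + 1" "max x y - min x y < \<delta>"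
      using that unfolding dist_real_def by (auto simp: min_def max_def abs_if split: if_splits)
    then have "cmod (f (max x y) - f (min x y)) < e"
      using H[of 1 "\<lambda>_. min x y" "\<lambda>_. max x y"] by (simp add: disjoint_family_on_def)
    then show ?thesis
      by (cases "x \<le> y") (auto simp: max_def min_def dist_norm norm_minus_commute)
  qed
  then show "\<exists>d>0. \<forall>y\<in>UNIV. dist y x < d \<longrightarrow> dist (f y) (f x) < e"
    using \<delta> by (intro exI[of _ "min 1 \<delta>"]) auto
qed

lemma borel_version:
  fixes h :: "real \<Rightarrow> complex"
  assumes "h \<in> borel_measurable lebesgue"
  obtains g where "g \<in> borel_measurable borel" "AE x in lebesgue. h x = g x"
proof -
  have "(\<lambda>x. Re (h x)) \<in> borel_measurable lebesgue" "(\<lambda>x. Im (h x)) \<in> borel_measurable lebesgue"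
    by (rule measurable_compose[OF assms borel_measurable_Re], rule measurable_compose[OF assms borel_measurable_Im])
  then obtain a b where ab: "a \<in> borel_measurable lborel" "b \<in> borel_measurable lborel"
    and "AE x in lborel. Re (h x) = a x" "AE x in lborel. Im (h x) = b x"
    using completion_ex_borel_measurable_real by metis
  then have "AE x in lborel. h x = Complex (a x) (b x)"
    by (auto simp: complex_eq_iff elim!: eventually_elim2)
  moreover have "(\<lambda>x. Complex (a x) (b x)) \<in> borel_measurable borel"
  proof -
    have "(\<lambda>x. Complex (a x) (b x)) = (\<lambda>x. of_real (a x) + \<i> * of_real (b x))" by (simp add: complex_eq_iff fun_eq_iff)
    then show ?thesis using ab by simp
  qed
  ultimately show thesis using that by (simp add: AE_completion_iff)
qed

lemma abs_cont_has_density: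
  assumes ac: "abs_cont f" and g: "g \<in> borel_measurable borel"
    and AE: "AE x in lebesgue. vector_derivative f (at x) = g x"
  shows "has_density f g"
  unfolding has_density_def
proof (intro conjI allI impI)
  fix s t :: real assume "s \<le> t"
  let ?h = "\<lambda>x. vector_derivative f (at x)"
  have F: "?h absolutely_integrable_on {s..t}" "integral {s..t} ?h = f t - f s"
    using abs_cont_FTC[OF ac \<open>s \<le> t\<close>] by auto
  obtain Z where Z: "negligible Z" "\<And>x. x \<notin> Z \<Longrightarrow> ?h x = g x"
    using AE by (auto simp: eventually_ae_filter negligible_iff_null_sets)
  have gi: "g absolutely_integrable_on {s..t}"
    using absolutely_integrable_spike[OF F(1) Z(1), of g] Z(2) by simp
  have gm: "(\<lambda>x. indicator {s..t} x *\<^sub>R g x) \<in> borel_measurable lborel"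
    using g by simp
  then have gi': "set_integrable lborel {s..t} g"
    using gi unfolding set_integrable_def by (simp only: integrable_completion)
  then show "set_integrable lborel {s..t} g" .
  have "(LINT x:{s..t}|lborel. g x) = integral {s..t} g"
    by (rule set_borel_integral_eq_integral(2)[OF gi'])
  also have "\<dots> = integral {s..t} ?h"
    by (rule integral_spike[OF Z(1)]) (use Z(2) in auto)
  finally show "(LINT x:{s..t}|lborel. g x) = f t - f s" using F(2) by simp
qed (rule g)

lemma derivative_has_density:
  fixes f g :: "real \<Rightarrow> complex"
  assumes der: "\<And>x. (f has_vector_derivative g x) (at x)" and cont: "continuous_on UNIV g"
  shows "has_density f g"
  unfolding has_density_def
proof (intro conjI allI impI)
  show "g \<in> borel_measurable borel" by (rule borel_measurable_continuous_onI[OF cont])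
  fix s t :: real assume "s \<le> t"
  have c: "continuous_on {s..t} g" using cont continuous_on_subset by blast
  show "set_integrable lborel {s..t} g"
    unfolding set_integrable_def by (rule borel_integrable_compact[OF _ c]) simp
  show "(LINT x:{s..t}|lborel. g x) = f t - f s"
    unfolding set_lebesgue_integral_def
    by (rule integral_FTC_Icc[OF \<open>s \<le> t\<close> _ c]) (use der has_vector_derivative_at_within in blast)
qed

text \<open>Borel versions of all derivatives, linked by integration. Only the top-order derivative has to be
  changed on a null set; for \<open>r = 0\<close> this is \<open>f\<close> itself.\<close>

lemma sobolev_chain:
  assumes f: "f \<in> sobolev_var r p"
  shows "\<exists>F :: nat \<Rightarrow> real \<Rightarrow> complex.
    (AE x in lebesgue. f x = F 0 x) \<and> (AE x in lebesgue. nth_deriv r f x = F r x) \<and>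
    (\<forall>j. F j \<in> borel_measurable borel) \<and> (\<forall>j<r. has_density (F j) (F (Suc j)))"
proof (cases "r = 0")
  case True
  have "f \<in> borel_measurable lebesgue" using f unfolding sobolev_var_def Lp_var_def by blast
  then obtain g where g: "g \<in> borel_measurable borel" "AE x in lebesgue. f x = g x" by (rule borel_version)
  show ?thesis
    by (rule exI[of _ "\<lambda>_. g"]) (use g True in \<open>simp add: nth_deriv_def\<close>)
next
  case False
  then obtain m where m: "r = Suc m" by (cases r) auto
  have dif: "\<And>j x. j < m \<Longrightarrow> nth_deriv j f differentiable (at x)"
    and ac: "abs_cont (nth_deriv m f)" and Lp: "nth_deriv r f \<in> Lp_var p"
    using f False unfolding sobolev_var_def m by auto
  obtain g where g: "g \<in> borel_measurable borel" "AE x in lebesgue. nth_deriv r f x = g x"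
    using Lp borel_version unfolding Lp_var_def by blast
  have cont: "continuous_on UNIV (nth_deriv j f)" if "j \<le> m" for j
  proof (cases "j = m")
    case True
    then show ?thesis using abs_cont_continuous[OF ac] by simp
  next
    case False
    then show ?thesis using that dif
      by (intro continuous_at_imp_continuous_on ballI differentiable_imp_continuous_within) auto
  qed
  define F where "F = (\<lambda>j. if j \<le> m then nth_deriv j f else g)"
  show ?thesis
  proof (intro exI[of _ F] conjI allI impI)
    show "AE x in lebesgue. f x = F 0 x" unfolding F_def nth_deriv_def by simp
    show "AE x in lebesgue. nth_deriv r f x = F r x" using g(2) unfolding F_def m by simp
    show "F j \<in> borel_measurable borel" for j
      unfolding F_def using cont g(1) by (auto intro: borel_measurable_continuous_onI)
    show "has_density (F j) (F (Suc j))" if "j < r" for j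
    proof (cases "j = m")
      case True
      have "has_density (nth_deriv m f) g"
        by (rule abs_cont_has_density[OF ac g(1)]) (use g(2) in \<open>simp add: m nth_deriv_Suc\<close>)
      then show ?thesis unfolding F_def True by simp
    next
      case False
      then have j: "j < m" using that m by simp
      have "has_density (nth_deriv j f) (nth_deriv (Suc j) f)"
      proof (rule derivative_has_density)
        show "(nth_deriv j f has_vector_derivative nth_deriv (Suc j) f x) (at x)" for x
          unfolding nth_deriv_Suc using dif[OF j] vector_derivative_works by blast
      qed (use cont j in simp)
      then show ?thesis unfolding F_def using j by simp
    qed
  qed
qed

context log_hoelder begin

text \<open>With \<open>R = I - V\<close>, \<open>S = I + K\<close>, \<open>D = I - T\<close> and the tail operator \<open>W\<close>, the proof rests on
  \<open>R\<^sup>k = S\<^sup>k D\<^sup>k\<close> and \<open>R\<^sup>r f = d\<^sup>r W\<^sup>r f\<^sup>(\<^sup>r\<^sup>)\<close>.\<close>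

proposition jackson_inequality:
  "\<exists>C>0. \<forall>\<sigma>>0. \<forall>f \<in> sobolev_var r p.
     best_approx \<sigma> p f \<le> C * mod_smooth k p f (1 / \<sigma>) \<and>
     best_approx \<sigma> p f \<le> C / \<sigma> ^ r * mod_smooth k p (nth_deriv r f) (1 / \<sigma>)"
proof -
  (* The top-order derivative has weight order 2, and each of the r integrations adds 2. *)
  define N where "N = 2 + 2 * r"
  (* P + 2 orders of decay for boundedness on the variable exponent space, N + 2 for the algebra *)
  define M where "M = P + N + 2"
  have NM: "N + 2 \<le> M" "N \<le> M" "P + 2 \<le> M" unfolding M_def N_def by auto
  obtain Vc V Cv where Vhol: "Vc holomorphic_on UNIV" and VV: "\<And>t. Vc (of_real t) = of_real (V t)"
    and V2: "decays (M + 2) V" and V1: "(LINT t|lborel. V t) = 1" and Cv: "0 \<le> Cv"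
    and Vb: "\<And>z. cmod (Vc z) \<le> Cv * exp \<bar>Im z\<bar> * weight (M + 2) (Re z)"
    using exp_type_kernel[of "M + 2"] by blast
  have Vb': "cmod (Vc z) \<le> Cv * exp \<bar>Im z\<bar> * weight N (Re z)" for z
  proof (rule order_trans[OF Vb])
    have "weight (M + 2) (Re z) \<le> weight N (Re z)" by (rule weight_antimono) (use NM in simp)
    then show "Cv * exp \<bar>Im z\<bar> * weight (M + 2) (Re z) \<le> Cv * exp \<bar>Im z\<bar> * weight N (Re z)"
      using Cv by (intro mult_left_mono) auto
  qed
  obtain K where K: "decays M K" and rel: "\<And>s. convolution unit_box K s = K s - unit_box s + V s"
    using renewal_kernel[OF V2 V1] by blast
  have V: "decays M V" by (rule decays_mono[OF V2]) simp
  define W where "W = tail_kernel V"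
  have W: "decays M W" unfolding W_def by (rule tail_kernel_decays[OF V2])
  have nV: "decays M (\<lambda>t. - V t)" by (rule decays_uminus[OF V])
  have nB: "decays M (\<lambda>t. - unit_box t)" by (rule decays_uminus[OF unit_box_decays])
  obtain DK where DK: "0 < DK" "\<And>d f. 0 < d \<Longrightarrow> f \<in> borel_measurable borel \<Longrightarrow> modular_dom DK ((multiplier d 1 K ^^ k) f) f"
    using multiplier_iter_modular_dom[OF decays_mono[OF K NM(3)], of 1 k] by blast
  obtain DW where DW: "0 < DW" "\<And>d f. 0 < d \<Longrightarrow> f \<in> borel_measurable borel \<Longrightarrow> modular_dom DW ((multiplier d 0 W ^^ r) f) f"
    using multiplier_iter_modular_dom[OF decays_mono[OF W NM(3)], of 0 r] by blast
  define C where "C = DK + DW * DK"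
  have C: "0 < C" "DK \<le> C" "DW * DK \<le> C" unfolding C_def using DK DW by (auto intro: add_pos_pos)
  have "best_approx \<sigma> p f \<le> C * mod_smooth k p f (1 / \<sigma>) \<and>
     best_approx \<sigma> p f \<le> C / \<sigma> ^ r * mod_smooth k p (nth_deriv r f) (1 / \<sigma>)"
    if \<sigma>: "0 < \<sigma>" and f: "f \<in> sobolev_var r p" for \<sigma> f
  proof -
    define d where "d = 1 / \<sigma>"
    have d: "0 < d" unfolding d_def using \<sigma> by simp
    obtain F where F0: "AE x in lebesgue. f x = F 0 x" and Fr: "AE x in lebesgue. nth_deriv r f x = F r x"
      and Fm': "\<forall>j. F j \<in> borel_measurable borel" and chain': "\<forall>j<r. has_density (F j) (F (Suc j))"
      using sobolev_chain[OF f] by (elim exE conjE) (rule that)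
    note Fm = Fm'[THEN spec] and chain = chain'[rule_format]
    have fLp: "f \<in> Lp_var p" using f unfolding sobolev_var_def by blast
    have frLp: "nth_deriv r f \<in> Lp_var p"
      using f fLp unfolding sobolev_var_def by (cases "r = 0") (auto simp: nth_deriv_def)
    have fm: "f \<in> borel_measurable lebesgue" "nth_deriv r f \<in> borel_measurable lebesgue"
      using fLp frLp unfolding Lp_var_def by auto
    have F0Lp: "F 0 \<in> Lp_var p" by (rule Lp_cong_AE[OF F0 fLp borel_imp_lebesgue[OF Fm]])
    have FrLp: "F r \<in> Lp_var p" by (rule Lp_cong_AE[OF Fr frLp borel_imp_lebesgue[OF Fm]])
    have "F (r - i) \<in> wL1 (2 + 2 * i)" if "i \<le> r" for i
      using that
    proof (induction i)
      case 0
      then show ?case using Lp_wL1[OF FrLp Fm] by simp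
    next
      case (Suc i)
      have "has_density (F (r - Suc i)) (F (r - i))"
        using chain[of "r - Suc i"] Suc.prems by (simp add: Suc_diff_Suc)
      from density_wL1[OF this _ Fm] Suc show ?case by simp
    qed
    then have FX: "F j \<in> wL1 N" if "j \<le> r" for j
      using wL1_mono[of "F j" "2 + 2 * (r - j)" N] that unfolding N_def
      by (metis diff_diff_cancel diff_le_self add_le_cancel_left mult_le_mono2)
    let ?R = "multiplier d 1 (\<lambda>t. - V t)" and ?S = "multiplier d 1 K" and ?D = "multiplier d 1 (\<lambda>t. - unit_box t)" and ?W = "multiplier d 0 W"
    have fact: "(?R ^^ k) h = (?S ^^ k) ((?D ^^ k) h)" if "h \<in> wL1 N" for h
      by (rule iterated_factorization[OF renewal_factorization[OF K V rel _ d NM(1)] K nB nV that d NM(1)])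
    have W_step: "?R (F j) = (\<lambda>x. of_real d * ?W (F (Suc j)) x)" if "j < r" for j
      using density_tail_identity[OF V2 V1 chain[OF that] FX FX NM(2) d] that
      unfolding multiplier_def dconv_uminus W_def by auto
    have W_iter: "(?R ^^ m) (F 0) = (\<lambda>x. of_real (d ^ m) * (?W ^^ m) (F m) x)" if "m \<le> r" for m
      using that
    proof (induction m)
      case (Suc m)
      have "(?R ^^ Suc m) (F 0) = ?R (\<lambda>x. of_real (d ^ m) * (?W ^^ m) (F m) x)" using Suc by simp
      also have "\<dots> = (\<lambda>x. of_real (d ^ m) * ?R ((?W ^^ m) (F m)) x)" by (rule multiplier_cmult)
      also have "?R ((?W ^^ m) (F m)) = (?W ^^ m) (?R (F m))"
        by (rule multiplier_commute_iter[OF FX nV W d NM(1)]) (use Suc in simp)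
      also have "?R (F m) = (\<lambda>x. of_real d * ?W (F (Suc m)) x)" by (rule W_step) (use Suc in simp)
      also have "(?W ^^ m) (\<lambda>x. of_real d * ?W (F (Suc m)) x) = (\<lambda>x. of_real d * (?W ^^ m) (?W (F (Suc m))) x)"
        by (rule multiplier_iter_cmult)
      finally show ?case by (simp add: funpow_swap1 mult_ac)
    qed simp
    have Dm: "(?D ^^ k) (F j) \<in> borel_measurable borel" if "j \<le> r" for j
      using multiplier_iter_wL1[OF FX[OF that] nB d NM(1)] by (rule wL1_measurable)
    have dom0: "modular_dom DK ((?R ^^ k) (F 0)) ((?D ^^ k) (F 0))"
      unfolding fact[OF FX[OF le0]] by (rule DK(2)[OF d Dm[OF le0]])
    have domr: "modular_dom (DW * DK * d ^ r) ((?R ^^ (k + r)) (F 0)) ((?D ^^ k) (F r))"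
    proof -
      have "(?R ^^ (k + r)) (F 0) = (?R ^^ k) (\<lambda>x. of_real (d ^ r) * (?W ^^ r) (F r) x)"
        unfolding funpow_add o_def W_iter[OF order_refl] ..
      also have "\<dots> = (\<lambda>x. of_real (d ^ r) * (?R ^^ k) ((?W ^^ r) (F r)) x)" by (rule multiplier_iter_cmult)
      also have "(?R ^^ k) ((?W ^^ r) (F r)) = (?W ^^ r) ((?R ^^ k) (F r))"
      proof (induction k)
        case (Suc k)
        have "(?R ^^ Suc k) ((?W ^^ r) (F r)) = ?R ((?W ^^ r) ((?R ^^ k) (F r)))" using Suc by simp
        also have "\<dots> = (?W ^^ r) (?R ((?R ^^ k) (F r)))"
          by (rule multiplier_commute_iter[OF multiplier_iter_wL1[OF FX[OF order_refl] nV d NM(1)] nV W d NM(1)])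
        finally show ?case by simp
      qed simp
      also have "(?R ^^ k) (F r) = (?S ^^ k) ((?D ^^ k) (F r))" by (rule fact[OF FX[OF order_refl]])
      finally have eq: "(?R ^^ (k + r)) (F 0) = (\<lambda>x. of_real (d ^ r) * (?W ^^ r) ((?S ^^ k) ((?D ^^ k) (F r))) x)" .
      have "(?S ^^ k) ((?D ^^ k) (F r)) \<in> borel_measurable borel"
        using multiplier_iter_wL1[OF multiplier_iter_wL1[OF FX[OF order_refl] nB d NM(1)] K d NM(1)] by (rule wL1_measurable)
      then have "modular_dom DW ((?W ^^ r) ((?S ^^ k) ((?D ^^ k) (F r)))) ((?S ^^ k) ((?D ^^ k) (F r)))" by (rule DW(2)[OF d])
      from modular_dom_trans[OF this DK(2)[OF d Dm[OF order_refl]]]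
      have "modular_dom (DW * DK) ((?W ^^ r) ((?S ^^ k) ((?D ^^ k) (F r)))) ((?D ^^ k) (F r))" .
      from modular_dom_scale[OF this, of "d ^ r"] show ?thesis unfolding eq using d by simp
    qed
    have approx: "best_approx \<sigma> p f \<le> norm_var p ((?R ^^ n) (F 0))" for n
    proof -
      obtain h where h: "h \<in> wL1 N" "\<And>x. F 0 x - (?R ^^ n) (F 0) x = dconv d V h x"
        using remainder_is_dconv[OF V FX[OF le0] d NM(1)] by blast
      obtain G where G: "G holomorphic_on UNIV" "exp_type_le \<sigma> G" "\<And>x. G (of_real x) = dconv (1 / \<sigma>) V h x"
        using dconv_entire[OF h(1) \<sigma> Vhol VV Cv Vb'] by blast
      have GR: "G (of_real x) = F 0 x + - (?R ^^ n) (F 0) x" for x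
        using h(2)[of x] G(3)[of x] unfolding d_def[symmetric] by simp
      obtain D where D: "modular_dom D ((?R ^^ n) (F 0)) (F 0)"
        using multiplier_iter_modular_dom[OF decays_mono[OF nV NM(3)], of 1 n] d Fm by blast
      have "(\<lambda>x. G (of_real x)) \<in> Lp_var p"
        unfolding GR
        by (rule modular_dom_norm_le(1)[OF modular_dom_add[OF modular_dom_refl[OF borel_imp_lebesgue[OF Fm]] modular_dom_uminus[OF D]] F0Lp])
      then have "G \<in> exp_type_class \<sigma> p" using G unfolding exp_type_class_def by blast
      from best_approx_le[OF this, of "F 0"]
      have "best_approx \<sigma> p (F 0) \<le> norm_var p (\<lambda>x. F 0 x - G (of_real x))" .
      then show ?thesis unfolding GR best_approx_cong_AE[OF F0] by simp
    qed
    have smooth: "mod_smooth k p f (1 / \<sigma>) = norm_var p ((?D ^^ k) (F 0))"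
      unfolding mod_smooth_def d_def[symmetric]
      by (rule norm_var_cong_AE[OF steklov_iter_AE[OF F0 Fm fm(1) d]])
    have smooth_r: "mod_smooth k p (nth_deriv r f) (1 / \<sigma>) = norm_var p ((?D ^^ k) (F r))"
      unfolding mod_smooth_def d_def[symmetric]
      by (rule norm_var_cong_AE[OF steklov_iter_AE[OF Fr Fm fm(2) d]])
    have DLp: "(?D ^^ k) (F j) \<in> Lp_var p" if "F j \<in> Lp_var p" for j
    proof -
      obtain D where D: "modular_dom D ((?D ^^ k) (F j)) (F j)"
        using multiplier_iter_modular_dom[OF decays_mono[OF nB NM(3)], of 1 k] d Fm by blast
      show ?thesis by (rule modular_dom_norm_le(1)[OF D that])
    qed
    have "best_approx \<sigma> p f \<le> DK * norm_var p ((?D ^^ k) (F 0))"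
      using approx[of k] modular_dom_norm_le(2)[OF dom0 DLp[OF F0Lp]] by linarith
    also have "\<dots> \<le> C * norm_var p ((?D ^^ k) (F 0))"
      by (intro mult_right_mono C norm_var_nonneg DLp F0Lp)
    finally have 1: "best_approx \<sigma> p f \<le> C * mod_smooth k p f (1 / \<sigma>)" unfolding smooth .
    have "best_approx \<sigma> p f \<le> (DW * DK * d ^ r) * norm_var p ((?D ^^ k) (F r))"
      using approx[of "k + r"] modular_dom_norm_le(2)[OF domr DLp[OF FrLp]] by linarith
    also have "\<dots> \<le> (C * d ^ r) * norm_var p ((?D ^^ k) (F r))"
      using d by (intro mult_right_mono C norm_var_nonneg DLp FrLp) auto
    also have "C * d ^ r = C / \<sigma> ^ r" unfolding d_def by (simp add: power_divide)
    finally have 2: "best_approx \<sigma> p f \<le> C / \<sigma> ^ r * mod_smooth k p (nth_deriv r f) (1 / \<sigma>)" unfolding smooth_r .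
    from 1 2 show ?thesis by blast
  qed
  then show ?thesis using C(1) by blast
qed

end

theorem theorem5p3:
  fixes p :: "real \<Rightarrow> real" and k r :: nat
  assumes "p \<in> log_exponents" and "k \<ge> 1"
  shows "\<exists>C::real. C > 0 \<and> (\<forall>\<sigma>>0. \<forall>f \<in> sobolev_var r p.
           best_approx \<sigma> p f \<le> C * mod_smooth k p f (1 / \<sigma>) \<and>
           best_approx \<sigma> p f \<le> C / \<sigma> ^ r * mod_smooth k p (nth_deriv r f) (1 / \<sigma>))"
proof -
  obtain c1 c2 q P where "log_hoelder p c1 c2 q P"
    using log_exponents_log_hoelder[OF assms(1)] by blast
  then interpret log_hoelder p c1 c2 q P .
  show ?thesis by (rule jackson_inequality)
qed

end
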